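(* Let $K\in[1,+\infty)$ be fixed. Then the Hoffman and Karp policy iteration algorithm solves in strongly polynomial time the instances of zero-sum two-player stochastic mean-payoff games with perfect information having a distinguished state $c$ to which the mean return time is bounded by $K$ for all choices of policies of both players, i.e. such that $\mathcal T_{ic}(M^{(\sigma\delta)})\le K$ for all $i\in[n]$ and all policies $\sigma\in A_{\mathrm M}$, $\delta\in B_{\mathrm M}$.
   Context: Instance: $n\ge1$; finite nonempty action sets $A_i$, $B_i$ for $i\in[n]=\{1,\dots,n\}$; for $i,j\in[n]$, $a\in A_i$, $b\in B_i$, transition probabilities $M^{ab}_{ij}\ge0$ with $\sum_jM^{ab}_{ij}=1$ and payments $r^{ab}_i\in\mathbb{R}$. Put $f_i(v)=\min_{a\in A_i}\max_{b\in B_i}(\sum_jM^{ab}_{ij}v_j+r^{ab}_i)$. Solving the game means computing $\eta\in\mathbb{R}$ (the value of the mean payoff game, the same for all initial states) and $v\in\mathbb{R}^n$ (a bias) with $\eta+v=f(v)$, $v_c=0$, together with policies attaining the minimum and maximum; here $\eta+v=(\eta+v_i)_i$. Let $A\supseteq A_i$, $B\supseteq B_i$ for all $i$. $A_{\mathrm M}$ is the set of maps $\sigma:[n]\to A$ with $\sigma(i)\in A_i$; $B_{\mathrm M}$ is the set of maps $\delta:[n]\times A\to B$ with $\delta(i,a)\in B_i$. With $\sigma_i=\sigma(i)$, $\delta_i=\delta(i,\sigma(i))$, put $M^{(\sigma\delta)}=(M^{\sigma_i\delta_i}_{ij})_{i,j}$, $f^{(\sigma\delta)}(v)=M^{(\sigma\delta)}v+(r^{\sigma_i\delta_i}_i)_i$,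 $f^{(\sigma)}(v)=\max_\delta f^{(\sigma\delta)}(v)$ (coordinatewise), so $f=\min_\sigma f^{(\sigma)}$. For a Markov matrix $M$, $\mathcal T_{ij}(M)=\mathbb{E}[\inf\{k\ge1\mid X_k=j\}\mid X_0=i]$, where $(X_k)$ is a Markov chain with transition matrix $M$. General policy iteration algorithm for the mean payoff additive eigenproblem: (1) set $s=0$, choose $\sigma^0\in A_{\mathrm M}$ arbitrarily; (2) compute $\eta^s\in\mathbb{R}$, $v^s\in\mathbb{R}^n$ with $\eta^s+v^s=f^{(\sigma^s)}(v^s)$ and $v^s_c=0$; (3) choose $\sigma^{s+1}$ with $f(v^s)=f^{(\sigma^{s+1})}(v^s)$, taking $\sigma^{s+1}=\sigma^s$ whenever possible; (4) if $\sigma^{s+1}=\sigma^s$ stop and return $\eta^s,v^s,\sigma^s$; otherwise increment $s$ and go to (2). The Hoffman and Karp policy iteration algorithm for 2-player mean-payoff games runs this on $A_{\mathrm M},f,(f^{(\sigma)})$, computing $(\eta^s,v^s)$ in step (2) by running the same algorithm with $\max$ instead of $\min$ on $B_{\mathrm M},f^{(\sigma^s)},(f^{(\sigma^s\delta)})_\delta$, where the linear problems for $f^{(\sigma^s\delta)}$ are solved exactly by a (strongly polynomial) linear system solver. Strongly polynomial has the usual meaning: the number of arithmetic operations is bounded by a polynomial in the number of input data ($n$ and the number of triples $(i,a,b)$), independently of the numerical values, and on rational input the bit sizes of the numbers occurring are polynomially bounded in the input bit size. The constant $K$ is not part of the input. *)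

theory Defs
  imports
    "HOL-Probability.Probability"
    "HOL-Computational_Algebra.Polynomial"
    "HOL-Library.Log_Nat"
    "HOL-Library.Monad_Syntax"
begin

section \<open>Perfect-information stochastic games\<close>

text \<open>
  States are the numbers below \<open>states G\<close>, actions are natural numbers (every finite action
  set can be so encoded; a single ground type is needed to quantify over all instances inside one
  formula). In state \<open>i\<close> the minimizer picks \<open>a\<close>, then the maximizer, knowing \<open>a\<close>, picks \<open>b\<close>;
  \<open>trans G i a b j\<close> is \<open>M\<^sub>i\<^sub>j\<close> for these actions. The component \<open>centre\<close> is the distinguished
  state \<open>c\<close>.
\<close>

record game =
  states :: nat
  min_actions :: "nat \<Rightarrow> nat set"
  max_actions :: "nat \<Rightarrow> nat set"
  trans :: "nat \<Rightarrow> nat \<Rightarrow> nat \<Rightarrow> nat \<Rightarrow> real"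
  payment :: "nat \<Rightarrow> nat \<Rightarrow> nat \<Rightarrow> real"
  centre :: nat

definition valid_game :: "game \<Rightarrow> bool" where
  "valid_game G \<longleftrightarrow>
     1 \<le> states G \<and> centre G < states G \<and>
     (\<forall>i<states G. finite (min_actions G i) \<and> min_actions G i \<noteq> {} \<and>
                   finite (max_actions G i) \<and> max_actions G i \<noteq> {}) \<and>
     (\<forall>i<states G. \<forall>a\<in>min_actions G i. \<forall>b\<in>max_actions G i.
        (\<forall>j<states G. 0 \<le> trans G i a b j) \<and> (\<Sum>j<states G. trans G i a b j) = 1)"

definition min_policies :: "game \<Rightarrow> (nat \<Rightarrow> nat) set" where
  "min_policies G = (\<Pi>\<^sub>E i\<in>{..<states G}. min_actions G i)"

definition max_policies :: "game \<Rightarrow> (nat \<times> nat \<Rightarrow> nat) set" where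
  "max_policies G =
     (\<Pi>\<^sub>E (i, a)\<in>{..<states G} \<times> (\<Union>k<states G. min_actions G k). max_actions G i)"

definition policy_matrix ::
    "game \<Rightarrow> (nat \<Rightarrow> nat) \<Rightarrow> (nat \<times> nat \<Rightarrow> nat) \<Rightarrow> nat \<Rightarrow> nat \<Rightarrow> real" where
  "policy_matrix G \<sigma> \<delta> i j = trans G i (\<sigma> i) (\<delta> (i, \<sigma> i)) j"

definition local_value :: "game \<Rightarrow> (nat \<Rightarrow> real) \<Rightarrow> nat \<Rightarrow> nat \<Rightarrow> nat \<Rightarrow> real" where
  "local_value G v i a b = (\<Sum>j<states G. trans G i a b j * v j) + payment G i a b"

definition max_value :: "game \<Rightarrow> (nat \<Rightarrow> real) \<Rightarrow> nat \<Rightarrow> nat \<Rightarrow> real" where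
  "max_value G v i a = Max (local_value G v i a ` max_actions G i)"

definition shapley :: "game \<Rightarrow> (nat \<Rightarrow> real) \<Rightarrow> nat \<Rightarrow> real" where
  "shapley G v i = Min (max_value G v i ` min_actions G i)"


subsection \<open>The value of the mean-payoff game\<close>

text \<open>
  Strategies are history dependent; a history is the list of past triples (state, action of the
  minimizer, action of the maximizer). \<open>total_payment G \<alpha> \<beta> N h i\<close> is the expected sum of the next
  \<open>N\<close> payments from state \<open>i\<close> after history \<open>h\<close>.
\<close>

type_synonym history = "(nat \<times> nat \<times> nat) list"

definition min_strategies :: "game \<Rightarrow> (history \<Rightarrow> nat \<Rightarrow> nat) set" where
  "min_strategies G = {\<alpha>. \<forall>h. \<forall>i<states G. \<alpha> h i \<in> min_actions G i}"

definition max_strategies :: "game \<Rightarrow> (history \<Rightarrow> nat \<Rightarrow> nat \<Rightarrow> nat) set" where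
  "max_strategies G =
     {\<beta>. \<forall>h. \<forall>i<states G. \<forall>a\<in>min_actions G i. \<beta> h i a \<in> max_actions G i}"

primrec total_payment ::
    "game \<Rightarrow> (history \<Rightarrow> nat \<Rightarrow> nat) \<Rightarrow> (history \<Rightarrow> nat \<Rightarrow> nat \<Rightarrow> nat) \<Rightarrow>
     nat \<Rightarrow> history \<Rightarrow> nat \<Rightarrow> real" where
  "total_payment G \<alpha> \<beta> 0 h i = 0"
| "total_payment G \<alpha> \<beta> (Suc N) h i =
     (let a = \<alpha> h i; b = \<beta> h i a
      in payment G i a b +
         (\<Sum>j<states G. trans G i a b j * total_payment G \<alpha> \<beta> N (h @ [(i, a, b)]) j))"

definition mean_payoff_value :: "game \<Rightarrow> nat \<Rightarrow> real \<Rightarrow> bool" where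
  "mean_payoff_value G i \<eta> \<longleftrightarrow>
     (\<exists>\<alpha>\<in>min_strategies G. \<forall>\<beta>\<in>max_strategies G.
        limsup (\<lambda>N. ereal (total_payment G \<alpha> \<beta> N [] i / real N)) \<le> ereal \<eta>) \<and>
     (\<exists>\<beta>\<in>max_strategies G. \<forall>\<alpha>\<in>min_strategies G.
        ereal \<eta> \<le> liminf (\<lambda>N. ereal (total_payment G \<alpha> \<beta> N [] i / real N)))"

definition solution ::
    "game \<Rightarrow> real \<Rightarrow> (nat \<Rightarrow> real) \<Rightarrow> (nat \<Rightarrow> nat) \<Rightarrow> (nat \<times> nat \<Rightarrow> nat) \<Rightarrow> bool" where
  "solution G \<eta> v \<sigma> \<delta> \<longleftrightarrow>
     (\<forall>i<states G. \<eta> + v i = shapley G v i) \<and> v (centre G) = 0 \<and>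
     (\<forall>i<states G. mean_payoff_value G i \<eta>) \<and>
     \<sigma> \<in> min_policies G \<and> (\<forall>i<states G. max_value G v i (\<sigma> i) = shapley G v i) \<and>
     \<delta> \<in> max_policies G \<and>
     (\<forall>i<states G. \<forall>a\<in>min_actions G i. local_value G v i a (\<delta> (i, a)) = max_value G v i a)"


section \<open>Mean return times\<close>

text \<open>
  The Markov chain with transition matrix \<open>M\<close> on \<open>{..<n}\<close> is realized by independent random maps
  of the state space, one for each time step, the image of \<open>i\<close> having law \<open>M\<^sub>i\<^sub>\<bullet>\<close>. The lemma
  \<open>markov_chain_law\<close> below confirms that this is the Markov chain with matrix \<open>M\<close>.
\<close>

definition markov_matrix :: "nat \<Rightarrow> (nat \<Rightarrow> nat \<Rightarrow> real) \<Rightarrow> bool" where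
  "markov_matrix n M \<longleftrightarrow> (\<forall>i<n. (\<forall>j<n. 0 \<le> M i j) \<and> (\<Sum>j<n. M i j) = 1)"

definition row_pmf :: "nat \<Rightarrow> (nat \<Rightarrow> nat \<Rightarrow> real) \<Rightarrow> nat \<Rightarrow> nat pmf" where
  "row_pmf n M i = embed_pmf (\<lambda>j. if j < n then M i j else 0)"

definition random_maps :: "nat \<Rightarrow> (nat \<Rightarrow> nat \<Rightarrow> real) \<Rightarrow> (nat \<Rightarrow> nat) stream measure" where
  "random_maps n M = stream_space (measure_pmf (Pi_pmf {..<n} 0 (row_pmf n M)))"

primrec chain :: "nat \<Rightarrow> (nat \<Rightarrow> nat) stream \<Rightarrow> nat \<Rightarrow> nat" where
  "chain i \<omega> 0 = i"
| "chain i \<omega> (Suc k) = (\<omega> !! k) (chain i \<omega> k)"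

lemma pmf_row:
  assumes "markov_matrix n M" "i < n" "j < n"
  shows "pmf (row_pmf n M i) j = M i j"
proof -
  have "(\<integral>\<^sup>+ j. ennreal (if j < n then M i j else 0) \<partial>count_space UNIV) =
        (\<Sum>j<n. ennreal (M i j))"
    by (subst nn_integral_count_space'[where A = "{..<n}"]) (auto intro!: sum.cong)
  also have "\<dots> = 1"
    using assms by (subst sum_ennreal) (auto simp: markov_matrix_def)
  finally show ?thesis
    unfolding row_pmf_def using assms by (subst pmf_embed_pmf) (auto simp: markov_matrix_def)
qed

lemma chain_SCons: "chain i (f ## \<omega>) (Suc k) = chain (f i) \<omega> k"
  by (induction k) auto

lemma measurable_chain [measurable]:
  "(\<lambda>\<omega>. chain i \<omega> k) \<in> random_maps n M \<rightarrow>\<^sub>M count_space UNIV"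
proof (induction k)
  case (Suc k)
  have "(\<lambda>\<omega>. (\<omega> !! k) j) \<in> random_maps n M \<rightarrow>\<^sub>M count_space UNIV" for j
    unfolding random_maps_def
    by (rule measurable_compose[OF measurable_snth]) simp
  from measurable_compose_countable[OF this Suc] show ?case by simp
qed simp

lemma markov_chain_law:
  assumes M: "markov_matrix n M" and "\<forall>t\<le>k. x t < n"
  shows "measure (random_maps n M) {\<omega>. \<forall>t\<le>k. chain (x 0) \<omega> t = x t} =
           (\<Prod>t<k. M (x t) (x (Suc t)))"
proof -
  let ?D = "measure_pmf (Pi_pmf {..<n} 0 (row_pmf n M))"
  have sp: "space (random_maps n M) = UNIV"
    by (simp add: random_maps_def space_stream_space)
  have meas: "{\<omega>. \<forall>t\<le>k. chain i \<omega> t = y t} \<in> sets (random_maps n M)" for i y k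
  proof -
    have "{\<omega>\<in>space (random_maps n M). \<forall>t\<in>{..k}. chain i \<omega> t = y t} \<in> sets (random_maps n M)"
      by measurable
    then show ?thesis by (simp add: sp Ball_def)
  qed
  have "emeasure (random_maps n M) {\<omega>. \<forall>t\<le>k. chain (x 0) \<omega> t = x t} =
          ennreal (\<Prod>t<k. M (x t) (x (Suc t)))"
    using assms(2)
  proof (induction k arbitrary: x)
    case 0
    have "prob_space (random_maps n M)"
      unfolding random_maps_def by (rule prob_space.prob_space_stream_space[OF prob_space_measure_pmf])
    from prob_space.emeasure_space_1[OF this] show ?case by (simp add: sp)
  next
    case (Suc k)
    let ?X = "{\<omega>. \<forall>t\<le>Suc k. chain (x 0) \<omega> t = x t}"
    let ?Y = "{\<omega>. \<forall>t\<le>k. chain (x (Suc 0)) \<omega> t = x (Suc t)}"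
    have shift: "f ## \<omega> \<in> ?X \<longleftrightarrow> f (x 0) = x (Suc 0) \<and> \<omega> \<in> ?Y" for f \<omega>
    proof -
      have "f ## \<omega> \<in> ?X \<longleftrightarrow> (\<forall>t\<le>k. chain (x 0) (f ## \<omega>) (Suc t) = x (Suc t))"
        unfolding mem_Collect_eq
        by (metis Suc_le_mono bot_nat_0.extremum chain.simps(1) not0_implies_Suc)
      also have "\<dots> \<longleftrightarrow> (\<forall>t\<le>k. chain (f (x 0)) \<omega> t = x (Suc t))"
        by (simp only: chain_SCons)
      also have "\<dots> \<longleftrightarrow> f (x 0) = x (Suc 0) \<and> \<omega> \<in> ?Y"
        unfolding mem_Collect_eq using chain.simps(1) le0 by metis
      finally show ?thesis .
    qed
    have "emeasure (random_maps n M) ?X =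
            (\<integral>\<^sup>+f. emeasure (random_maps n M) {\<omega>\<in>space (random_maps n M). f ## \<omega> \<in> ?X} \<partial>?D)"
      using meas[of "Suc k" "x 0" x] unfolding random_maps_def
      by (rule prob_space.emeasure_stream_space[OF prob_space_measure_pmf])
    also have "\<dots> = (\<integral>\<^sup>+f. emeasure (random_maps n M) ?Y * indicator {f. f (x 0) = x (Suc 0)} f \<partial>?D)"
      by (intro nn_integral_cong) (unfold shift sp, auto split: split_indicator)
    also have "\<dots> = emeasure (random_maps n M) ?Y * emeasure ?D {f. f (x 0) = x (Suc 0)}"
      by (subst nn_integral_cmult) auto
    also have "emeasure ?D {f. f (x 0) = x (Suc 0)} =
                 emeasure (map_pmf (\<lambda>f. f (x 0)) (Pi_pmf {..<n} 0 (row_pmf n M))) {x (Suc 0)}"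
      by (simp add: vimage_def)
    also have "\<dots> = ennreal (M (x 0) (x (Suc 0)))"
      using Suc.prems by (subst Pi_pmf_component) (auto simp: emeasure_pmf_single pmf_row[OF M])
    also have "emeasure (random_maps n M) ?Y = ennreal (\<Prod>t<k. M (x (Suc t)) (x (Suc (Suc t))))"
      using Suc.IH[of "\<lambda>t. x (Suc t)"] Suc.prems by simp
    also have "\<dots> * ennreal (M (x 0) (x (Suc 0))) = ennreal (\<Prod>t<Suc k. M (x t) (x (Suc t)))"
    proof -
      have nonneg: "0 \<le> M (x t) (x (Suc t))" if "t \<le> k" for t
        using M Suc.prems that by (auto simp: markov_matrix_def)
      have "0 \<le> (\<Prod>t<k. M (x (Suc t)) (x (Suc (Suc t))))"
        by (intro prod_nonneg) (auto intro!: nonneg)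
      then show ?thesis
        using nonneg[of 0]
        by (subst prod.lessThan_Suc_shift) (simp add: ennreal_mult' mult.commute)
    qed
    finally show ?case .
  qed
  moreover have "0 \<le> (\<Prod>t<k. M (x t) (x (Suc t)))"
    using assms by (auto simp: markov_matrix_def intro!: prod_nonneg)
  ultimately show ?thesis by (simp add: measure_def)
qed

definition mean_return_time :: "nat \<Rightarrow> (nat \<Rightarrow> nat \<Rightarrow> real) \<Rightarrow> nat \<Rightarrow> nat \<Rightarrow> ennreal" where
  "mean_return_time n M i j =
     (\<integral>\<^sup>+\<omega>. (INF k\<in>{k. 1 \<le> k \<and> chain i \<omega> k = j}. of_nat k) \<partial>random_maps n M)"

definition bounded_return_games :: "real \<Rightarrow> game set" where
  "bounded_return_games K =
     {G. valid_game G \<and>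
         (\<forall>\<sigma>\<in>min_policies G. \<forall>\<delta>\<in>max_policies G. \<forall>i<states G.
            mean_return_time (states G) (policy_matrix G \<sigma> \<delta>) i (centre G) \<le> ennreal K)}"


section \<open>Arithmetic computations\<close>

text \<open>
  The algebraic model of computation. A program sees real numbers only through the addresses of the
  registers that hold them: it can append a rational constant or the result of an arithmetic
  operation to the memory (the continuation receives the address of the new register), and it can
  branch on the comparison of two registers. Every instruction costs one unit, and since memory is
  never overwritten, it finally holds all numbers that occurred.
\<close>

datatype arith_op = Plus | Minus | Times | Divide

primrec arith_fun :: "arith_op \<Rightarrow> real \<Rightarrow> real \<Rightarrow> real" where
  "arith_fun Plus = (+)"
| "arith_fun Minus = (-)"
| "arith_fun Times = (*)"
| "arith_fun Divide = (/)"

datatype 'x prog =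
    Return 'x
  | Const rat "nat \<Rightarrow> 'x prog"
  | Arith arith_op nat nat "nat \<Rightarrow> 'x prog"
  | Less nat nat "bool \<Rightarrow> 'x prog"

text \<open>\<open>exec p m\<close> is the result, the final memory and the number of executed instructions.\<close>

primrec exec :: "'x prog \<Rightarrow> real list \<Rightarrow> 'x \<times> real list \<times> nat" where
  "exec (Return x) = (\<lambda>m. (x, m, 0))"
| "exec (Const q k) =
     (\<lambda>m. let (x, m', t) = exec (k (length m)) (m @ [of_rat q]) in (x, m', Suc t))"
| "exec (Arith f i j k) =
     (\<lambda>m. let (x, m', t) = exec (k (length m)) (m @ [arith_fun f (m ! i) (m ! j)])
          in (x, m', Suc t))"
| "exec (Less i j k) =
     (\<lambda>m. let (x, m', t) = exec (k (m ! i < m ! j)) m in (x, m', Suc t))"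

primrec prog_bind :: "'x prog \<Rightarrow> ('x \<Rightarrow> 'y prog) \<Rightarrow> 'y prog" where
  "prog_bind (Return x) g = g x"
| "prog_bind (Const q k) g = Const q (\<lambda>a. prog_bind (k a) g)"
| "prog_bind (Arith f i j k) g = Arith f i j (\<lambda>a. prog_bind (k a) g)"
| "prog_bind (Less i j k) g = Less i j (\<lambda>b. prog_bind (k b) g)"

adhoc_overloading Monad_Syntax.bind \<rightleftharpoons> prog_bind

primrec traverse :: "('a \<Rightarrow> 'x prog) \<Rightarrow> 'a list \<Rightarrow> 'x list prog" where
  "traverse f [] = Return []"
| "traverse f (a # as) = do { x \<leftarrow> f a; xs \<leftarrow> traverse f as; Return (x # xs) }"

primrec fold_prog :: "('s \<Rightarrow> 'a \<Rightarrow> 's prog) \<Rightarrow> 's \<Rightarrow> 'a list \<Rightarrow> 's prog" where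
  "fold_prog f s [] = Return s"
| "fold_prog f s (a # as) = do { s' \<leftarrow> f s a; fold_prog f s' as }"

text \<open>
  The bit size of a rational number \<open>p/q\<close> in lowest terms: a sign and the binary digits of \<open>p\<close>
  and \<open>q\<close>.
\<close>

definition bit_size :: "real \<Rightarrow> nat" where
  "bit_size x =
     (let (p, q) = quotient_of (THE r. of_rat r = x)
      in 1 + floorlog 2 (nat \<bar>p\<bar>) + floorlog 2 (nat q))"


subsection \<open>Strongly polynomial algorithms\<close>

text \<open>
  An algorithm is given by its input data, its possible initial control states and the programs
  it executes in each control state, which return the set of admissible next control states. The
  algorithm may continue with any of these, and stops when there are none.
\<close>

record ('p, 'q) algorithm =
  input :: "'p \<Rightarrow> real list"
  start :: "'p \<Rightarrow> 'q set"
  control :: "'p \<Rightarrow> 'q \<Rightarrow> 'q set prog"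

fun step ::
    "('q \<Rightarrow> 'q set prog) \<Rightarrow> 'q \<times> real list \<times> nat \<Rightarrow> 'q \<times> real list \<times> nat \<Rightarrow> bool" where
  "step P (q, m, t) (q', m', t') \<longleftrightarrow> (\<exists>Q d. exec (P q) m = (Q, m', d) \<and> q' \<in> Q \<and> t' = t + d)"

text \<open>
  All runs are considered, whatever nondeterministic choices are made. Besides the number of
  instructions also the number of steps of a run is bounded, so every run terminates.
\<close>

definition solves_in_strongly_polynomial_time ::
    "('p, 'q) algorithm \<Rightarrow> ('p \<Rightarrow> nat) \<Rightarrow> ('p \<Rightarrow> 'q \<Rightarrow> real list \<Rightarrow> bool) \<Rightarrow> 'p set \<Rightarrow> bool" where
  "solves_in_strongly_polynomial_time alg data_count correct_output I \<longleftrightarrow>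
     (\<exists>p b :: nat poly. \<forall>G\<in>I. \<forall>q\<in>start alg G. \<forall>k q' m t.
        (step (control alg G) ^^ k) (q, input alg G, 0) (q', m, t) \<longrightarrow>
          k \<le> poly p (data_count G) \<and>
          t \<le> poly p (data_count G) \<and>
          (set (input alg G) \<subseteq> \<rat> \<longrightarrow>
             (\<forall>x\<in>set m. x \<in> \<rat> \<and>
                bit_size x \<le> poly b (sum_list (map bit_size (input alg G))))) \<and>
          ((\<nexists>s. step (control alg G) (q', m, t) s) \<longrightarrow> correct_output G q' m))"


subsection \<open>Linear system solvers\<close>

text \<open>
  A solver receives the dimension and the addresses of the coefficients and of the right-hand side,
  and returns the addresses of the solution. It is only required to work on nonsingular systems.
\<close>

type_synonym linear_solver = "nat \<Rightarrow> (nat \<Rightarrow> nat \<Rightarrow> nat) \<Rightarrow> (nat \<Rightarrow> nat) \<Rightarrow> (nat \<Rightarrow> nat) prog"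

definition nonsingular :: "nat \<Rightarrow> (nat \<Rightarrow> nat \<Rightarrow> real) \<Rightarrow> bool" where
  "nonsingular N A \<longleftrightarrow> (\<forall>y. (\<forall>i<N. (\<Sum>j<N. A i j * y j) = 0) \<longrightarrow> (\<forall>j<N. y j = 0))"

definition strongly_polynomial_solver :: "linear_solver \<Rightarrow> bool" where
  "strongly_polynomial_solver S \<longleftrightarrow>
     (\<exists>p b :: nat poly. \<forall>N A r m x m' t.
        1 \<le> N \<and> (\<forall>i<N. r i < length m \<and> (\<forall>j<N. A i j < length m)) \<and>
        nonsingular N (\<lambda>i j. m ! A i j) \<and> exec (S N A r) m = (x, m', t) \<longrightarrow>
          (\<forall>i<N. x i < length m') \<and>
          (\<forall>i<N. (\<Sum>j<N. m ! A i j * m' ! x j) = m ! r i) \<and>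
          t \<le> poly p N \<and>
          ((\<forall>i<N. m ! r i \<in> \<rat> \<and> (\<forall>j<N. m ! A i j \<in> \<rat>)) \<longrightarrow>
             (\<forall>z\<in>set (drop (length m) m'). z \<in> \<rat> \<and>
                bit_size z \<le>
                  poly b (\<Sum>i<N. bit_size (m ! r i) + (\<Sum>j<N. bit_size (m ! A i j))))))"


section \<open>The Hoffman--Karp algorithm\<close>

subsection \<open>Memory layout of the input\<close>

definition triples :: "game \<Rightarrow> (nat \<times> nat \<times> nat) list" where
  "triples G =
     [(i, a, b). i \<leftarrow> [0..<states G],
                 a \<leftarrow> sorted_list_of_set (min_actions G i),
                 b \<leftarrow> sorted_list_of_set (max_actions G i)]"

definition game_data :: "game \<Rightarrow> real list" where
  "game_data G =
     concat (map (\<lambda>(i, a, b). payment G i a b # map (trans G i a b) [0..<states G]) (triples G))"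

definition payment_addr :: "game \<Rightarrow> nat \<Rightarrow> nat \<Rightarrow> nat \<Rightarrow> nat" where
  "payment_addr G i a b =
     Suc (states G) * (LEAST k. k < length (triples G) \<and> triples G ! k = (i, a, b))"

definition trans_addr :: "game \<Rightarrow> nat \<Rightarrow> nat \<Rightarrow> nat \<Rightarrow> nat \<Rightarrow> nat" where
  "trans_addr G i a b j = payment_addr G i a b + Suc j"


subsection \<open>Policy evaluation and improvement\<close>

text \<open>
  Solves \<open>\<eta> + v = M v + r\<close>, \<open>v\<^sub>c = 0\<close> for the pair of policies, as a linear system in the unknowns
  \<open>v\<^sub>0, \<dots>, v\<^sub>n\<^sub>-\<^sub>1\<close> and \<open>\<eta>\<close> (unknown number \<open>n\<close>); equation number \<open>n\<close> is \<open>v\<^sub>c = 0\<close>. The result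
  consists of the addresses of \<open>\<eta>\<close> and \<open>v\<close>.
\<close>

definition evaluate ::
    "linear_solver \<Rightarrow> game \<Rightarrow> (nat \<Rightarrow> nat) \<Rightarrow> (nat \<times> nat \<Rightarrow> nat) \<Rightarrow>
     (nat \<times> (nat \<Rightarrow> nat)) prog" where
  "evaluate S G \<sigma> \<delta> =
     (let n = states G in do {
        zero \<leftarrow> Const 0 Return;
        one \<leftarrow> Const 1 Return;
        L \<leftarrow> traverse (\<lambda>i. traverse (\<lambda>j.
               Arith Minus (if i = j then one else zero)
                 (trans_addr G i (\<sigma> i) (\<delta> (i, \<sigma> i)) j) Return) [0..<n]) [0..<n];
        x \<leftarrow> S (Suc n)
               (\<lambda>i j. if i < n then (if j < n then L ! i ! j else one)
                      else (if j = centre G then one else zero))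
               (\<lambda>i. if i < n then payment_addr G i (\<sigma> i) (\<delta> (i, \<sigma> i)) else zero);
        Return (x n, x)
      })"

definition local_value_prog ::
    "game \<Rightarrow> (nat \<Rightarrow> nat) \<Rightarrow> nat \<Rightarrow> nat \<Rightarrow> nat \<Rightarrow> nat prog" where
  "local_value_prog G v i a b =
     fold_prog (\<lambda>s j. do {
         x \<leftarrow> Arith Times (trans_addr G i a b j) (v j) Return;
         Arith Plus s x Return
       }) (payment_addr G i a b) [0..<states G]"

text \<open>
  For a list of actions paired with addresses of values: the address of the best value and the set
  of all actions attaining it. The first argument is the strict comparison ``better than''.
\<close>

definition optimize ::
    "(nat \<Rightarrow> nat \<Rightarrow> bool prog) \<Rightarrow> (nat \<times> nat) list \<Rightarrow> (nat \<times> nat set) prog" where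
  "optimize better xs = do {
     best \<leftarrow> fold_prog (\<lambda>x y. do { u \<leftarrow> better y x; Return (if u then y else x) })
               (snd (hd xs)) (map snd (tl xs));
     opt \<leftarrow> traverse (\<lambda>(a, x). do { u \<leftarrow> better best x; Return (if u then {} else {a}) }) xs;
     Return (best, \<Union> (set opt))
   }"

definition larger :: "nat \<Rightarrow> nat \<Rightarrow> bool prog" where
  "larger x y = Less y x Return"

definition smaller :: "nat \<Rightarrow> nat \<Rightarrow> bool prog" where
  "smaller x y = Less x y Return"

definition maximize :: "game \<Rightarrow> (nat \<Rightarrow> nat) \<Rightarrow> nat \<Rightarrow> nat \<Rightarrow> (nat \<times> nat set) prog" where
  "maximize G v i a = do {
     xs \<leftarrow> traverse (\<lambda>b. do { x \<leftarrow> local_value_prog G v i a b; Return (b, x) })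
             (sorted_list_of_set (max_actions G i));
     optimize larger xs
   }"

text \<open>
  Returns the set of minimizing actions at state \<open>i\<close>, and for each action of the minimizer the set
  of maximizing answers.
\<close>

definition minimize :: "game \<Rightarrow> (nat \<Rightarrow> nat) \<Rightarrow> nat \<Rightarrow> (nat set \<times> (nat \<Rightarrow> nat set)) prog" where
  "minimize G v i = do {
     ys \<leftarrow> traverse (\<lambda>a. do { (y, D) \<leftarrow> maximize G v i a; Return (a, y, D) })
             (sorted_list_of_set (min_actions G i));
     (y, C) \<leftarrow> optimize smaller (map (\<lambda>(a, y, D). (a, y)) ys);
     Return (C, \<lambda>a. \<Union> {D. \<exists>y. (a, y, D) \<in> set ys})
   }"


subsection \<open>The iteration\<close>

text \<open>
  \<open>Evaluate \<sigma> \<delta>\<close> is one iteration of the inner (maximizing) policy iteration for \<open>\<sigma>\<close> at the policy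
  \<open>\<delta>\<close>, \<open>Improve \<sigma> \<eta> v\<close> the improvement of the policy \<open>\<sigma>\<close> whose inner problem has the solution
  stored at addresses \<open>\<eta>\<close>, \<open>v\<close>. Each inner policy iteration starts from an arbitrary policy.
\<close>

datatype hk_state =
    Evaluate "nat \<Rightarrow> nat" "nat \<times> nat \<Rightarrow> nat"
  | Improve "nat \<Rightarrow> nat" nat "nat \<Rightarrow> nat"
  | Done "nat \<Rightarrow> nat" "nat \<times> nat \<Rightarrow> nat" nat "nat \<Rightarrow> nat"

primrec hk_control :: "linear_solver \<Rightarrow> game \<Rightarrow> hk_state \<Rightarrow> hk_state set prog" where
  "hk_control S G (Evaluate \<sigma> \<delta>) = do {
     (e, v) \<leftarrow> evaluate S G \<sigma> \<delta>;
     R \<leftarrow> traverse (\<lambda>i. maximize G v i (\<sigma> i)) [0..<states G];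
     Return
       (if \<forall>i<states G. \<delta> (i, \<sigma> i) \<in> snd (R ! i) then {Improve \<sigma> e v}
        else {Evaluate \<sigma> \<delta>' | \<delta>'.
                \<delta>' \<in> max_policies G \<and> (\<forall>i<states G. \<delta>' (i, \<sigma> i) \<in> snd (R ! i))})
   }"
| "hk_control S G (Improve \<sigma> e v) = do {
     R \<leftarrow> traverse (minimize G v) [0..<states G];
     Return
       (if \<forall>i<states G. \<sigma> i \<in> fst (R ! i)
        then {Done \<sigma> \<delta> e v | \<delta>.
                \<delta> \<in> max_policies G \<and>
                (\<forall>i<states G. \<forall>a\<in>min_actions G i. \<delta> (i, a) \<in> snd (R ! i) a)}
        else {Evaluate \<sigma>' \<delta> | \<sigma>' \<delta>.
                \<sigma>' \<in> min_policies G \<and> (\<forall>i<states G. \<sigma>' i \<in> fst (R ! i)) \<and>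
                \<delta> \<in> max_policies G})
   }"
| "hk_control S G (Done \<sigma> \<delta> e v) = Return {}"

definition hoffman_karp :: "linear_solver \<Rightarrow> (game, hk_state) algorithm" where
  "hoffman_karp S =
     \<lparr> input = game_data,
       start = (\<lambda>G. {Evaluate \<sigma> \<delta> | \<sigma> \<delta>. \<sigma> \<in> min_policies G \<and> \<delta> \<in> max_policies G}),
       control = hk_control S \<rparr>"

definition game_data_count :: "game \<Rightarrow> nat" where
  "game_data_count G = states G + length (triples G)"

definition solved :: "game \<Rightarrow> hk_state \<Rightarrow> real list \<Rightarrow> bool" where
  "solved G q m \<longleftrightarrow>
     (\<exists>\<sigma> \<delta> e v. q = Done \<sigma> \<delta> e v \<and> solution G (m ! e) (\<lambda>i. m ! v i) \<sigma> \<delta>)"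

end

theory Submission
  imports Defs "HOL-Library.Sublist"
begin

text \<open>
  Let \<open>u\<^sub>i\<close> be the largest mean return time from \<open>i\<close> to \<open>c\<close> over all pairs of policies; then
  \<open>1 \<le> u \<le> K\<close> and \<open>1 + \<Sum>\<^sub>j\<^sub>\<noteq>\<^sub>c M\<^sub>i\<^sub>j u\<^sub>j \<le> u\<^sub>i\<close> for all actions. The substitution
  \<open>v\<^sub>i = u\<^sub>i (w\<^sub>i - \<eta>)\<close> turns \<open>\<eta> + v = f(v)\<close>, \<open>v\<^sub>c = 0\<close> into the equation \<open>w = g(w)\<close> of a discounted
  game with factor \<open>\<gamma> = 1 - 1/K\<close>, and both levels of the Hoffman--Karp algorithm for \<open>f\<close> are policy
  iterations for \<open>g\<close>. As in the analysis of Ye and of Hansen, Miltersen and Zwick, among the pairs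
  (state, action) used by a non-optimal policy one has slack at least \<open>1 - \<gamma>\<close> times the distance of
  the policy's value from the optimum, whereas this distance is at least the slack of each pair that
  the policy uses. The distance decreases by the factor \<open>\<gamma>\<close> in each iteration, so that pair is not
  used again after \<open>L\<close> iterations if \<open>\<gamma>\<^sup>L < 1 - \<gamma>\<close>. The number of iterations on each level is
  hence at most \<open>L\<close> times the number of pairs, and \<open>L\<close> depends on \<open>K\<close> only.
\<close>

section \<open>Policy iteration for contractive operators\<close>

text \<open>The improvements are chosen nondeterministically and every inner iteration restarts from
  an arbitrary policy, so there is no fixed sequence of policies to follow. The elimination argument
  is therefore cast as a rank: a natural number attached to a policy that drops at every improving
  step, whichever is taken. The ranks of the two levels are then combined lexicographically. The
  weight \<open>u\<close> and the discounted game live in the analysis alone; the programs only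
  compare the original one-step values. This is consistent because at each state the transformed
  value of an action is an increasing affine function of the original one, the same for all actions.
  The contraction also makes the evaluation systems nonsingular, which is the precondition for
  calling the solver. Bit sizes do not accumulate along a run: each evaluation assembles its system
  from the input alone, and nothing computed in an earlier iteration enters it.\<close>

text \<open>Monotone and contracting with factor \<open>\<gamma>\<close> in the sup norm, in a single condition.\<close>

definition contractive :: "nat \<Rightarrow> real \<Rightarrow> ((nat \<Rightarrow> real) \<Rightarrow> real) \<Rightarrow> bool" where
  "contractive n \<gamma> F \<longleftrightarrow> (\<forall>x y e. 0 \<le> e \<longrightarrow> (\<forall>j<n. x j \<le> y j + e) \<longrightarrow> F x \<le> F y + \<gamma> * e)"

lemma contractiveD:
  "contractive n \<gamma> F \<Longrightarrow> 0 \<le> e \<Longrightarrow> (\<And>j. j < n \<Longrightarrow> x j \<le> y j + e) \<Longrightarrow> F x \<le> F y + \<gamma> * e"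
  by (auto simp: contractive_def)

lemma contractive_mono:
  "contractive n \<gamma> F \<Longrightarrow> (\<And>j. j < n \<Longrightarrow> x j \<le> y j) \<Longrightarrow> F x \<le> F y"
  using contractiveD[of n \<gamma> F 0 x y] by simp

lemma contractive_cong:
  "contractive n \<gamma> F \<Longrightarrow> (\<And>j. j < n \<Longrightarrow> x j = y j) \<Longrightarrow> F x = F y"
  using contractive_mono[of n \<gamma> F x y] contractive_mono[of n \<gamma> F y x] by fastforce

lemma contractive_abs:
  assumes "contractive n \<gamma> F" "\<And>j. j < n \<Longrightarrow> \<bar>x j - y j\<bar> \<le> e" "0 \<le> e"
  shows "\<bar>F x - F y\<bar> \<le> \<gamma> * e"
proof -
  have "F x \<le> F y + \<gamma> * e" "F y \<le> F x + \<gamma> * e"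
    using assms(2) by (intro contractiveD[OF assms(1,3)]; simp add: abs_le_iff diff_le_eq add.commute)+
  then show ?thesis by (simp add: abs_le_iff)
qed

text \<open>An action that is minimal at \<open>y\<close> is a competitor at \<open>x\<close>, so
  its own bound passes to the two minima.\<close>

lemma contractive_Min:
  assumes "finite A" "A \<noteq> {}" "\<And>a. a \<in> A \<Longrightarrow> contractive n \<gamma> (h a)"
  shows "contractive n \<gamma> (\<lambda>x. Min ((\<lambda>a. h a x) ` A))"
  unfolding contractive_def
proof (intro allI impI)
  fix x y :: "nat \<Rightarrow> real" and e :: real
  assume e: "0 \<le> e" "\<forall>j<n. x j \<le> y j + e"
  have "Min ((\<lambda>a. h a y) ` A) \<in> (\<lambda>a. h a y) ` A"
    using assms by (intro Min_in) auto
  then obtain a where a: "a \<in> A" "Min ((\<lambda>a. h a y) ` A) = h a y" by auto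
  have "Min ((\<lambda>a. h a x) ` A) \<le> h a x" using a assms by (intro Min_le) auto
  also have "\<dots> \<le> h a y + \<gamma> * e" using contractiveD[OF assms(3)[OF a(1)]] e by blast
  finally show "Min ((\<lambda>a. h a x) ` A) \<le> Min ((\<lambda>a. h a y) ` A) + \<gamma> * e" using a by simp
qed

text \<open>Negating arguments and values exchanges minima with maxima. This conjugation transfers
  the results on minimization to maximization.\<close>

lemma contractive_uminus:
  assumes "contractive n \<gamma> F"
  shows "contractive n \<gamma> (\<lambda>x. - F (\<lambda>j. - x j))"
  unfolding contractive_def
proof (intro allI impI)
  fix x y :: "nat \<Rightarrow> real" and e :: real
  assume "0 \<le> e" "\<forall>j<n. x j \<le> y j + e"
  then have "F (\<lambda>j. - y j) \<le> F (\<lambda>j. - x j) + \<gamma> * e"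
    by (intro contractiveD[OF assms]) (auto simp: algebra_simps)
  then show "- F (\<lambda>j. - x j) \<le> - F (\<lambda>j. - y j) + \<gamma> * e" by simp
qed

lemma Max_eq_uminus_Min:
  fixes f :: "'a \<Rightarrow> real"
  assumes "finite A" "A \<noteq> {}"
  shows "Max (f ` A) = - Min ((\<lambda>a. - f a) ` A)"
  using minus_Max_eq_Min[of "f ` A"] assms by (simp add: image_image)

lemma contractive_Max:
  assumes "finite A" "A \<noteq> {}" "\<And>a. a \<in> A \<Longrightarrow> contractive n \<gamma> (h a)"
  shows "contractive n \<gamma> (\<lambda>x. Max ((\<lambda>a. h a x) ` A))"
proof -
  have "contractive n \<gamma> (\<lambda>x. Min ((\<lambda>a. - h a (\<lambda>j. - x j)) ` A))"
    using assms by (intro contractive_Min contractive_uminus) auto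
  from contractive_uminus[OF this] show ?thesis
    by (simp add: Max_eq_uminus_Min[OF assms(1,2)])
qed

text \<open>Banach iteration from the zero vector. Vectors are functions on all of
  \<open>nat\<close>, so convergence is claimed only below \<open>n\<close>; that suffices since the
  value of a contractive \<open>F i\<close> is determined by these coordinates.\<close>

lemma contractive_fixpoint:
  fixes F :: "nat \<Rightarrow> (nat \<Rightarrow> real) \<Rightarrow> real"
  assumes \<gamma>: "0 \<le> \<gamma>" "\<gamma> < 1" and F: "\<And>i. i < n \<Longrightarrow> contractive n \<gamma> (F i)"
  obtains w where "\<And>i. i < n \<Longrightarrow> F i w = w i"
proof -
  define x where "x = (\<lambda>t. ((\<lambda>y i. F i y) ^^ t) (\<lambda>_. 0))"
  have xS: "x (Suc t) i = F i (x t)" for t i by (simp add: x_def)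
  \<comment> \<open>The sum dominates every coordinate of the first increment and avoids a maximum,
    which would range over the empty set for \<open>n = 0\<close>.\<close>
  define C where "C = (\<Sum>j<n. \<bar>x 1 j - x 0 j\<bar>)"
  have C: "0 \<le> C" by (simp add: C_def sum_nonneg)
  have dist: "\<bar>x (Suc t) i - x t i\<bar> \<le> \<gamma> ^ t * C" if "i < n" for t i
    using that
  proof (induction t arbitrary: i)
    case 0
    then show ?case unfolding C_def by (auto intro!: member_le_sum[of i "{..<n}" "\<lambda>j. \<bar>x 1 j - x 0 j\<bar>", simplified])
  next
    case (Suc t)
    show ?case
      using contractive_abs[OF F[OF Suc.prems], of "x (Suc t)" "x t" "\<gamma> ^ t * C"] Suc.IH C \<gamma>
      by (simp add: xS algebra_simps)
  qed
  have "convergent (\<lambda>t. x t i)" if "i < n" for i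
  proof -
    have "summable (\<lambda>t. \<gamma> ^ t * C)"
      using \<gamma> by (intro summable_mult2 summable_geometric) auto
    then have "summable (\<lambda>t. x (Suc t) i - x t i)"
      by (rule summable_comparison_test[rotated]) (use dist[OF that] in auto)
    then have "convergent (\<lambda>t. \<Sum>k<t. x (Suc k) i - x k i)"
      by (simp add: summable_iff_convergent)
    then have "convergent (\<lambda>t. x t i - x 0 i)"
      by (simp only: sum_lessThan_telescope[of "\<lambda>t. x t i"])
    then have "convergent (\<lambda>t. (x t i - x 0 i) + x 0 i)"
      by (intro convergent_add convergent_const)
    then show ?thesis by simp
  qed
  then obtain w where w: "\<And>i. i < n \<Longrightarrow> (\<lambda>t. x t i) \<longlonglongrightarrow> w i"
    unfolding convergent_def by metis
  show ?thesis
  proof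
    fix i assume i: "i < n"
    have "(\<lambda>t. \<gamma> * (\<Sum>j<n. \<bar>x t j - w j\<bar>)) \<longlonglongrightarrow> \<gamma> * (\<Sum>j<n. \<bar>w j - w j\<bar>)"
      by (intro tendsto_intros w) auto
    then have lim: "(\<lambda>t. \<gamma> * (\<Sum>j<n. \<bar>x t j - w j\<bar>)) \<longlonglongrightarrow> 0" by simp
    have "(\<lambda>t. F i (x t) - F i w) \<longlonglongrightarrow> 0"
    proof (rule Lim_null_comparison[OF _ lim], rule always_eventually, rule allI)
      fix t
      show "norm (F i (x t) - F i w) \<le> \<gamma> * (\<Sum>j<n. \<bar>x t j - w j\<bar>)"
        unfolding real_norm_def
        by (rule contractive_abs[OF F[OF i]])
          (auto intro!: sum_nonneg member_le_sum[of _ "{..<n}" "\<lambda>j. \<bar>x t j - w j\<bar>", simplified])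
    qed
    then have "(\<lambda>t. x (Suc t) i) \<longlonglongrightarrow> F i w"
      unfolding xS by (rule LIM_zero_cancel)
    moreover have "(\<lambda>t. x (Suc t) i) \<longlonglongrightarrow> w i"
      using w[OF i] by (rule LIMSEQ_Suc)
    ultimately show "F i w = w i" by (rule LIMSEQ_unique)
  qed
qed

text \<open>A maximum principle: at a coordinate \<open>k\<close> where the excess
  \<open>y - w\<close> is largest, a positive excess \<open>e\<close> would satisfy
  \<open>e \<le> \<gamma> * e\<close>. It orders the values of different policies by testing one
  vector in the operator of another.\<close>

lemma contractive_comparison:
  fixes F :: "nat \<Rightarrow> (nat \<Rightarrow> real) \<Rightarrow> real"
  assumes \<gamma>: "0 \<le> \<gamma>" "\<gamma> < 1" and F: "\<And>i. i < n \<Longrightarrow> contractive n \<gamma> (F i)"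
    and y: "\<And>i. i < n \<Longrightarrow> y i \<le> F i y" and w: "\<And>i. i < n \<Longrightarrow> F i w \<le> w i" and "i < n"
  shows "y i \<le> w i"
proof -
  define e where "e = Max ((\<lambda>j. y j - w j) ` {..<n})"
  have "e \<in> (\<lambda>j. y j - w j) ` {..<n}"
    unfolding e_def using \<open>i < n\<close> by (intro Max_in) auto
  then obtain k where k: "k < n" "e = y k - w k" by auto
  have le: "y j - w j \<le> e" if "j < n" for j unfolding e_def using that by (intro Max_ge) auto
  have "e \<le> 0"
  proof (rule ccontr)
    assume "\<not> e \<le> 0"
    then have "F k y \<le> F k w + \<gamma> * e"
      using le by (intro contractiveD[OF F[OF k(1)]]) (auto simp: algebra_simps)
    then have "e \<le> \<gamma> * e" using y[OF k(1)] w[OF k(1)] k(2) by linarith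
    then show False using \<open>\<not> e \<le> 0\<close> \<gamma> by simp
  qed
  then show ?thesis using le[OF \<open>i < n\<close>] by simp
qed

lemma contractive_unique:
  fixes F :: "nat \<Rightarrow> (nat \<Rightarrow> real) \<Rightarrow> real"
  assumes "0 \<le> \<gamma>" "\<gamma> < 1" "\<And>i. i < n \<Longrightarrow> contractive n \<gamma> (F i)"
    and "\<And>i. i < n \<Longrightarrow> F i y = y i" "\<And>i. i < n \<Longrightarrow> F i w = w i" and "i < n"
  shows "y i = w i"
  by (rule antisym; rule contractive_comparison[where F = F, OF assms(1-3)]) (use assms in auto)

text \<open>
  For the optimal value \<open>w'\<close> and the slack \<open>d i a = h i a w' - w' i\<close>, a policy with value \<open>w\<close>
  at distance \<open>X\<close> from \<open>w'\<close> uses a pair \<open>(i, a)\<close> with \<open>(1 - \<gamma>) X \<le> d i a \<le> X\<close>, and its successor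
  has distance at most \<open>\<gamma> X\<close>. The rank of a policy counts, for each pair with positive slack, the
  number of \<open>t < L\<close> such that \<open>\<gamma>\<^sup>t X\<close> is not yet below this slack.
\<close>

lemma policy_iteration_rank:
  fixes h :: "nat \<Rightarrow> 'a \<Rightarrow> (nat \<Rightarrow> real) \<Rightarrow> real"
  assumes \<gamma>: "0 \<le> \<gamma>" "\<gamma> < 1" and L: "\<gamma> ^ L < 1 - \<gamma>"
    and A: "\<And>i. i < n \<Longrightarrow> finite (A i) \<and> A i \<noteq> {}"
    and h: "\<And>i a. i < n \<Longrightarrow> a \<in> A i \<Longrightarrow> contractive n \<gamma> (h i a)"
  obtains \<rho> :: "(nat \<Rightarrow> 'a) \<Rightarrow> nat" where
    "\<And>\<pi>. \<rho> \<pi> \<le> L * card (SIGMA i:{..<n}. A i)"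
    "\<And>\<pi> \<pi>' w. (\<And>i. i < n \<Longrightarrow> \<pi> i \<in> A i) \<Longrightarrow> (\<And>i. i < n \<Longrightarrow> \<pi>' i \<in> A i) \<Longrightarrow>
       (\<And>i. i < n \<Longrightarrow> h i (\<pi> i) w = w i) \<Longrightarrow>
       (\<And>i a. i < n \<Longrightarrow> a \<in> A i \<Longrightarrow> h i (\<pi>' i) w \<le> h i a w) \<Longrightarrow>
       \<not> (\<forall>i<n. \<forall>a\<in>A i. h i (\<pi> i) w \<le> h i a w) \<Longrightarrow> \<rho> \<pi>' < \<rho> \<pi>"
proof -
  have "contractive n \<gamma> (\<lambda>x. Min ((\<lambda>a. h i a x) ` A i))" if "i < n" for i
    using A h that by (intro contractive_Min) auto
  from contractive_fixpoint[where F = "\<lambda>i x. Min ((\<lambda>a. h i a x) ` A i)", OF \<gamma> this] obtain w' where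
    w'_Min: "\<And>i. i < n \<Longrightarrow> Min ((\<lambda>a. h i a w') ` A i) = w' i" by blast
  have w'_le: "w' i \<le> h i a w'" if "i < n" "a \<in> A i" for i a
    using that A by (subst w'_Min[symmetric]) auto
  have w'_attained: "\<exists>a\<in>A i. h i a w' = w' i" if "i < n" for i
  proof -
    have "Min ((\<lambda>a. h i a w') ` A i) \<in> (\<lambda>a. h i a w') ` A i"
      using A[OF that] by (intro Min_in) auto
    then show ?thesis using w'_Min[OF that] by auto
  qed
  define d where "d i a = h i a w' - w' i" for i a
  \<comment> \<open>The rank has to be a function of the policy alone, hence the choice operator.
    Below \<open>n\<close> the fixed point is unique, so the chosen vector agrees there with every
    solution \<open>w\<close> of the evaluation equation.\<close>
  define val where "val \<pi> = (SOME w. \<forall>i<n. h i (\<pi> i) w = w i)" for \<pi>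
  have val: "val \<pi> j = w j"
    if \<pi>: "\<And>i. i < n \<Longrightarrow> \<pi> i \<in> A i" and w: "\<And>i. i < n \<Longrightarrow> h i (\<pi> i) w = w i" and j: "j < n"
    for \<pi> w j
  proof -
    have *: "\<forall>i<n. h i (\<pi> i) (val \<pi>) = val \<pi> i"
      unfolding val_def by (rule someI[of "\<lambda>w. \<forall>i<n. h i (\<pi> i) w = w i" w]) (use w in auto)
    show ?thesis
      by (rule contractive_unique[where F = "\<lambda>i. h i (\<pi> i)", OF \<gamma>]) (use h \<pi> w j * in auto)
  qed
  define X where "X \<pi> = Max ((\<lambda>j. \<bar>val \<pi> j - w' j\<bar>) ` {..<n})" for \<pi>
  define P where "P = (SIGMA i:{..<n}. A i)"
  have P: "finite P" using A by (auto simp: P_def)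
  define cnt where "cnt \<pi> = (\<lambda>(i, a). card {t. t < L \<and> 0 < d i a \<and> d i a \<le> \<gamma> ^ t * X \<pi>})" for \<pi>
  define \<rho> where "\<rho> \<pi> = sum (cnt \<pi>) P" for \<pi>
  show ?thesis
  proof (rule that[of \<rho>])
    fix \<pi>
    have cnt_le: "cnt \<pi> z \<le> L" for z
    proof (cases z)
      case (Pair i a)
      have "card {t. t < L \<and> 0 < d i a \<and> d i a \<le> \<gamma> ^ t * X \<pi>} \<le> card {..<L}"
        by (rule card_mono) auto
      then show ?thesis by (simp add: cnt_def Pair)
    qed
    have "\<rho> \<pi> \<le> sum (\<lambda>_. L) P" unfolding \<rho>_def by (rule sum_mono[OF cnt_le])
    then show "\<rho> \<pi> \<le> L * card (SIGMA i:{..<n}. A i)" by (simp add: P_def mult.commute)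
  next
    fix \<pi> \<pi>' w
    assume \<pi>: "\<And>i. i < n \<Longrightarrow> \<pi> i \<in> A i" and \<pi>': "\<And>i. i < n \<Longrightarrow> \<pi>' i \<in> A i"
      and w: "\<And>i. i < n \<Longrightarrow> h i (\<pi> i) w = w i"
      and greedy: "\<And>i a. i < n \<Longrightarrow> a \<in> A i \<Longrightarrow> h i (\<pi>' i) w \<le> h i a w"
      and nopt: "\<not> (\<forall>i<n. \<forall>a\<in>A i. h i (\<pi> i) w \<le> h i a w)"
    from nopt obtain k where k: "k < n" by blast
    have n_ne: "{..<n} \<noteq> {}" using k by auto
    have "contractive n \<gamma> (h i (\<pi>' i))" if "i < n" for i using h \<pi>' that by auto
    from contractive_fixpoint[where F = "\<lambda>i. h i (\<pi>' i)", OF \<gamma> this] obtain y where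
      y: "\<And>i. i < n \<Longrightarrow> h i (\<pi>' i) y = y i" by blast
    have h\<pi>: "contractive n \<gamma> (h i (\<pi> i))" "contractive n \<gamma> (h i (\<pi>' i))" if "i < n" for i
      using h \<pi> \<pi>' that by auto
    have y_le_w: "y i \<le> w i" if "i < n" for i
    proof (rule contractive_comparison[where F = "\<lambda>i. h i (\<pi>' i)", OF \<gamma>])
      show "h i (\<pi>' i) w \<le> w i" if "i < n" for i
        using greedy[OF that \<pi>[OF that]] w[OF that] by simp
    qed (use h\<pi> y that in auto)
    have w'_le_w: "w' i \<le> w i" if "i < n" for i
      by (rule contractive_comparison[where F = "\<lambda>i. h i (\<pi> i)", OF \<gamma>])
         (use h\<pi> w w'_le \<pi> that in auto)
    have w'_le_y: "w' i \<le> y i" if "i < n" for i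
      by (rule contractive_comparison[where F = "\<lambda>i. h i (\<pi>' i)", OF \<gamma>])
         (use h\<pi> y w'_le \<pi>' that in auto)
    have X\<pi>: "X \<pi> = Max ((\<lambda>j. \<bar>w j - w' j\<bar>) ` {..<n})"
      unfolding X_def using val[OF \<pi> w] by (intro arg_cong[where f = Max] image_cong) auto
    have X\<pi>': "X \<pi>' = Max ((\<lambda>j. \<bar>y j - w' j\<bar>) ` {..<n})"
      unfolding X_def using val[OF \<pi>' y] by (intro arg_cong[where f = Max] image_cong) auto
    have X_ge: "\<bar>w j - w' j\<bar> \<le> X \<pi>" if "j < n" for j
      unfolding X\<pi> using that by (intro Max_ge) auto
    have X_up: "w j \<le> w' j + X \<pi>" if "j < n" for j
      using X_ge[OF that] by linarith
    have X0: "0 \<le> X \<pi>" using X_ge[OF k] by linarith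
    have "X \<pi> \<in> (\<lambda>j. \<bar>w j - w' j\<bar>) ` {..<n}"
      unfolding X\<pi> using n_ne by (intro Max_in) auto
    then obtain i where i: "i < n" "X \<pi> = \<bar>w i - w' i\<bar>" by auto
    \<comment> \<open>At distance 0 the vector \<open>w\<close> coincides with \<open>w'\<close>,
      and a policy with this value attains all minima.\<close>
    have Xpos: "0 < X \<pi>"
    proof (rule ccontr)
      assume "\<not> 0 < X \<pi>"
      then have eq: "w j = w' j" if "j < n" for j using X_ge[OF that] by linarith
      have "h j b w = h j b w'" if "j < n" "b \<in> A j" for j b
        by (rule contractive_cong[OF h[OF that]]) (use eq in auto)
      then have "\<forall>j<n. \<forall>b\<in>A j. h j (\<pi> j) w \<le> h j b w"
        using w w'_le eq by auto
      with nopt show False by blast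
    qed
    have contr: "X \<pi>' \<le> \<gamma> * X \<pi>"
      unfolding X\<pi>'
    proof (rule Max.boundedI)
      fix r assume "r \<in> (\<lambda>j. \<bar>y j - w' j\<bar>) ` {..<n}"
      then obtain j where j: "j < n" "r = \<bar>y j - w' j\<bar>" by auto
      obtain b where b: "b \<in> A j" "h j b w' = w' j" using w'_attained[OF j(1)] by auto
      \<comment> \<open>One greedy step from \<open>w\<close> lies above the value \<open>y\<close>
        of the greedy policy and below the step with an action \<open>b\<close> that is optimal at
        \<open>w'\<close>. Comparing the latter with \<open>w'\<close> yields the factor
        \<open>\<gamma>\<close>.\<close>
      have "y j \<le> h j (\<pi>' j) w"
        using contractive_mono[OF h\<pi>(2)[OF j(1)], of y w] y_le_w y j by auto
      also have "\<dots> \<le> h j b w" using greedy j b by auto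
      also have "\<dots> \<le> h j b w' + \<gamma> * X \<pi>"
        using X_up X0 by (intro contractiveD[OF h[OF j(1) b(1)]])
      finally show "r \<le> \<gamma> * X \<pi>" using b j w'_le_y[OF j(1)] by simp
    qed (use n_ne in auto)
    let ?D = "d i (\<pi> i)"
    \<comment> \<open>At \<open>i\<close> the distance is attained and \<open>w'\<close> lies below
      \<open>w\<close>, so \<open>w i = w' i + X \<pi>\<close>. Contraction accounts for
      \<open>\<gamma> * X \<pi>\<close> of this gap; the rest must be slack of the action in
      use.\<close>
    have "w i \<le> h i (\<pi> i) w' + \<gamma> * X \<pi>"
      using X_up X0 w[OF i(1)] contractiveD[OF h\<pi>(1)[OF i(1)], of "X \<pi>" w w'] by simp
    then have D_ge: "(1 - \<gamma>) * X \<pi> \<le> ?D"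
      using i(2) w'_le_w[OF i(1)] unfolding d_def left_diff_distrib by linarith
    have D_le: "?D \<le> X \<pi>"
      using contractive_mono[OF h\<pi>(1)[OF i(1)], of w' w] w'_le_w w[OF i(1)] i
      by (auto simp: d_def)
    have D_pos: "0 < ?D" using D_ge Xpos \<gamma>
      by (meson diff_gt_0_iff_gt dual_order.strict_trans1 mult_pos_pos)
    have cnt_mono: "\<gamma> ^ t * X \<pi>' \<le> \<gamma> ^ Suc t * X \<pi>" for t
      using mult_left_mono[OF contr, of "\<gamma> ^ t"] \<gamma> by (simp add: algebra_simps)
    have pow_mono: "\<gamma> ^ t * X \<pi> \<le> \<gamma> ^ s * X \<pi>" if "s \<le> t" for s t
      using that \<gamma> X0 by (intro mult_right_mono power_decreasing) auto
    let ?T = "\<lambda>\<pi> i a. {t. t < L \<and> 0 < d i a \<and> d i a \<le> \<gamma> ^ t * X \<pi>}"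
    have sub: "?T \<pi>' j b \<subseteq> ?T \<pi> j b" for j b
      using cnt_mono pow_mono[of _ "Suc _"] by (smt (verit) Collect_mono le_SucI order_refl)
    have le: "cnt \<pi>' z \<le> cnt \<pi> z" for z
      using card_mono[OF _ sub, of "fst z" "snd z"] by (auto simp: cnt_def split: prod.splits)
    have DL: "\<not> ?D \<le> \<gamma> ^ L * X \<pi>"
      using mult_strict_right_mono[OF L Xpos] D_ge by simp
    have L_pos: "0 < L"
    proof (rule ccontr)
      assume "\<not> 0 < L" with L \<gamma> show False by simp
    qed
    \<comment> \<open>\<open>s\<close> is the last exponent counted for this pair. Were it still
      counted for \<open>\<pi>'\<close>, the contraction would give the inequality for
      \<open>\<pi>\<close> with exponent \<open>Suc s\<close>: below \<open>L\<close> this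
      contradicts maximality, and at \<open>L\<close> it contradicts \<open>DL\<close>. So the count
      at this pair drops, while no other count rises.\<close>
    define s where "s = Max (?T \<pi> i (\<pi> i))"
    have "0 \<in> ?T \<pi> i (\<pi> i)" using L_pos D_pos D_le by simp
    then have ne: "?T \<pi> i (\<pi> i) \<noteq> {}" by blast
    have s_in: "s \<in> ?T \<pi> i (\<pi> i)" unfolding s_def using ne by (intro Max_in) auto
    have "s \<notin> ?T \<pi>' i (\<pi> i)"
    proof
      assume "s \<in> ?T \<pi>' i (\<pi> i)"
      then have *: "s < L" "?D \<le> \<gamma> ^ Suc s * X \<pi>" using cnt_mono[of s] by auto
      show False
      proof (cases "Suc s < L")
        case True
        then have "Suc s \<in> ?T \<pi> i (\<pi> i)" using * D_pos by auto
        then have "Suc s \<le> s" unfolding s_def by (intro Max_ge) auto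
        then show False by simp
      next
        case False
        then have "Suc s = L" using * by simp
        then show False using * DL by simp
      qed
    qed
    then have "?T \<pi>' i (\<pi> i) \<subset> ?T \<pi> i (\<pi> i)" using sub s_in by blast
    then have "cnt \<pi>' (i, \<pi> i) < cnt \<pi> (i, \<pi> i)"
      unfolding cnt_def by (auto intro!: psubset_card_mono)
    moreover have "(i, \<pi> i) \<in> P" using i \<pi> by (auto simp: P_def)
    ultimately show "\<rho> \<pi>' < \<rho> \<pi>"
      unfolding \<rho>_def using le P by (intro sum_strict_mono_ex1) auto
  qed
qed

lemma policy_iteration_rank_max:
  fixes h :: "nat \<Rightarrow> 'a \<Rightarrow> (nat \<Rightarrow> real) \<Rightarrow> real"
  assumes \<gamma>: "0 \<le> \<gamma>" "\<gamma> < 1" and L: "\<gamma> ^ L < 1 - \<gamma>"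
    and A: "\<And>i. i < n \<Longrightarrow> finite (A i) \<and> A i \<noteq> {}"
    and h: "\<And>i a. i < n \<Longrightarrow> a \<in> A i \<Longrightarrow> contractive n \<gamma> (h i a)"
  obtains \<rho> :: "(nat \<Rightarrow> 'a) \<Rightarrow> nat" where
    "\<And>\<pi>. \<rho> \<pi> \<le> L * card (SIGMA i:{..<n}. A i)"
    "\<And>\<pi> \<pi>' w. (\<And>i. i < n \<Longrightarrow> \<pi> i \<in> A i) \<Longrightarrow> (\<And>i. i < n \<Longrightarrow> \<pi>' i \<in> A i) \<Longrightarrow>
       (\<And>i. i < n \<Longrightarrow> h i (\<pi> i) w = w i) \<Longrightarrow>
       (\<And>i a. i < n \<Longrightarrow> a \<in> A i \<Longrightarrow> h i a w \<le> h i (\<pi>' i) w) \<Longrightarrow>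
       \<not> (\<forall>i<n. \<forall>a\<in>A i. h i a w \<le> h i (\<pi> i) w) \<Longrightarrow> \<rho> \<pi>' < \<rho> \<pi>"
proof -
  let ?h = "\<lambda>i a x. - h i a (\<lambda>j. - x j)"
  show ?thesis
  proof (rule policy_iteration_rank[where h = ?h and A = A and n = n, OF \<gamma> L A])
    show "contractive n \<gamma> (?h i a)" if "i < n" "a \<in> A i" for i a
      by (rule contractive_uminus[OF h[OF that]])
  next
    fix \<rho> :: "(nat \<Rightarrow> 'a) \<Rightarrow> nat"
    assume le: "\<And>\<pi>. \<rho> \<pi> \<le> L * card (SIGMA i:{..<n}. A i)"
      and less: "\<And>\<pi> \<pi>' w. (\<And>i. i < n \<Longrightarrow> \<pi> i \<in> A i) \<Longrightarrow> (\<And>i. i < n \<Longrightarrow> \<pi>' i \<in> A i) \<Longrightarrow>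
        (\<And>i. i < n \<Longrightarrow> ?h i (\<pi> i) w = w i) \<Longrightarrow>
        (\<And>i a. i < n \<Longrightarrow> a \<in> A i \<Longrightarrow> ?h i (\<pi>' i) w \<le> ?h i a w) \<Longrightarrow>
        \<not> (\<forall>i<n. \<forall>a\<in>A i. ?h i (\<pi> i) w \<le> ?h i a w) \<Longrightarrow> \<rho> \<pi>' < \<rho> \<pi>"
    show thesis
    proof (rule that[OF le])
      fix \<pi> \<pi>' w
      assume "\<And>i. i < n \<Longrightarrow> \<pi> i \<in> A i" "\<And>i. i < n \<Longrightarrow> \<pi>' i \<in> A i"
        "\<And>i. i < n \<Longrightarrow> h i (\<pi> i) w = w i"
        "\<And>i a. i < n \<Longrightarrow> a \<in> A i \<Longrightarrow> h i a w \<le> h i (\<pi>' i) w"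
        "\<not> (\<forall>i<n. \<forall>a\<in>A i. h i a w \<le> h i (\<pi> i) w)"
      then show "\<rho> \<pi>' < \<rho> \<pi>" by (intro less[of \<pi> \<pi>' "\<lambda>j. - w j"]) simp_all
    qed
  qed simp
qed

section \<open>Mean return times\<close>

text \<open>A nonempty set of naturals attains its infimum; on the empty set both sides are
  \<open>top\<close>, the time of a return that never happens.\<close>

lemma INF_of_nat_Suc: "(INF k\<in>S. of_nat (Suc k) :: ennreal) = 1 + (INF k\<in>S. of_nat k)"
proof (cases "S = {}")
  case False
  define l where "l = (LEAST k. k \<in> S)"
  have l: "l \<in> S" "\<And>k. k \<in> S \<Longrightarrow> l \<le> k"
    using False unfolding l_def by (auto intro: LeastI Least_le)
  have "(INF k\<in>S. of_nat (Suc k) :: ennreal) = of_nat (Suc l)"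
    using l by (intro antisym INF_lower INF_greatest) (simp_all only: of_nat_le_iff Suc_le_mono)
  moreover have "(INF k\<in>S. of_nat k :: ennreal) = of_nat l"
    using l by (intro antisym INF_lower INF_greatest) simp_all
  ultimately show ?thesis by simp
qed simp

lemma set_row_pmf:
  assumes "markov_matrix n M" "i < n"
  shows "set_pmf (row_pmf n M i) \<subseteq> {..<n}"
proof -
  have "measure_pmf.prob (row_pmf n M i) {..<n} = (\<Sum>j<n. M i j)"
    using assms by (simp add: measure_measure_pmf_finite pmf_row)
  also have "\<dots> = 1" using assms by (simp add: markov_matrix_def)
  finally have "AE j in row_pmf n M i. j \<in> {..<n}"
    by (simp add: measure_pmf.prob_eq_1)
  then show ?thesis by (auto simp: AE_measure_pmf_iff)
qed

text \<open>The random variable behind \<open>mean_return_time\<close>; the infimum over the empty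
  set makes it \<open>top\<close> on paths that never reach \<open>j\<close>.\<close>

definition return_time :: "nat \<Rightarrow> (nat \<Rightarrow> nat) stream \<Rightarrow> nat \<Rightarrow> ennreal" where
  "return_time i \<omega> j = (INF k\<in>{k. 1 \<le> k \<and> chain i \<omega> k = j}. of_nat k)"

text \<open>Dropping the first map shifts time by one and so admits time 0 for the remaining path.
  This matters only if that path starts in \<open>j\<close>; otherwise hitting time and return time
  agree.\<close>

lemma return_time_SCons:
  "return_time i (f ## \<omega>) j = (if f i = j then 1 else 1 + return_time (f i) \<omega> j)"
proof -
  have S: "{k. 1 \<le> k \<and> chain i (f ## \<omega>) k = j} = Suc ` {k. chain (f i) \<omega> k = j}"
  proof (intro set_eqI iffI)
    fix k assume "k \<in> {k. 1 \<le> k \<and> chain i (f ## \<omega>) k = j}"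
    then show "k \<in> Suc ` {k. chain (f i) \<omega> k = j}"
      by (cases k) (auto simp: chain_SCons simp del: chain.simps(2))
  qed (auto simp: chain_SCons simp del: chain.simps(2))
  have eq: "return_time i (f ## \<omega>) j = 1 + (INF k\<in>{k. chain (f i) \<omega> k = j}. of_nat k)"
    unfolding return_time_def S image_image INF_of_nat_Suc ..
  show ?thesis
  proof (cases "f i = j")
    case True
    then have "(INF k\<in>{k. chain (f i) \<omega> k = j}. of_nat k :: ennreal) \<le> of_nat 0"
      by (intro INF_lower) simp
    then show ?thesis using eq True by simp
  next
    case False
    then have "{k. chain (f i) \<omega> k = j} = {k. 1 \<le> k \<and> chain (f i) \<omega> k = j}"
      by (auto simp: Suc_le_eq intro!: gr0I)
    then show ?thesis using eq False by (simp add: return_time_def)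
  qed
qed

text \<open>The infimum ranges over a random index set; assigning \<open>top\<close> to the excluded
  times turns it into a countable infimum of measurable functions.\<close>

lemma measurable_return_time [measurable]:
  "(\<lambda>\<omega>. return_time i \<omega> j) \<in> borel_measurable (random_maps n M)"
proof -
  have eq: "return_time i \<omega> j = (INF k. if 1 \<le> k \<and> chain i \<omega> k = j then of_nat k else top)" for \<omega>
    unfolding return_time_def
  proof (intro antisym INF_greatest)
    fix k assume k: "k \<in> {k. 1 \<le> k \<and> chain i \<omega> k = j}"
    have "(INF k. if 1 \<le> k \<and> chain i \<omega> k = j then of_nat k else top) \<le>
        (if 1 \<le> k \<and> chain i \<omega> k = j then of_nat k else top :: ennreal)"
      by (rule INF_lower) simp
    then show "(INF k. if 1 \<le> k \<and> chain i \<omega> k = j then of_nat k else top) \<le> (of_nat k :: ennreal)"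
      using k by simp
  qed (auto intro: INF_lower)
  show ?thesis unfolding eq by measurable
qed

text \<open>The stream measure splits into the first map and an independent tail of the same law. Of
  the first map only the image of \<open>i\<close> matters, and its law is row
  \<open>i\<close>.\<close>

lemma mean_return_time_first_step:
  assumes M: "markov_matrix n M" and i: "i < n"
  shows "mean_return_time n M i c =
    (\<Sum>j<n. ennreal (M i j) * (if j = c then 1 else 1 + mean_return_time n M j c))"
proof -
  let ?P = "Pi_pmf {..<n} 0 (row_pmf n M)"
  let ?t = "\<lambda>j. if j = c then 1 else 1 + mean_return_time n M j c"
  interpret prob_space "random_maps n M"
    unfolding random_maps_def by (rule prob_space.prob_space_stream_space[OF prob_space_measure_pmf])
  have mrt: "mean_return_time n M i c = (\<integral>\<^sup>+\<omega>. return_time i \<omega> c \<partial>random_maps n M)" for i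
    by (simp add: mean_return_time_def return_time_def)
  have "mean_return_time n M i c = (\<integral>\<^sup>+f. (\<integral>\<^sup>+\<omega>. return_time i (f ## \<omega>) c \<partial>random_maps n M) \<partial>?P)"
    unfolding mrt using measurable_return_time[of i c n M] unfolding random_maps_def
    by (rule prob_space.nn_integral_stream_space[OF prob_space_measure_pmf])
  also have "\<dots> = (\<integral>\<^sup>+f. ?t (f i) \<partial>?P)"
  proof (intro nn_integral_cong)
    fix f
    have "(\<integral>\<^sup>+\<omega>. 1 + return_time (f i) \<omega> c \<partial>random_maps n M) = 1 + mean_return_time n M (f i) c"
      by (subst nn_integral_add) (auto simp: mrt emeasure_space_1)
    then show "(\<integral>\<^sup>+\<omega>. return_time i (f ## \<omega>) c \<partial>random_maps n M) = ?t (f i)"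
      by (simp add: return_time_SCons emeasure_space_1)
  qed
  also have "\<dots> = (\<integral>\<^sup>+j. ?t j \<partial>map_pmf (\<lambda>f. f i) ?P)" by simp
  also have "map_pmf (\<lambda>f. f i) ?P = row_pmf n M i"
    using i by (simp add: Pi_pmf_component)
  also have "(\<integral>\<^sup>+j. ?t j \<partial>row_pmf n M i) = (\<Sum>j<n. ?t j * ennreal (pmf (row_pmf n M i) j))"
    using set_row_pmf[OF M i] by (intro nn_integral_measure_pmf_support) auto
  also have "\<dots> = (\<Sum>j<n. ennreal (M i j) * ?t j)"
    using M i by (intro sum.cong) (auto simp: pmf_row mult.commute)
  finally show ?thesis .
qed

text \<open>Finiteness makes the first-step equation one between real numbers. The row sum collects
  the time of the first step, and a move to \<open>c\<close> adds no further time.\<close>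

lemma finite_mean_return_time_eq:
  assumes M: "markov_matrix n M" and "c < n"
    and fin: "\<And>i. i < n \<Longrightarrow> mean_return_time n M i c < top" and i: "i < n"
  shows "enn2real (mean_return_time n M i c) =
    1 + (\<Sum>j\<in>{..<n} - {c}. M i j * enn2real (mean_return_time n M j c))"
proof -
  let ?T = "\<lambda>j. enn2real (mean_return_time n M j c)"
  let ?t = "\<lambda>j. if j = c then 1 else 1 + ?T j"
  have M0: "0 \<le> M i j" if "j < n" for j using M i that by (auto simp: markov_matrix_def)
  have nonneg: "0 \<le> (\<Sum>j<n. M i j * ?t j)"
    using M0 by (intro sum_nonneg mult_nonneg_nonneg) auto
  have T: "mean_return_time n M j c = ennreal (?T j)" if "j < n" for j
    using fin[OF that] by simp
  have "mean_return_time n M i c = (\<Sum>j<n. ennreal (M i j * ?t j))"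
    unfolding mean_return_time_first_step[OF M i]
  proof (intro sum.cong refl)
    fix j assume "j \<in> {..<n}"
    then have j: "j < n" by simp
    have "ennreal (1 + ?T j) = 1 + mean_return_time n M j c"
      unfolding ennreal_plus[OF zero_le_one enn2real_nonneg] T[OF j, symmetric] by simp
    then show "ennreal (M i j) * (if j = c then 1 else 1 + mean_return_time n M j c) =
      ennreal (M i j * ?t j)"
      using M0[OF j] by (simp add: ennreal_mult')
  qed
  also have "\<dots> = ennreal (\<Sum>j<n. M i j * ?t j)"
    using M0 by (intro sum_ennreal) auto
  finally have "?T i = (\<Sum>j<n. M i j * ?t j)"
    using nonneg by (simp only: enn2real_ennreal)
  also have "\<dots> = (\<Sum>j<n. M i j) + (\<Sum>j<n. if j = c then 0 else M i j * ?T j)"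
    unfolding sum.distrib[symmetric] by (intro sum.cong) (auto simp: algebra_simps)
  also have "(\<Sum>j<n. if j = c then 0 else M i j * ?T j) = (\<Sum>j\<in>{..<n} - {c}. M i j * ?T j)"
    by (intro sum.mono_neutral_cong_right) auto
  also have "(\<Sum>j<n. M i j) = 1" using M i by (simp add: markov_matrix_def)
  finally show ?thesis .
qed

text \<open>A minimum principle for the chain killed in \<open>c\<close>, with \<open>T\<close> as a
  positive strict supersolution. At a state \<open>k\<close> where \<open>x / T\<close> is minimal,
  a negative minimum \<open>l\<close> would give \<open>l * (T k - 1) \<le> l * T k\<close>, which
  is false.\<close>

lemma killed_chain_nonneg:
  fixes x T :: "nat \<Rightarrow> real"
  assumes M: "\<And>i j. i < n \<Longrightarrow> j < n \<Longrightarrow> 0 \<le> M i j"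
    and T: "\<And>i. i < n \<Longrightarrow> 1 + (\<Sum>j\<in>{..<n} - {c}. M i j * T j) \<le> T i"
    and T_pos: "\<And>i. i < n \<Longrightarrow> 0 < T i"
    and x: "\<And>i. i < n \<Longrightarrow> (\<Sum>j\<in>{..<n} - {c}. M i j * x j) \<le> x i" and "i < n"
  shows "0 \<le> x i"
proof -
  define l where "l = Min ((\<lambda>j. x j / T j) ` {..<n})"
  have "l \<in> (\<lambda>j. x j / T j) ` {..<n}" unfolding l_def using \<open>i < n\<close> by (intro Min_in) auto
  then obtain k where k: "k < n" "l = x k / T k" by auto
  have le: "l * T j \<le> x j" if "j < n" for j
  proof -
    have "l \<le> x j / T j" unfolding l_def using that by (intro Min_le) auto
    then show ?thesis using T_pos[OF that] by (simp add: field_simps)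
  qed
  have xk: "x k = l * T k" using k T_pos[OF k(1)] by simp
  have "0 \<le> l"
  proof (rule ccontr)
    assume neg: "\<not> 0 \<le> l"
    have "l * (T k - 1) \<le> l * (\<Sum>j\<in>{..<n} - {c}. M k j * T j)"
      using T[OF k(1)] neg by (intro mult_left_mono_neg) auto
    also have "\<dots> = (\<Sum>j\<in>{..<n} - {c}. M k j * (l * T j))"
      by (simp add: sum_distrib_left algebra_simps)
    also have "\<dots> \<le> (\<Sum>j\<in>{..<n} - {c}. M k j * x j)"
      using M[OF k(1)] le by (intro sum_mono mult_left_mono) auto
    also have "\<dots> \<le> l * T k" using x[OF k(1)] xk by simp
    finally show False using neg by (simp add: algebra_simps)
  qed
  then show ?thesis using le[OF \<open>i < n\<close>] T_pos[OF \<open>i < n\<close>]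
    by (meson less_imp_le mult_nonneg_nonneg order_trans)
qed

section \<open>Finiteness and pointwise choice of policies\<close>

lemma finite_min_policies: "valid_game G \<Longrightarrow> finite (min_policies G)"
  by (auto simp: min_policies_def valid_game_def intro!: finite_PiE)

lemma finite_max_policies: "valid_game G \<Longrightarrow> finite (max_policies G)"
  by (auto simp: max_policies_def valid_game_def intro!: finite_PiE)

lemma min_policiesD: "\<sigma> \<in> min_policies G \<Longrightarrow> i < states G \<Longrightarrow> \<sigma> i \<in> min_actions G i"
  by (auto simp: min_policies_def)

lemma max_policiesD:
  assumes "\<delta> \<in> max_policies G" "i < states G" "k < states G" "a \<in> min_actions G k"
  shows "\<delta> (i, a) \<in> max_actions G i"
  using assms unfolding max_policies_def by (auto dest!: PiE_mem[of _ _ _ "(i, a)"])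

lemma min_policies_ex:
  assumes "\<And>i. i < states G \<Longrightarrow> \<exists>a\<in>min_actions G i. P i a"
  obtains \<sigma> where "\<sigma> \<in> min_policies G" "\<And>i. i < states G \<Longrightarrow> P i (\<sigma> i)"
proof
  let ?\<sigma> = "\<lambda>i\<in>{..<states G}. SOME a. a \<in> min_actions G i \<and> P i a"
  have *: "?\<sigma> i \<in> min_actions G i \<and> P i (?\<sigma> i)" if "i < states G" for i
    using assms[OF that] someI_ex[of "\<lambda>a. a \<in> min_actions G i \<and> P i a"] that by auto
  then show "?\<sigma> \<in> min_policies G" "\<And>i. i < states G \<Longrightarrow> P i (?\<sigma> i)"
    by (auto simp: min_policies_def)
qed

text \<open>A policy in \<open>max_policies\<close> also has to answer at pairs
  \<open>(i, a)\<close> where \<open>a\<close> is available only in another state. The witness is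
  therefore demanded for the actions of every state \<open>k\<close>.\<close>

lemma max_policies_ex:
  assumes "\<And>i k a. i < states G \<Longrightarrow> k < states G \<Longrightarrow> a \<in> min_actions G k \<Longrightarrow>
    \<exists>b\<in>max_actions G i. P i a b"
  obtains \<delta> where "\<delta> \<in> max_policies G"
    "\<And>i k a. i < states G \<Longrightarrow> k < states G \<Longrightarrow> a \<in> min_actions G k \<Longrightarrow> P i a (\<delta> (i, a))"
proof
  let ?D = "{..<states G} \<times> (\<Union>k<states G. min_actions G k)"
  let ?\<delta> = "\<lambda>z\<in>?D. SOME b. b \<in> max_actions G (fst z) \<and> P (fst z) (snd z) b"
  have *: "?\<delta> (i, a) \<in> max_actions G i \<and> P i a (?\<delta> (i, a))"
    if "i < states G" "k < states G" "a \<in> min_actions G k" for i k a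
  proof -
    have "?\<delta> (i, a) = (SOME b. b \<in> max_actions G i \<and> P i a b)" using that by auto
    then show ?thesis using assms[OF that] someI_ex[of "\<lambda>b. b \<in> max_actions G i \<and> P i a b"] by auto
  qed
  then show "?\<delta> \<in> max_policies G"
    unfolding max_policies_def
  proof (intro PiE_I)
    fix z assume "z \<in> ?D"
    then obtain i k a where "z = (i, a)" "i < states G" "k < states G" "a \<in> min_actions G k" by auto
    then show "?\<delta> z \<in> (case z of (i, a) \<Rightarrow> max_actions G i)" using * by auto
  next
    fix z assume "z \<notin> ?D" then show "?\<delta> z = undefined" by (rule restrict_apply[THEN trans, OF if_not_P])
  qed
  show "\<And>i k a. i < states G \<Longrightarrow> k < states G \<Longrightarrow> a \<in> min_actions G k \<Longrightarrow> P i a (?\<delta> (i, a))"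
    using * by blast
qed

lemma policy_matrix_markov:
  assumes "valid_game G" "\<sigma> \<in> min_policies G" "\<delta> \<in> max_policies G"
  shows "markov_matrix (states G) (policy_matrix G \<sigma> \<delta>)"
  using assms min_policiesD[OF assms(2)] max_policiesD[OF assms(3)]
  by (fastforce simp: markov_matrix_def policy_matrix_def valid_game_def)

text \<open>
  The weight \<open>u\<close> is the vector of mean return times for a pair of policies maximizing the sum
  of these times; switching a single action at which the inequality for \<open>u\<close> fails would increase
  this sum.
\<close>

lemma bounded_return_weight:
  assumes "G \<in> bounded_return_games K"
  obtains u where "\<And>i. i < states G \<Longrightarrow> 1 \<le> u i \<and> u i \<le> K"
    and "\<And>i a b. i < states G \<Longrightarrow> a \<in> min_actions G i \<Longrightarrow> b \<in> max_actions G i \<Longrightarrow>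
      1 + (\<Sum>j\<in>{..<states G} - {centre G}. trans G i a b j * u j) \<le> u i"
proof -
  define n where "n = states G"
  define c where "c = centre G"
  have G: "valid_game G" and K: "\<And>\<sigma> \<delta> i. \<sigma> \<in> min_policies G \<Longrightarrow> \<delta> \<in> max_policies G \<Longrightarrow> i < n \<Longrightarrow>
      mean_return_time n (policy_matrix G \<sigma> \<delta>) i c \<le> ennreal K"
    using assms by (auto simp: bounded_return_games_def n_def c_def)
  have c: "c < n" using G by (simp add: valid_game_def c_def n_def)
  define Ps where "Ps = min_policies G \<times> max_policies G"
  define T where "T \<pi> i = enn2real (mean_return_time n (policy_matrix G (fst \<pi>) (snd \<pi>)) i c)" for \<pi> i
  define Q where "Q \<pi> i j = policy_matrix G (fst \<pi>) (snd \<pi>) i j" for \<pi> i j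
  have T_eq: "T \<pi> i = 1 + (\<Sum>j\<in>{..<n} - {c}. Q \<pi> i j * T \<pi> j)" if "\<pi> \<in> Ps" "i < n" for \<pi> i
    unfolding T_def Q_def
    using that policy_matrix_markov[OF G, of "fst \<pi>" "snd \<pi>"] c K[of "fst \<pi>" "snd \<pi>"]
    by (intro finite_mean_return_time_eq) (auto simp: Ps_def n_def intro!: order.strict_trans1[OF _ ennreal_less_top])
  have Q0: "0 \<le> Q \<pi> i j" if "\<pi> \<in> Ps" "i < n" "j < n" for \<pi> i j
    using policy_matrix_markov[OF G, of "fst \<pi>" "snd \<pi>"] that
    by (auto simp: Ps_def n_def markov_matrix_def Q_def)
  have T0: "0 \<le> T \<pi> i" for \<pi> i by (simp add: T_def)
  have T1: "1 \<le> T \<pi> i" if "\<pi> \<in> Ps" "i < n" for \<pi> i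
    using T_eq[OF that] Q0[OF that] T0[of \<pi>] by simp (intro sum_nonneg mult_nonneg_nonneg, auto)
  have ne: "min_actions G i \<noteq> {}" "max_actions G i \<noteq> {}" if "i < n" for i
    using G that by (auto simp: valid_game_def n_def)
  obtain \<sigma>0 where s0: "\<sigma>0 \<in> min_policies G"
    by (rule min_policies_ex[of G "\<lambda>_ _. True"]) (use ne in \<open>auto simp: n_def ex_in_conv\<close>)
  obtain \<delta>0 where d0: "\<delta>0 \<in> max_policies G"
    by (rule max_policies_ex[of G "\<lambda>_ _ _. True"]) (use ne in \<open>auto simp: n_def ex_in_conv\<close>)
  have "finite Ps" "Ps \<noteq> {}"
    using finite_min_policies[OF G] finite_max_policies[OF G] s0 d0 by (auto simp: Ps_def)
  then obtain \<pi> where \<pi>: "\<pi> \<in> Ps" and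
    max: "\<And>\<pi>'. \<pi>' \<in> Ps \<Longrightarrow> (\<Sum>i<n. T \<pi>' i) \<le> (\<Sum>i<n. T \<pi> i)"
    using finite_has_maximal[of "(\<lambda>\<pi>. \<Sum>i<n. T \<pi> i) ` Ps"] by (fastforce simp: image_iff)
  obtain \<sigma> \<delta> where \<pi>_eq: "\<pi> = (\<sigma>, \<delta>)" by (cases \<pi>)
  show thesis
  proof (rule that[of "T \<pi>"], goal_cases)
    case (1 i)
    then have "mean_return_time n (policy_matrix G \<sigma> \<delta>) i c \<le> ennreal K"
      using \<pi> by (intro K) (auto simp: \<pi>_eq Ps_def n_def)
    moreover have "1 \<le> T \<pi> i" using T1[OF \<pi>] 1 by (simp add: n_def)
    \<comment> \<open>\<open>ennreal\<close> sends negative numbers to 0, so the bound on the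
      extended time becomes a bound by \<open>K\<close> itself only for nonnegative
      \<open>K\<close>. For negative \<open>K\<close> the return time would be 0, against
      \<open>1 \<le> T \<pi> i\<close>.\<close>
    moreover have "0 \<le> K"
    proof (rule ccontr)
      assume "\<not> 0 \<le> K"
      then have "ennreal K = 0" by (simp add: ennreal_neg)
      with calculation show False by (simp add: T_def \<pi>_eq)
    qed
    ultimately show ?case
      by (auto simp: T_def \<pi>_eq dest: enn2real_mono[of _ "ennreal K"])
  next
    case (2 i a b)
    then have i: "i < n" by (simp add: n_def)
    show ?case
    proof (rule ccontr)
      assume "\<not> ?thesis"
      then have gt: "T \<pi> i < 1 + (\<Sum>j\<in>{..<n} - {c}. trans G i a b j * T \<pi> j)"
        by (simp add: n_def c_def)
      define \<pi>' where "\<pi>' = (\<sigma>(i := a), \<delta>((i, a) := b))"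
      have \<pi>': "\<pi>' \<in> Ps"
        using \<pi> 2 unfolding \<pi>_eq \<pi>'_def Ps_def min_policies_def max_policies_def
        by (auto intro!: PiE_I simp: PiE_iff extensional_def split: if_splits)
      \<comment> \<open>Only row \<open>i\<close> changes: at every other state the minimizer acts
        as before, and the altered pair \<open>(i, a)\<close> is not consulted.\<close>
      have Q': "Q \<pi>' k j = (if k = i then trans G i a b j else Q \<pi> k j)" for k j
        by (auto simp: Q_def \<pi>'_def \<pi>_eq policy_matrix_def)
      define x where "x j = T \<pi>' j - T \<pi> j" for j
      have x_eq: "x k = (\<Sum>j\<in>{..<n} - {c}. Q \<pi>' k j * x j) +
        (1 + (\<Sum>j\<in>{..<n} - {c}. Q \<pi>' k j * T \<pi> j) - T \<pi> k)" if "k < n" for k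
        using T_eq[OF \<pi>' that] by (simp add: x_def right_diff_distrib sum_subtractf)
      have ge: "T \<pi> k \<le> 1 + (\<Sum>j\<in>{..<n} - {c}. Q \<pi>' k j * T \<pi> j)" if "k < n" for k
        using T_eq[OF \<pi> that] gt by (cases "k = i") (auto simp: Q')
      \<comment> \<open>The gains \<open>x\<close> satisfy the inequality of the killed chain for
        the new pair of policies, whose own return times serve as the supersolution. Hence no return
        time decreases, and the strict inequality at \<open>i\<close> makes the sum grow.\<close>
      have x0: "0 \<le> x k" if "k < n" for k
      proof (rule killed_chain_nonneg[where T = "T \<pi>'" and M = "Q \<pi>'" and c = c, OF _ _ _ _ that])
        show "(\<Sum>j\<in>{..<n} - {c}. Q \<pi>' k j * x j) \<le> x k" if "k < n" for k
          using x_eq[OF that] ge[OF that] by simp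
        show "1 + (\<Sum>j\<in>{..<n} - {c}. Q \<pi>' k j * T \<pi>' j) \<le> T \<pi>' k" if "k < n" for k
          using T_eq[OF \<pi>' that] by simp
        show "0 < T \<pi>' k" if "k < n" for k using T1[OF \<pi>' that] by simp
      qed (use Q0[OF \<pi>'] in auto)
      have "0 \<le> (\<Sum>j\<in>{..<n} - {c}. Q \<pi>' i j * x j)"
        using x0 Q0[OF \<pi>' i] by (intro sum_nonneg) auto
      then have "0 < x i" using x_eq[OF i] gt by (simp add: Q')
      then have "0 < (\<Sum>k<n. x k)" using x0 i by (intro sum_pos2[of _ i]) auto
      then show False using max[OF \<pi>'] by (simp add: x_def sum_subtractf)
    qed
  qed
qed

section \<open>Transformation to a discounted game\<close>

text \<open>
  Substituting \<open>v\<^sub>i = u\<^sub>i (w\<^sub>i - \<eta>)\<close>, hence \<open>w\<^sub>c = \<eta>\<close>, turns \<open>\<eta> + v = f(v)\<close>, \<open>v\<^sub>c = 0\<close> into a fixed point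
  equation for \<open>w\<close> with nonnegative coefficients whose row sums are \<open>1 - 1 / u\<^sub>i\<close>.
\<close>

definition discounted :: "game \<Rightarrow> (nat \<Rightarrow> real) \<Rightarrow> nat \<Rightarrow> nat \<Rightarrow> nat \<Rightarrow> (nat \<Rightarrow> real) \<Rightarrow> real" where
  "discounted G u i a b w =
     ((\<Sum>j\<in>{..<states G} - {centre G}. trans G i a b j * u j * w j) +
      w (centre G) * (u i - 1 - (\<Sum>j\<in>{..<states G} - {centre G}. trans G i a b j * u j)) +
      payment G i a b) / u i"

text \<open>The return times enter the further analysis only through the weight \<open>u\<close>.
  The conditions on \<open>u\<close> concern transitions alone, so the same weight fits the game
  with other payments; \<open>evaluation_unique\<close> relies on this.\<close>

locale weighted_game =
  fixes G :: game and K :: real and u :: "nat \<Rightarrow> real"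
  assumes valid: "valid_game G"
    and u: "i < states G \<Longrightarrow> 1 \<le> u i \<and> u i \<le> K"
    and step: "i < states G \<Longrightarrow> a \<in> min_actions G i \<Longrightarrow> b \<in> max_actions G i \<Longrightarrow>
      1 + (\<Sum>j\<in>{..<states G} - {centre G}. trans G i a b j * u j) \<le> u i"
begin

abbreviation "n \<equiv> states G"
abbreviation "c \<equiv> centre G"
abbreviation "\<gamma> \<equiv> 1 - 1 / K"

lemma c: "c < n" and finite_actions: "i < n \<Longrightarrow> finite (min_actions G i) \<and> min_actions G i \<noteq> {}"
  "i < n \<Longrightarrow> finite (max_actions G i) \<and> max_actions G i \<noteq> {}"
  and trans_nonneg: "i < n \<Longrightarrow> a \<in> min_actions G i \<Longrightarrow> b \<in> max_actions G i \<Longrightarrow> j < n \<Longrightarrow> 0 \<le> trans G i a b j"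
  using valid by (auto simp: valid_game_def)

lemma K: "1 \<le> K" using u[OF c] by simp

lemma discount_factor: "0 \<le> \<gamma>" "\<gamma> < 1" using K by auto

text \<open>The coefficient at the centre is exactly the slack in \<open>step\<close>. So it is
  nonnegative and fills the row up to \<open>u i - 1\<close>; dividing by \<open>u i\<close> and
  using \<open>u i \<le> K\<close> gives the common factor.\<close>

lemma contractive_discounted:
  assumes i: "i < n" "a \<in> min_actions G i" "b \<in> max_actions G i"
  shows "contractive n \<gamma> (discounted G u i a b)"
  unfolding contractive_def
proof (intro allI impI)
  fix x y :: "nat \<Rightarrow> real" and e :: real
  assume e: "0 \<le> e" "\<forall>j<n. x j \<le> y j + e"
  let ?S = "{..<n} - {c}"
  let ?q = "\<lambda>j. trans G i a b j * u j"
  let ?d = "u i - 1 - (\<Sum>j\<in>?S. ?q j)"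
  have ui: "1 \<le> u i" "u i \<le> K" using u[OF i(1)] by auto
  have "(\<Sum>j\<in>?S. ?q j * x j) \<le> (\<Sum>j\<in>?S. ?q j * (y j + e))"
  proof (intro sum_mono mult_left_mono mult_nonneg_nonneg)
    fix j assume "j \<in> ?S"
    then show "x j \<le> y j + e" "0 \<le> trans G i a b j" "0 \<le> u j"
      using e trans_nonneg[OF i] u[of j] by auto
  qed
  also have "\<dots> = (\<Sum>j\<in>?S. ?q j * y j) + (\<Sum>j\<in>?S. ?q j) * e"
    by (simp add: distrib_left sum.distrib sum_distrib_right)
  finally have "(\<Sum>j\<in>?S. ?q j * x j) \<le> (\<Sum>j\<in>?S. ?q j * y j) + (\<Sum>j\<in>?S. ?q j) * e" .
  moreover have "x c * ?d \<le> (y c + e) * ?d"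
    using e c step[OF i] by (intro mult_right_mono) auto
  ultimately have "(\<Sum>j\<in>?S. ?q j * x j) + x c * ?d + payment G i a b \<le>
      (\<Sum>j\<in>?S. ?q j * y j) + y c * ?d + payment G i a b + (u i - 1) * e"
    by (simp add: algebra_simps)
  then have "discounted G u i a b x \<le>
      ((\<Sum>j\<in>?S. ?q j * y j) + y c * ?d + payment G i a b + (u i - 1) * e) / u i"
    unfolding discounted_def using ui by (intro divide_right_mono) auto
  also have "\<dots> = discounted G u i a b y + (1 - 1 / u i) * e"
    unfolding discounted_def using ui by (simp add: field_simps)
  also have "\<dots> \<le> discounted G u i a b y + \<gamma> * e"
    using ui e(1) by (intro add_left_mono mult_right_mono) (auto simp: frac_le)
  finally show "discounted G u i a b x \<le> discounted G u i a b y + \<gamma> * e" .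
qed

text \<open>The residual of the discounted equation is the residual of the additive eigenproblem
  divided by \<open>u i\<close>. Hence solutions correspond, and at each state both problems order
  the actions alike.\<close>

lemma discounted_eq:
  assumes "v c = 0" "i < n"
  shows "discounted G u i a b (\<lambda>j. v j / u j + \<eta>) =
    (v i / u i + \<eta>) + (local_value G v i a b - (\<eta> + v i)) / u i"
proof -
  let ?S = "{..<n} - {c}"
  have u0: "u j \<noteq> 0" if "j < n" for j using u[OF that] by auto
  have "(\<Sum>j\<in>?S. trans G i a b j * u j * (v j / u j + \<eta>)) =
      (\<Sum>j\<in>?S. trans G i a b j * v j) + \<eta> * (\<Sum>j\<in>?S. trans G i a b j * u j)"
    unfolding sum_distrib_left sum.distrib[symmetric]
    using u0 by (intro sum.cong) (auto simp: field_simps)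
  also have "(\<Sum>j\<in>?S. trans G i a b j * v j) = (\<Sum>j<n. trans G i a b j * v j)"
    using assms by (intro sum.mono_neutral_left) auto
  finally show ?thesis
    unfolding discounted_def local_value_def using assms u0[OF assms(2)]
    by (simp add: field_simps)
qed

lemma discounted_optimal_eq:
  assumes "v c = 0" "i < n"
  shows "Max ((\<lambda>b. discounted G u i a b (\<lambda>j. v j / u j + \<eta>)) ` max_actions G i) =
    (v i / u i + \<eta>) + (max_value G v i a - (\<eta> + v i)) / u i"
proof -
  let ?f = "\<lambda>x. (v i / u i + \<eta>) + (x - (\<eta> + v i)) / u i"
  have "mono ?f" using u[OF assms(2)] by (intro monoI add_left_mono divide_right_mono) auto
  then have "?f (Max (local_value G v i a ` max_actions G i)) =
      Max (?f ` local_value G v i a ` max_actions G i)"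
    using finite_actions(2)[OF assms(2)] by (intro mono_Max_commute) auto
  then show ?thesis by (simp add: max_value_def image_image discounted_eq[where v = v and i = i, OF assms])
qed

section \<open>Ranks for the inner and the outer iteration\<close>

lemma discounted_le_iff:
  assumes "i < n"
  shows "z + (x - w) / u i \<le> z + (y - w) / u i \<longleftrightarrow> x \<le> y"
  using u[OF assms] by (simp add: divide_le_cancel)

text \<open>Once \<open>\<sigma>\<close> is fixed, the maximizer faces a one-player problem that is
  governed by the answers to \<open>\<sigma>\<close>. So \<open>\<pi>\<close> stands for the map
  taking \<open>i\<close> to \<open>\<delta> (i, \<sigma> i)\<close>.\<close>

lemma inner_rank:
  assumes \<sigma>: "\<sigma> \<in> min_policies G" and L: "\<gamma> ^ L < 1 - \<gamma>"
  obtains \<rho> :: "(nat \<Rightarrow> nat) \<Rightarrow> nat" where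
    "\<And>\<pi>. \<rho> \<pi> \<le> L * card (SIGMA i:{..<n}. max_actions G i)"
    "\<And>\<pi> \<pi>' \<eta> v. (\<And>i. i < n \<Longrightarrow> \<pi> i \<in> max_actions G i) \<Longrightarrow>
      (\<And>i. i < n \<Longrightarrow> \<pi>' i \<in> max_actions G i) \<Longrightarrow> v c = 0 \<Longrightarrow>
      (\<And>i. i < n \<Longrightarrow> \<eta> + v i = local_value G v i (\<sigma> i) (\<pi> i)) \<Longrightarrow>
      (\<And>i. i < n \<Longrightarrow> local_value G v i (\<sigma> i) (\<pi>' i) = max_value G v i (\<sigma> i)) \<Longrightarrow>
      \<not> (\<forall>i<n. local_value G v i (\<sigma> i) (\<pi> i) = max_value G v i (\<sigma> i)) \<Longrightarrow> \<rho> \<pi>' < \<rho> \<pi>"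
proof (rule policy_iteration_rank_max[where h = "\<lambda>i b. discounted G u i (\<sigma> i) b" and
      A = "max_actions G" and n = n, OF discount_factor L finite_actions(2)], simp, goal_cases)
  case (1 i a)
  then show ?case using contractive_discounted min_policiesD[OF \<sigma>] by auto
next
  case (2 \<rho>)
  show ?thesis
  proof (rule that[OF 2(2)])
    fix \<pi> \<pi>' \<eta> v
    assume \<pi>: "\<And>i. i < n \<Longrightarrow> \<pi> i \<in> max_actions G i" "\<And>i. i < n \<Longrightarrow> \<pi>' i \<in> max_actions G i"
      and v: "v c = 0" "\<And>i. i < n \<Longrightarrow> \<eta> + v i = local_value G v i (\<sigma> i) (\<pi> i)"
      and greedy: "\<And>i. i < n \<Longrightarrow> local_value G v i (\<sigma> i) (\<pi>' i) = max_value G v i (\<sigma> i)"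
      and nopt: "\<not> (\<forall>i<n. local_value G v i (\<sigma> i) (\<pi> i) = max_value G v i (\<sigma> i))"
    have le: "local_value G v i (\<sigma> i) b \<le> max_value G v i (\<sigma> i)" if "i < n" "b \<in> max_actions G i" for i b
      unfolding max_value_def using finite_actions(2)[OF that(1)] that(2) by auto
    show "\<rho> \<pi>' < \<rho> \<pi>"
    proof (rule 2(3)[of \<pi> \<pi>' "\<lambda>j. v j / u j + \<eta>"])
      show "discounted G u i (\<sigma> i) (\<pi> i) (\<lambda>j. v j / u j + \<eta>) = v i / u i + \<eta>" if "i < n" for i
        using v that by (simp add: discounted_eq)
      show "discounted G u i (\<sigma> i) b (\<lambda>j. v j / u j + \<eta>)
          \<le> discounted G u i (\<sigma> i) (\<pi>' i) (\<lambda>j. v j / u j + \<eta>)"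
        if "i < n" "b \<in> max_actions G i" for i b
        unfolding discounted_eq[of v, OF v(1) that(1)] discounted_le_iff[OF that(1)]
        using greedy le that by simp
      show "\<not> (\<forall>i<n. \<forall>b\<in>max_actions G i. discounted G u i (\<sigma> i) b (\<lambda>j. v j / u j + \<eta>)
          \<le> discounted G u i (\<sigma> i) (\<pi> i) (\<lambda>j. v j / u j + \<eta>))"
      proof
        assume *: "\<forall>i<n. \<forall>b\<in>max_actions G i. discounted G u i (\<sigma> i) b (\<lambda>j. v j / u j + \<eta>)
          \<le> discounted G u i (\<sigma> i) (\<pi> i) (\<lambda>j. v j / u j + \<eta>)"
        have "local_value G v i (\<sigma> i) (\<pi> i) = max_value G v i (\<sigma> i)" if i: "i < n" for i
        proof (rule antisym[OF le[OF i \<pi>(1)[OF i]]])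
          have "discounted G u i (\<sigma> i) (\<pi>' i) (\<lambda>j. v j / u j + \<eta>)
            \<le> discounted G u i (\<sigma> i) (\<pi> i) (\<lambda>j. v j / u j + \<eta>)"
            using * i \<pi>(2) by blast
          then show "max_value G v i (\<sigma> i) \<le> local_value G v i (\<sigma> i) (\<pi> i)"
            unfolding discounted_eq[of v, OF v(1) i] discounted_le_iff[OF i] greedy[OF i] .
        qed
        with nopt show False by blast
      qed
    qed (use \<pi> in auto)
  qed
qed

text \<open>The inner problem is solved exactly, so on this level the operator of an action is the
  maximum over all answers. Such a maximum is contractive with the same factor, and the one-player
  analysis applies again.\<close>

lemma outer_rank:
  assumes L: "\<gamma> ^ L < 1 - \<gamma>"
  obtains \<rho> :: "(nat \<Rightarrow> nat) \<Rightarrow> nat" where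
    "\<And>\<sigma>. \<rho> \<sigma> \<le> L * card (SIGMA i:{..<n}. min_actions G i)"
    "\<And>\<sigma> \<sigma>' \<eta> v. (\<And>i. i < n \<Longrightarrow> \<sigma> i \<in> min_actions G i) \<Longrightarrow>
      (\<And>i. i < n \<Longrightarrow> \<sigma>' i \<in> min_actions G i) \<Longrightarrow> v c = 0 \<Longrightarrow>
      (\<And>i. i < n \<Longrightarrow> \<eta> + v i = max_value G v i (\<sigma> i)) \<Longrightarrow>
      (\<And>i. i < n \<Longrightarrow> max_value G v i (\<sigma>' i) = shapley G v i) \<Longrightarrow>
      \<not> (\<forall>i<n. max_value G v i (\<sigma> i) = shapley G v i) \<Longrightarrow> \<rho> \<sigma>' < \<rho> \<sigma>"
proof -
  define h where "h i a w = Max ((\<lambda>b. discounted G u i a b w) ` max_actions G i)" for i a w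
  have h_eq: "h i a (\<lambda>j. v j / u j + \<eta>) = (v i / u i + \<eta>) + (max_value G v i a - (\<eta> + v i)) / u i"
    if "v c = 0" "i < n" for v i a \<eta>
    unfolding h_def by (rule discounted_optimal_eq[where v = v and i = i, OF that])
  show ?thesis
  proof (rule policy_iteration_rank[where h = h and
      A = "min_actions G" and n = n, OF discount_factor L finite_actions(1)], simp, goal_cases)
    case (1 i a)
    then show ?case unfolding h_def
      using contractive_discounted finite_actions by (intro contractive_Max) auto
  next
    case (2 \<rho>)
    show ?thesis
    proof (rule that[OF 2(1)])
      fix \<sigma> \<sigma>' \<eta> v
      assume \<sigma>: "\<And>i. i < n \<Longrightarrow> \<sigma> i \<in> min_actions G i" "\<And>i. i < n \<Longrightarrow> \<sigma>' i \<in> min_actions G i"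
        and v: "v c = 0" "\<And>i. i < n \<Longrightarrow> \<eta> + v i = max_value G v i (\<sigma> i)"
        and greedy: "\<And>i. i < n \<Longrightarrow> max_value G v i (\<sigma>' i) = shapley G v i"
        and nopt: "\<not> (\<forall>i<n. max_value G v i (\<sigma> i) = shapley G v i)"
      have le: "shapley G v i \<le> max_value G v i a" if "i < n" "a \<in> min_actions G i" for i a
        unfolding shapley_def using finite_actions(1)[OF that(1)] that(2) by auto
      show "\<rho> \<sigma>' < \<rho> \<sigma>"
      proof (rule 2(2)[of \<sigma> \<sigma>' "\<lambda>j. v j / u j + \<eta>"])
        show "h i (\<sigma> i) (\<lambda>j. v j / u j + \<eta>) = v i / u i + \<eta>" if "i < n" for i
          using v that by (simp add: h_eq)
        show "h i (\<sigma>' i) (\<lambda>j. v j / u j + \<eta>) \<le> h i a (\<lambda>j. v j / u j + \<eta>)"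
          if "i < n" "a \<in> min_actions G i" for i a
          unfolding h_eq[of v, OF v(1) that(1)] discounted_le_iff[OF that(1)]
          using greedy le that by simp
        show "\<not> (\<forall>i<n. \<forall>a\<in>min_actions G i.
            h i (\<sigma> i) (\<lambda>j. v j / u j + \<eta>) \<le> h i a (\<lambda>j. v j / u j + \<eta>))"
        proof
          assume *: "\<forall>i<n. \<forall>a\<in>min_actions G i.
            h i (\<sigma> i) (\<lambda>j. v j / u j + \<eta>) \<le> h i a (\<lambda>j. v j / u j + \<eta>)"
          have "max_value G v i (\<sigma> i) = shapley G v i" if i: "i < n" for i
          proof (rule antisym[OF _ le[OF i \<sigma>(1)[OF i]]])
            have "h i (\<sigma> i) (\<lambda>j. v j / u j + \<eta>) \<le> h i (\<sigma>' i) (\<lambda>j. v j / u j + \<eta>)"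
              using * i \<sigma>(2) by blast
            then show "max_value G v i (\<sigma> i) \<le> shapley G v i"
              unfolding h_eq[of v, OF v(1) i] discounted_le_iff[OF i] greedy[OF i] .
          qed
          with nopt show False by blast
        qed
      qed (use \<sigma> in auto)
    qed
  qed
qed

text \<open>The hypotheses are the evaluation equation of the game with zero payments, whose
  discounted operator fixes the zero vector. By uniqueness \<open>y j / u j + \<eta>\<close>
  vanishes; at the centre this says \<open>\<eta> = 0\<close>, and then \<open>y\<close> vanishes as
  well.\<close>

lemma evaluation_unique:
  assumes a: "\<And>i. i < n \<Longrightarrow> a i \<in> min_actions G i" and b: "\<And>i. i < n \<Longrightarrow> b i \<in> max_actions G i"
    and y: "\<And>i. i < n \<Longrightarrow> y i + \<eta> = (\<Sum>j<n. trans G i (a i) (b i) j * y j)" and yc: "y c = 0"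
  shows "\<eta> = 0" "i < n \<Longrightarrow> y i = 0"
proof -
  let ?G = "G\<lparr>payment := \<lambda>_ _ _. 0\<rparr>"
  interpret G0: weighted_game ?G K u
    by unfold_locales (use valid u step in \<open>auto simp: valid_game_def\<close>)
  let ?w = "\<lambda>j. y j / u j + \<eta>"
  have w0: "?w i = 0" if "i < n" for i
  proof (rule contractive_unique[where y = ?w and w = "\<lambda>_. 0" and
        F = "\<lambda>i. discounted ?G u i (a i) (b i)", OF discount_factor _ _ _ that])
    show "contractive n \<gamma> (discounted ?G u i (a i) (b i))" if "i < n" for i
      using G0.contractive_discounted[of i "a i" "b i"] a b that by simp
    show "discounted ?G u i (a i) (b i) ?w = ?w i" if "i < n" for i
      using G0.discounted_eq[of y i "a i" "b i" \<eta>] that y[OF that] yc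
      by (simp add: local_value_def add.commute)
  qed (simp add: discounted_def)
  then show "\<eta> = 0" using c yc by force
  with w0 show "y i = 0" if "i < n" using u[OF that] that by force
qed

end

section \<open>The value of the game\<close>

text \<open>\<open>v\<close> acts as a potential: a step pays at most \<open>\<eta>\<close> plus the
  expected decrease of \<open>v\<close>, and this telescopes over the horizon. The constant
  \<open>C\<close> makes \<open>v i + C\<close> nonnegative, as horizon 0 requires. The induction
  covers all histories because the opponent may depend on them.\<close>

lemma total_payment_upper:
  assumes opt: "\<And>h i. i < states G \<Longrightarrow> \<alpha> h i \<in> min_actions G i \<and>
      (\<forall>b\<in>max_actions G i. local_value G v i (\<alpha> h i) b \<le> \<eta> + v i)"
    and valid: "valid_game G" and \<beta>: "\<beta> \<in> max_strategies G" and C: "\<And>i. i < states G \<Longrightarrow> - C \<le> v i"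
    and "i < states G"
  shows "total_payment G \<alpha> \<beta> N h i \<le> real N * \<eta> + v i + C"
  using \<open>i < states G\<close>
proof (induction N arbitrary: h i)
  case 0
  then show ?case using C[of i] by simp
next
  case (Suc N)
  let ?a = "\<alpha> h i" let ?b = "\<beta> h i ?a" let ?n = "states G"
  have a: "?a \<in> min_actions G i" using opt Suc.prems by blast
  then have b: "?b \<in> max_actions G i" using \<beta> Suc.prems by (auto simp: max_strategies_def)
  have M: "\<And>j. j < ?n \<Longrightarrow> 0 \<le> trans G i ?a ?b j" "(\<Sum>j<?n. trans G i ?a ?b j) = 1"
    using valid a b Suc.prems by (auto simp: valid_game_def)
  have "total_payment G \<alpha> \<beta> (Suc N) h i = payment G i ?a ?b +
      (\<Sum>j<?n. trans G i ?a ?b j * total_payment G \<alpha> \<beta> N (h @ [(i, ?a, ?b)]) j)"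
    by (simp add: Let_def)
  also have "\<dots> \<le> payment G i ?a ?b + (\<Sum>j<?n. trans G i ?a ?b j * (real N * \<eta> + v j + C))"
    using M Suc.IH by (intro add_left_mono sum_mono mult_left_mono) auto
  also have "\<dots> = local_value G v i ?a ?b + (\<Sum>j<?n. trans G i ?a ?b j) * (real N * \<eta> + C)"
    by (simp add: local_value_def sum_distrib_right sum.distrib distrib_left)
  also have "\<dots> \<le> \<eta> + v i + (real N * \<eta> + C)"
    using opt[OF Suc.prems] b M(2) by simp
  finally show ?case by (simp add: algebra_simps)
qed

lemma total_payment_lower:
  assumes opt: "\<And>h i a. i < states G \<Longrightarrow> a \<in> min_actions G i \<Longrightarrow> \<beta> h i a \<in> max_actions G i \<and>
      \<eta> + v i \<le> local_value G v i a (\<beta> h i a)"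
    and valid: "valid_game G" and \<alpha>: "\<alpha> \<in> min_strategies G" and C: "\<And>i. i < states G \<Longrightarrow> v i \<le> C"
    and "i < states G"
  shows "real N * \<eta> + v i - C \<le> total_payment G \<alpha> \<beta> N h i"
  using \<open>i < states G\<close>
proof (induction N arbitrary: h i)
  case 0
  then show ?case using C[of i] by simp
next
  case (Suc N)
  let ?a = "\<alpha> h i" let ?b = "\<beta> h i ?a" let ?n = "states G"
  have a: "?a \<in> min_actions G i" using \<alpha> Suc.prems by (auto simp: min_strategies_def)
  then have b: "?b \<in> max_actions G i" using opt Suc.prems by blast
  have M: "\<And>j. j < ?n \<Longrightarrow> 0 \<le> trans G i ?a ?b j" "(\<Sum>j<?n. trans G i ?a ?b j) = 1"
    using valid a b Suc.prems by (auto simp: valid_game_def)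
  have "\<eta> + v i + (real N * \<eta> - C) \<le>
      local_value G v i ?a ?b + (\<Sum>j<?n. trans G i ?a ?b j) * (real N * \<eta> - C)"
    using opt[OF Suc.prems a] M(2) by simp
  also have "\<dots> = payment G i ?a ?b + (\<Sum>j<?n. trans G i ?a ?b j * (real N * \<eta> + v j - C))"
    by (simp add: local_value_def sum_distrib_right sum_distrib_left sum.distrib distrib_left
        right_diff_distrib sum_subtractf)
  also have "\<dots> \<le> payment G i ?a ?b +
      (\<Sum>j<?n. trans G i ?a ?b j * total_payment G \<alpha> \<beta> N (h @ [(i, ?a, ?b)]) j)"
    using M Suc.IH by (intro add_left_mono sum_mono mult_left_mono) auto
  also have "\<dots> = total_payment G \<alpha> \<beta> (Suc N) h i" by (simp add: Let_def)
  finally show ?case by (simp add: algebra_simps)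
qed

lemma average_tendsto: "(\<lambda>N. ereal ((real N * \<eta> + C) / real N)) \<longlonglongrightarrow> ereal \<eta>"
proof -
  have "(\<lambda>N. \<eta> + C / real N) \<longlonglongrightarrow> \<eta> + 0"
    by (intro tendsto_intros lim_const_over_n)
  \<comment> \<open>At \<open>N = 0\<close> division by zero yields 0 and the two sides can differ,
    so the equality is claimed only eventually.\<close>
  moreover have "\<forall>\<^sub>F N in sequentially. \<eta> + C / real N = (real N * \<eta> + C) / real N"
    using eventually_gt_at_top[of 0] by eventually_elim (simp add: field_simps)
  ultimately have "(\<lambda>N. (real N * \<eta> + C) / real N) \<longlonglongrightarrow> \<eta>"
    by (simp add: Lim_transform_eventually)
  then show ?thesis by simp
qed

text \<open>Positional strategies that are greedy for \<open>v\<close> certify the value on both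
  sides: against every history-dependent opponent they keep the total payment within a constant of
  \<open>N * \<eta>\<close> on the favourable side, and the constant vanishes in the
  average.\<close>

lemma ergodic_equation_value:
  assumes valid: "valid_game G" and eq: "\<And>i. i < states G \<Longrightarrow> \<eta> + v i = shapley G v i"
    and i: "i < states G"
  shows "mean_payoff_value G i \<eta>"
proof -
  let ?n = "states G"
  have fin: "finite (min_actions G i)" "min_actions G i \<noteq> {}" "finite (max_actions G i)"
    "max_actions G i \<noteq> {}" if "i < ?n" for i
    using valid that by (auto simp: valid_game_def)
  define C where "C = (\<Sum>j<?n. \<bar>v j\<bar>)"
  have "\<bar>v j\<bar> \<le> C" if "j < ?n" for j
    unfolding C_def using that by (intro member_le_sum[of j "{..<?n}" "\<lambda>j. \<bar>v j\<bar>"]) auto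
  then have C: "- C \<le> v j" "v j \<le> C" if "j < ?n" for j using that by (force simp: abs_le_iff)+
  have "\<exists>a\<in>min_actions G i. max_value G v i a = shapley G v i" if "i < ?n" for i
    using Min_in[of "max_value G v i ` min_actions G i"] fin[OF that]
    unfolding shapley_def by (metis finite_imageI image_is_empty imageE)
  then obtain s where s: "\<And>i. i < ?n \<Longrightarrow> s i \<in> min_actions G i \<and> max_value G v i (s i) = shapley G v i"
    by metis
  have "\<exists>b\<in>max_actions G i. local_value G v i a b = max_value G v i a" if "i < ?n" for i a
    using Max_in[of "local_value G v i a ` max_actions G i"] fin[OF that]
    unfolding max_value_def by (metis finite_imageI image_is_empty imageE)
  then obtain d where d: "\<And>i a. i < ?n \<Longrightarrow> d i a \<in> max_actions G i \<and>
      local_value G v i a (d i a) = max_value G v i a"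
    by metis
  have le: "local_value G v i a b \<le> max_value G v i a" if "i < ?n" "b \<in> max_actions G i" for i a b
    using fin[OF that(1)] that by (auto simp: max_value_def)
  have ge: "shapley G v i \<le> max_value G v i a" if "i < ?n" "a \<in> min_actions G i" for i a
    using fin[OF that(1)] that by (auto simp: shapley_def)
  have s_le: "local_value G v i (s i) b \<le> \<eta> + v i" if "i < ?n" "b \<in> max_actions G i" for i b
    using le[OF that, of "s i"] s[OF that(1)] eq[OF that(1)] by simp
  have d_ge: "\<eta> + v i \<le> local_value G v i a (d i a)" if "i < ?n" "a \<in> min_actions G i" for i a
    using ge[OF that] d[OF that(1)] eq[OF that(1)] by simp
  show ?thesis
    unfolding mean_payoff_value_def
  proof (intro conjI bexI ballI)
    fix \<beta> assume \<beta>: "\<beta> \<in> max_strategies G"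
    have "total_payment G (\<lambda>h. s) \<beta> N [] i \<le> real N * \<eta> + (v i + C)" for N
      using total_payment_upper[of G "\<lambda>h. s" v \<eta> \<beta> C i N "[]"] valid \<beta> C(1) i s s_le by (simp add: add.assoc)
    then have "limsup (\<lambda>N. ereal (total_payment G (\<lambda>h. s) \<beta> N [] i / real N)) \<le>
        limsup (\<lambda>N. ereal ((real N * \<eta> + (v i + C)) / real N))"
      by (intro Limsup_mono always_eventually allI) (simp add: divide_right_mono)
    also have "\<dots> = ereal \<eta>" by (rule lim_imp_Limsup[OF _ average_tendsto]) simp
    finally show "limsup (\<lambda>N. ereal (total_payment G (\<lambda>h. s) \<beta> N [] i / real N)) \<le> ereal \<eta>" .
  next
    fix \<alpha> assume \<alpha>: "\<alpha> \<in> min_strategies G"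
    have "real N * \<eta> + (v i - C) \<le> total_payment G \<alpha> (\<lambda>h. d) N [] i" for N
      using total_payment_lower[of G "\<lambda>h. d" \<eta> v \<alpha> C i N "[]"] valid \<alpha> C(2) i d d_ge
      by (simp add: add_diff_eq)
    then have "liminf (\<lambda>N. ereal ((real N * \<eta> + (v i - C)) / real N)) \<le>
        liminf (\<lambda>N. ereal (total_payment G \<alpha> (\<lambda>h. d) N [] i / real N))"
      by (intro Liminf_mono always_eventually allI) (simp add: divide_right_mono)
    moreover have "liminf (\<lambda>N. ereal ((real N * \<eta> + (v i - C)) / real N)) = ereal \<eta>"
      by (rule lim_imp_Liminf[OF _ average_tendsto]) simp
    ultimately show "ereal \<eta> \<le> liminf (\<lambda>N. ereal (total_payment G \<alpha> (\<lambda>h. d) N [] i / real N))"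
      by simp
  qed (use s d in \<open>auto simp: min_strategies_def max_strategies_def\<close>)
qed

section \<open>Sizes of rational numbers\<close>

text \<open>
  Magnitude and denominator are bounded separately: unlike for the bit size itself, these bounds
  grow only linearly with the number of summands.
\<close>

definition rat_bounded :: "nat \<Rightarrow> nat \<Rightarrow> real \<Rightarrow> bool" where
  "rat_bounded P Q x \<longleftrightarrow> \<bar>x\<bar> \<le> 2 ^ P \<and> (\<exists>d::nat. 0 < d \<and> d \<le> 2 ^ Q \<and> of_nat d * x \<in> \<int>)"

lemma rat_bounded_mono:
  assumes "rat_bounded P Q x" "P \<le> P'" "Q \<le> Q'"
  shows "rat_bounded P' Q' x"
proof -
  have "(2::real) ^ P \<le> 2 ^ P'" "(2::nat) ^ Q \<le> 2 ^ Q'" using assms by auto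
  then show ?thesis using assms(1) unfolding rat_bounded_def by (meson order_trans)
qed

lemma rat_bounded_0: "rat_bounded P Q 0" and rat_bounded_1: "rat_bounded P Q 1"
  by (auto simp: rat_bounded_def intro!: exI[of _ 1])

lemma rat_bounded_uminus: "rat_bounded P Q x \<Longrightarrow> rat_bounded P Q (- x)"
  by (auto simp: rat_bounded_def)

lemma rat_bounded_add:
  assumes "rat_bounded P Q x" "rat_bounded P' Q' y"
  shows "rat_bounded (Suc (max P P')) (Q + Q') (x + y)"
proof -
  from assms obtain d e :: nat where d: "0 < d" "d \<le> 2 ^ Q" "of_nat d * x \<in> \<int>"
    and e: "0 < e" "e \<le> 2 ^ Q'" "of_nat e * y \<in> \<int>" and b: "\<bar>x\<bar> \<le> 2 ^ P" "\<bar>y\<bar> \<le> 2 ^ P'"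
    by (auto simp: rat_bounded_def)
  have "(2::real) ^ P \<le> 2 ^ max P P'" "(2::real) ^ P' \<le> 2 ^ max P P'" by auto
  then have "\<bar>x + y\<bar> \<le> 2 ^ Suc (max P P')" using b by (simp only: power_Suc)
  moreover have "d * e \<le> 2 ^ (Q + Q')" using d e by (simp add: power_add mult_mono)
  moreover have "of_nat (d * e) * (x + y) \<in> \<int>"
  proof -
    have "of_nat (d * e) * (x + y) = of_nat e * (of_nat d * x) + of_nat d * (of_nat e * y)"
      by (simp add: algebra_simps)
    then show ?thesis using d e by (metis Ints_add Ints_mult Ints_of_nat)
  qed
  ultimately show ?thesis unfolding rat_bounded_def using d e by (metis nat_0_less_mult_iff)
qed

lemma rat_bounded_diff:
  "rat_bounded P Q x \<Longrightarrow> rat_bounded P' Q' y \<Longrightarrow> rat_bounded (Suc (max P P')) (Q + Q') (x - y)"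
  using rat_bounded_add[of P Q x P' Q' "- y"] rat_bounded_uminus by simp

lemma rat_bounded_mult:
  assumes "rat_bounded P Q x" "rat_bounded P' Q' y"
  shows "rat_bounded (P + P') (Q + Q') (x * y)"
proof -
  from assms obtain d e :: nat where d: "0 < d" "d \<le> 2 ^ Q" "of_nat d * x \<in> \<int>"
    and e: "0 < e" "e \<le> 2 ^ Q'" "of_nat e * y \<in> \<int>" and b: "\<bar>x\<bar> \<le> 2 ^ P" "\<bar>y\<bar> \<le> 2 ^ P'"
    by (auto simp: rat_bounded_def)
  have "\<bar>x * y\<bar> \<le> 2 ^ (P + P')" using b by (simp add: power_add abs_mult mult_mono)
  moreover have "d * e \<le> 2 ^ (Q + Q')" using d e by (simp add: power_add mult_mono)
  moreover have "of_nat (d * e) * (x * y) \<in> \<int>"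
  proof -
    have "of_nat (d * e) * (x * y) = (of_nat d * x) * (of_nat e * y)" by (simp add: algebra_simps)
    then show ?thesis using d e by (metis Ints_mult)
  qed
  ultimately show ?thesis unfolding rat_bounded_def using d e by (metis nat_0_less_mult_iff)
qed

lemma bit_size_of_rat:
  "bit_size (of_rat r) = (let (p, q) = quotient_of r in 1 + floorlog 2 (nat \<bar>p\<bar>) + floorlog 2 (nat q))"
  by (simp add: bit_size_def)

text \<open>The denominator in lowest terms divides every \<open>d\<close> for which
  \<open>d * x\<close> is an integer, so it is at most \<open>2 ^ Q\<close>, and the numerator is at
  most \<open>2 ^ (P + Q)\<close>. Sign and digits add up to
  \<open>1 + (P + Q + 1) + (Q + 1)\<close>.\<close>

lemma rat_bounded_imp_bit_size:
  assumes "rat_bounded P Q x"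
  shows "x \<in> \<rat>" "bit_size x \<le> P + 2 * Q + 3"
proof -
  obtain d k where d: "0 < d" "d \<le> 2 ^ Q" "of_nat d * x = of_int k" and b: "\<bar>x\<bar> \<le> 2 ^ P"
    using assms by (auto simp: rat_bounded_def Ints_def)
  have "x = of_int k / of_nat d" using d by (simp add: field_simps)
  then show "x \<in> \<rat>" by simp
  then obtain r where r: "x = of_rat r" by (auto elim: Rats_cases)
  obtain p q where pq: "quotient_of r = (p, q)" by (cases "quotient_of r")
  have q: "0 < q" "coprime p q" using quotient_of_denom_pos[OF pq] quotient_of_coprime[OF pq] .
  have x: "x = of_int p / of_int q"
    using quotient_of_div[OF pq] r by (simp add: of_rat_divide)
  have "real_of_int (int d * p) = real_of_int (k * q)"
    using d(3) q(1) unfolding x by (simp add: field_simps)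
  then have "int d * p = k * q" by (simp only: of_int_eq_iff)
  then have "q dvd int d * p" by simp
  then have "q dvd int d" using q(2) by (simp add: coprime_dvd_mult_left_iff coprime_commute)
  then have "q \<le> int d" using d(1) by (simp add: zdvd_imp_le)
  then have q_le: "nat q \<le> 2 ^ Q" using d(2) by linarith
  have "real_of_int \<bar>p\<bar> = \<bar>x\<bar> * real_of_int q" using q(1) unfolding x by (simp add: abs_mult)
  also have "\<dots> \<le> 2 ^ P * 2 ^ Q"
  proof (rule mult_mono)
    have "real_of_int q = real (nat q)" using q(1) by simp
    also have "\<dots> \<le> real (2 ^ Q)" using q_le by (simp only: of_nat_le_iff)
    finally show "real_of_int q \<le> 2 ^ Q" by simp
  qed (use b q in auto)
  also have "\<dots> = real_of_int (2 ^ (P + Q))" by (simp add: power_add)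
  finally have "\<bar>p\<bar> \<le> 2 ^ (P + Q)" by (simp only: of_int_le_iff)
  then have p_le: "nat \<bar>p\<bar> \<le> 2 ^ (P + Q)" by (simp add: nat_le_iff)
  have "floorlog 2 (nat \<bar>p\<bar>) \<le> Suc (P + Q)"
  proof (rule floorlog_leI)
    show "nat \<bar>p\<bar> < 2 ^ Suc (P + Q)" using p_le by (rule le_less_trans) simp
  qed auto
  moreover have "floorlog 2 (nat q) \<le> Suc Q"
  proof (rule floorlog_leI)
    show "nat q < 2 ^ Suc Q" using q_le by (rule le_less_trans) simp
  qed auto
  ultimately show "bit_size x \<le> P + 2 * Q + 3"
    by (simp add: r bit_size_of_rat pq)
qed

lemma bit_size_imp_rat_bounded:
  assumes "x \<in> \<rat>" "bit_size x \<le> s"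
  shows "rat_bounded s s x"
proof -
  obtain r where r: "x = of_rat r" using assms by (auto elim: Rats_cases)
  obtain p q where pq: "quotient_of r = (p, q)" by (cases "quotient_of r")
  have q: "0 < q" using quotient_of_denom_pos[OF pq] .
  have x: "x = of_int p / of_int q"
    using quotient_of_div[OF pq] r by (simp add: of_rat_divide)
  have "floorlog 2 (nat \<bar>p\<bar>) \<le> s" "floorlog 2 (nat q) \<le> s"
    using assms(2) by (simp_all add: r bit_size_of_rat pq)
  then have le: "nat \<bar>p\<bar> < 2 ^ s" "nat q < 2 ^ s" using floorlog_leD by (metis one_less_numeral_iff semiring_norm(76))+
  have "\<bar>x\<bar> \<le> real_of_int \<bar>p\<bar>" using q mult_right_mono[of 1 "real_of_int q" "\<bar>real_of_int p\<bar>"]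
    unfolding x by (simp add: field_simps)
  also have "\<dots> = real (nat \<bar>p\<bar>)" by simp
  also have "\<dots> \<le> real (2 ^ s)" using le(1) by (simp only: of_nat_le_iff)
  finally have "\<bar>x\<bar> \<le> 2 ^ s" by simp
  moreover have "of_nat (nat q) * x = of_int p" using q unfolding x by simp
  ultimately show ?thesis
    unfolding rat_bounded_def using q le(2) by (intro conjI exI[of _ "nat q"]) auto
qed

lemma bit_size_pos: "1 \<le> bit_size x"
  by (simp add: bit_size_def split: prod.splits)

lemma poly_nat_mono:
  fixes p :: "nat poly"
  assumes "x \<le> y"
  shows "poly p x \<le> poly p y"
  using assms by (induction p) (auto intro!: add_mono mult_mono)

section \<open>Reasoning about programs\<close>

lemma exec_prog_bind:
  "exec (prog_bind p g) m =
     (let (x, m', t) = exec p m; (y, m'', t') = exec (g x) m' in (y, m'', t + t'))"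
  by (induction p arbitrary: m) (simp_all add: Let_def split: prod.splits)

lemma exec_prefix: "exec p m = (x, m', t) \<Longrightarrow> prefix m m'"
proof (induction p arbitrary: m x m' t)
  case (Const q k)
  then show ?case by (fastforce simp: Let_def split: prod.splits dest: append_prefixD)
next
  case (Arith f i j k)
  then show ?case by (fastforce simp: Let_def split: prod.splits dest: append_prefixD)
next
  case (Less i j k)
  then show ?case by (fastforce simp: Let_def split: prod.splits)
qed simp

lemma prefix_nth: "prefix m m' \<Longrightarrow> i < length m \<Longrightarrow> m' ! i = m ! i"
  by (auto simp: prefix_def nth_append)

lemma prefix_less: "prefix m m' \<Longrightarrow> i < length m \<Longrightarrow> i < length m'"
  using prefix_length_le less_le_trans by blast

text \<open>A Hoare triple for append-only memory with a time bound. \<open>V\<close> is demanded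
  only of the newly written registers, so triples compose without any condition on what the memory
  held before.\<close>

definition runs ::
    "(real \<Rightarrow> bool) \<Rightarrow> nat \<Rightarrow> 'x prog \<Rightarrow> real list \<Rightarrow> ('x \<Rightarrow> real list \<Rightarrow> bool) \<Rightarrow> bool" where
  "runs V T p m R \<longleftrightarrow> (\<forall>x m' t. exec p m = (x, m', t) \<longrightarrow>
     t \<le> T \<and> prefix m m' \<and> (\<forall>y\<in>set (drop (length m) m'). V y) \<and> R x m')"

lemma runsD:
  assumes "runs V T p m R" "exec p m = (x, m', t)"
  shows "t \<le> T" "prefix m m'" "\<And>y. y \<in> set m' \<Longrightarrow> y \<in> set m \<or> V y" "R x m'"
proof -
  have *: "t \<le> T \<and> prefix m m' \<and> (\<forall>y\<in>set (drop (length m) m'). V y) \<and> R x m'"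
    using assms unfolding runs_def by blast
  then show "t \<le> T" "prefix m m'" "R x m'" by auto
  show "y \<in> set m \<or> V y" if "y \<in> set m'" for y
    using * that by (auto simp: prefix_def)
qed

lemma runs_weaken:
  assumes "runs V T p m R" "T \<le> T'" "\<And>x m'. prefix m m' \<Longrightarrow> R x m' \<Longrightarrow> R' x m'"
  shows "runs V T' p m R'"
  using assms unfolding runs_def by (meson order_trans)

lemma runs_Return: "R x m \<Longrightarrow> runs V T (Return x) m R"
  by (simp add: runs_def)

lemma runs_Const:
  "V (of_rat q) \<Longrightarrow> R (length m) (m @ [of_rat q]) \<Longrightarrow> runs V 1 (Const q Return) m R"
  by (simp add: runs_def)

lemma runs_Arith:
  "V (arith_fun f (m ! i) (m ! j)) \<Longrightarrow> R (length m) (m @ [arith_fun f (m ! i) (m ! j)]) \<Longrightarrow>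
    runs V 1 (Arith f i j Return) m R"
  by (simp add: runs_def)

lemma runs_Less: "R (m ! i < m ! j) m \<Longrightarrow> runs V 1 (Less i j Return) m R"
  by (simp add: runs_def)

lemma runs_bind:
  assumes p: "runs V T p m R" and g: "\<And>x m'. prefix m m' \<Longrightarrow> R x m' \<Longrightarrow> runs V T' (g x) m' R'"
    and T: "T + T' \<le> T''"
  shows "runs V T'' (prog_bind p g) m R'"
  unfolding runs_def
proof (intro allI impI)
  fix y m'' t
  assume "exec (prog_bind p g) m = (y, m'', t)"
  then obtain x m' t1 t2 where 1: "exec p m = (x, m', t1)" and 2: "exec (g x) m' = (y, m'', t2)"
    and t: "t = t1 + t2"
    unfolding exec_prog_bind by (auto simp: Let_def split: prod.splits)
  have *: "t1 \<le> T \<and> prefix m m' \<and> (\<forall>y\<in>set (drop (length m) m'). V y) \<and> R x m'"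
    using p 1 unfolding runs_def by blast
  then have "runs V T' (g x) m' R'" using g by blast
  then have **: "t2 \<le> T' \<and> prefix m' m'' \<and> (\<forall>y\<in>set (drop (length m') m''). V y) \<and> R' y m''"
    using 2 unfolding runs_def by blast
  from * ** T show "t \<le> T'' \<and> prefix m m'' \<and> (\<forall>y\<in>set (drop (length m) m''). V y) \<and> R' y m''"
    by (auto simp: t prefix_def)
qed

text \<open>Results for early elements are used after the later elements have been processed, so
  their postconditions must survive extensions of the memory; this is the second assumption.\<close>

lemma runs_traverse:
  assumes f: "\<And>a m'. a \<in> set as \<Longrightarrow> prefix m m' \<Longrightarrow> runs V T (f a) m' (R a)"
    and R: "\<And>a x m' m''. R a x m' \<Longrightarrow> prefix m' m'' \<Longrightarrow> R a x m''"
  shows "runs V (length as * T) (traverse f as) m (\<lambda>xs m'. list_all2 (\<lambda>a x. R a x m') as xs)"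
  using f
proof (induction as arbitrary: m)
  case Nil
  then show ?case by (simp add: runs_Return)
next
  case (Cons a as)
  have *: "runs V (length as * T) (prog_bind (traverse f as) (\<lambda>xs. Return (x # xs))) m'
      (\<lambda>xs m'. list_all2 (\<lambda>a x. R a x m') (a # as) xs)"
    if "prefix m m'" "R a x m'" for x m'
  proof (rule runs_bind[where T' = 0])
    show "runs V (length as * T) (traverse f as) m' (\<lambda>xs m'. list_all2 (\<lambda>a x. R a x m') as xs)"
      using Cons.prems that(1) by (intro Cons.IH) (auto intro: prefix_order.trans)
    show "runs V 0 (Return (x # xs)) m'' (\<lambda>xs m'. list_all2 (\<lambda>a x. R a x m') (a # as) xs)"
      if "prefix m' m''" "list_all2 (\<lambda>a x. R a x m'') as xs" for xs m''
      using that R[OF \<open>R a x m'\<close>] by (intro runs_Return) simp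
  qed simp
  have "runs V T (f a) m (R a)" using Cons.prems[of a m] by simp
  then show ?case by (simp, rule runs_bind[OF _ *]) simp_all
qed

lemma runs_fold_prog:
  assumes "\<And>k s m'. k < length as \<Longrightarrow> prefix m m' \<Longrightarrow> I k s m' \<Longrightarrow> runs V T (f s (as ! k)) m' (I (Suc k))"
    and "I 0 s m"
  shows "runs V (length as * T) (fold_prog f s as) m (I (length as))"
  using assms
proof (induction as arbitrary: m s I)
  case Nil
  then show ?case by (simp add: runs_Return)
next
  case (Cons a as)
  have *: "runs V (length as * T) (fold_prog f s' as) m' (I (length (a # as)))"
    if "prefix m m'" "I (Suc 0) s' m'" for s' m'
  proof -
    have "runs V T (f s'' (as ! k)) m'' (I (Suc (Suc k)))"
      if "k < length as" "prefix m' m''" "I (Suc k) s'' m''" for k s'' m''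
      using Cons.prems(1)[of "Suc k" m'' s''] that \<open>prefix m m'\<close> by (auto intro: prefix_order.trans)
    from Cons.IH[of m' "\<lambda>k. I (Suc k)", OF this] that show ?thesis by simp
  qed
  have "runs V T (f s a) m (I (Suc 0))"
    using Cons.prems(1)[of 0 m s] Cons.prems(2) by simp
  then show ?case by (simp, rule runs_bind[OF _ *[simplified]]) simp_all
qed

section \<open>Memory layout\<close>

lemma concat_map_nth:
  assumes "\<And>x. x \<in> set xs \<Longrightarrow> length (f x) = N" "k < length xs" "j < N"
  shows "N * k + j < length (concat (map f xs)) \<and> concat (map f xs) ! (N * k + j) = f (xs ! k) ! j"
  using assms
proof (induction xs arbitrary: k)
  case (Cons x xs)
  show ?case
  proof (cases k)
    case 0
    then show ?thesis using Cons.prems by (simp add: nth_append)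
  next
    case (Suc k')
    have "N * k' + j < length (concat (map f xs)) \<and> concat (map f xs) ! (N * k' + j) = f (xs ! k') ! j"
      using Cons.prems Suc by (intro Cons.IH) auto
    then show ?thesis using Cons.prems(1)[of x] Suc by (simp add: nth_append add.assoc)
  qed
qed simp

lemma length_concat_map:
  "(\<And>x. x \<in> set xs \<Longrightarrow> length (f x) = N) \<Longrightarrow> length (concat (map f xs)) = N * length xs"
  by (induction xs) auto

section \<open>Addresses, cardinalities and size of the input\<close>

context weighted_game
begin

abbreviation "num_triples \<equiv> length (triples G)"

lemma set_triples:
  "set (triples G) = {(i, a, b). i < n \<and> a \<in> min_actions G i \<and> b \<in> max_actions G i}"
  using finite_actions by (auto simp: triples_def image_iff)

lemma card_image_triples: "card (f ` set (triples G)) \<le> num_triples"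
  using card_image_le[of "set (triples G)" f] card_length[of "triples G"] by simp

text \<open>Since no action set is empty, the index sets are projections of the set of triples, and
  the action sets of one state embed into these. Thus the lengths of all loops are bounded by the
  number of data.\<close>

lemma num_triples_ge:
  "n \<le> num_triples"
  "card (SIGMA i:{..<n}. min_actions G i) \<le> num_triples"
  "card (SIGMA i:{..<n}. max_actions G i) \<le> num_triples"
  "i < n \<Longrightarrow> card (min_actions G i) \<le> num_triples"
  "i < n \<Longrightarrow> card (max_actions G i) \<le> num_triples"
proof -
  have "fst ` set (triples G) = {..<n}"
    using finite_actions by (force simp: set_triples image_iff)
  then show "n \<le> num_triples" using card_image_triples[of fst] by simp
  have "(\<lambda>(i, a, b). (i, a)) ` set (triples G) = (SIGMA i:{..<n}. min_actions G i)"
    using finite_actions by (force simp: set_triples image_iff)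
  then show 1: "card (SIGMA i:{..<n}. min_actions G i) \<le> num_triples"
    using card_image_triples[of "\<lambda>(i, a, b). (i, a)"] by simp
  have "(\<lambda>(i, a, b). (i, b)) ` set (triples G) = (SIGMA i:{..<n}. max_actions G i)"
    using finite_actions by (force simp: set_triples image_iff)
  then show 2: "card (SIGMA i:{..<n}. max_actions G i) \<le> num_triples"
    using card_image_triples[of "\<lambda>(i, a, b). (i, b)"] by simp
  assume i: "i < n"
  have fin: "finite (SIGMA i:{..<n}. min_actions G i)" "finite (SIGMA i:{..<n}. max_actions G i)"
    using finite_actions by auto
  have "card (Pair i ` min_actions G i) \<le> card (SIGMA i:{..<n}. min_actions G i)"
    using i fin by (intro card_mono) auto
  then show "card (min_actions G i) \<le> num_triples"
    using 1 by (simp add: card_image inj_on_def)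
  have "card (Pair i ` max_actions G i) \<le> card (SIGMA i:{..<n}. max_actions G i)"
    using i fin by (intro card_mono) auto
  then show "card (max_actions G i) \<le> num_triples"
    using 2 by (simp add: card_image inj_on_def)
qed

definition loaded :: "real list \<Rightarrow> bool" where
  "loaded m \<longleftrightarrow> prefix (game_data G) m"

lemma loaded_prefix: "loaded m \<Longrightarrow> prefix m m' \<Longrightarrow> loaded m'"
  unfolding loaded_def by (rule prefix_order.trans)

lemma game_data_addr:
  assumes "i < n" "a \<in> min_actions G i" "b \<in> max_actions G i"
  shows "payment_addr G i a b < length (game_data G)"
    "game_data G ! payment_addr G i a b = payment G i a b"
    "j < n \<Longrightarrow> trans_addr G i a b j < length (game_data G)"
    "j < n \<Longrightarrow> game_data G ! trans_addr G i a b j = trans G i a b j"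
proof -
  define k where "k = (LEAST k. k < num_triples \<and> triples G ! k = (i, a, b))"
  have "\<exists>k. k < num_triples \<and> triples G ! k = (i, a, b)"
    using assms set_triples by (auto simp: in_set_conv_nth[symmetric])
  from LeastI_ex[OF this] have k: "k < num_triples" "triples G ! k = (i, a, b)"
    unfolding k_def by auto
  let ?f = "\<lambda>(i, a, b). payment G i a b # map (trans G i a b) [0..<n]"
  have len: "length (?f x) = Suc n" for x by (auto split: prod.splits)
  have addr: "payment_addr G i a b = Suc n * k" by (simp add: payment_addr_def k_def)
  note * = concat_map_nth[of "triples G" ?f "Suc n" k, OF len k(1), unfolded k(2), simplified prod.case]
  show "payment_addr G i a b < length (game_data G)"
    "game_data G ! payment_addr G i a b = payment G i a b"
    unfolding addr game_data_def using *[of 0] by (simp_all only: add_0_right nth_Cons_0 zero_less_Suc)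
  show "trans_addr G i a b j < length (game_data G)"
    "game_data G ! trans_addr G i a b j = trans G i a b j" if "j < n"
    unfolding trans_addr_def addr game_data_def using *[of "Suc j"] that
    by (simp_all only: add_0_right nth_Cons_Suc Suc_less_eq nth_map_upt diff_zero add_0)
qed

lemma loaded_addr:
  assumes "loaded m" "i < n" "a \<in> min_actions G i" "b \<in> max_actions G i"
  shows "payment_addr G i a b < length m" "m ! payment_addr G i a b = payment G i a b"
    "j < n \<Longrightarrow> trans_addr G i a b j < length m"
    "j < n \<Longrightarrow> m ! trans_addr G i a b j = trans G i a b j"
  using game_data_addr[OF assms(2-4)] prefix_nth[of "game_data G" m] prefix_less[of "game_data G" m]
    assms(1) unfolding loaded_def by auto

abbreviation "rational \<equiv> set (game_data G) \<subseteq> \<rat>"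
abbreviation "input_size \<equiv> sum_list (map bit_size (game_data G))"

lemma bit_size_game_data: "x \<in> set (game_data G) \<Longrightarrow> bit_size x \<le> input_size"
  by (intro member_le_sum_list) auto

text \<open>Every number costs at least its sign bit, and some triple exists and contributes a block
  of \<open>Suc n\<close> numbers. This converts dimensions into input size, the only argument
  allowed in the bit bounds.\<close>

lemma input_size_ge: "Suc n \<le> input_size"
proof -
  have "length (game_data G) = Suc n * num_triples"
    unfolding game_data_def by (rule length_concat_map) (auto split: prod.splits)
  moreover have "1 \<le> num_triples" using num_triples_ge(1) c by simp
  ultimately have "Suc n \<le> length (game_data G)" by (cases num_triples) auto
  also have "length xs \<le> sum_list (map bit_size xs)" for xs
  proof (induction xs)
    case (Cons x xs)
    then show ?case using bit_size_pos[of x] by simp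
  qed simp
  finally show ?thesis .
qed

lemma rat_bounded_data:
  assumes "rational" "i < n" "a \<in> min_actions G i" "b \<in> max_actions G i"
  shows "rat_bounded input_size input_size (payment G i a b)"
    "j < n \<Longrightarrow> rat_bounded input_size input_size (trans G i a b j)"
proof -
  have *: "rat_bounded input_size input_size x" if "x \<in> set (game_data G)" for x
    using that assms(1) bit_size_game_data by (intro bit_size_imp_rat_bounded) auto
  show "rat_bounded input_size input_size (payment G i a b)"
    using game_data_addr(1,2)[OF assms(2-4)] by (metis * nth_mem)
  show "rat_bounded input_size input_size (trans G i a b j)" if "j < n"
    using game_data_addr(3,4)[OF assms(2-4) that] by (metis * nth_mem)
qed

end

section \<open>Specification of the programs\<close>

text \<open>The order \<open>lt\<close> is abstract so that maximization and minimization share one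
  proof. Negative transitivity, the third law, carries the comparison from a discarded candidate to
  its replacement. Comparisons write nothing, hence a single memory throughout.\<close>

lemma runs_best:
  fixes lt :: "real \<Rightarrow> real \<Rightarrow> bool"
  assumes better: "\<And>x y m V. runs V 1 (better x y) m (\<lambda>u m'. u = lt (m ! x) (m ! y) \<and> m' = m)"
    and lt: "\<And>p. \<not> lt p p" "\<And>p q. lt p q \<Longrightarrow> \<not> lt q p"
      "\<And>p q r. \<not> lt p q \<Longrightarrow> \<not> lt q r \<Longrightarrow> \<not> lt p r"
  shows "runs V (length ys)
    (fold_prog (\<lambda>x y. do { u \<leftarrow> better y x; Return (if u then y else x) }) x ys) m
    (\<lambda>z m'. z \<in> insert x (set ys) \<and> (\<forall>y\<in>insert x (set ys). \<not> lt (m ! y) (m ! z)) \<and> m' = m)"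
proof (induction ys arbitrary: x)
  case Nil
  show ?case using lt(1) by (simp add: runs_Return)
next
  case (Cons y ys)
  let ?f = "\<lambda>x y. do { u \<leftarrow> better y x; Return (if u then y else x) }"
  let ?x = "if lt (m ! y) (m ! x) then y else x"
  have "runs V 1 (?f x y) m (\<lambda>z m'. z = ?x \<and> m' = m)"
    by (rule runs_bind[OF better, where T' = 0]) (auto intro: runs_Return)
  then have "runs V (1 + length ys) (prog_bind (?f x y) (\<lambda>s'. fold_prog ?f s' ys)) m
    (\<lambda>z m'. z \<in> insert ?x (set ys) \<and> (\<forall>y\<in>insert ?x (set ys). \<not> lt (m ! y) (m ! z)) \<and> m' = m)"
    by (rule runs_bind[where T' = "length ys"]) (use Cons.IH[of ?x] in auto)
  then show ?case
    unfolding fold_prog.simps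
  proof (rule runs_weaken)
    fix z m'
    assume "z \<in> insert ?x (set ys) \<and> (\<forall>y\<in>insert ?x (set ys). \<not> lt (m ! y) (m ! z)) \<and> m' = m"
    then show "z \<in> insert x (set (y # ys)) \<and>
        (\<forall>y\<in>insert x (set (y # ys)). \<not> lt (m ! y) (m ! z)) \<and> m' = m"
      using lt(2)[of "m ! y" "m ! x"] lt(3)[of "m ! x" "m ! y" "m ! z"] lt(3)[of "m ! y" "m ! x" "m ! z"]
      by (cases "lt (m ! y) (m ! x)") auto
  qed simp
qed

lemma runs_optimize:
  fixes lt :: "real \<Rightarrow> real \<Rightarrow> bool"
  assumes better: "\<And>x y m V. runs V 1 (better x y) m (\<lambda>u m'. u = lt (m ! x) (m ! y) \<and> m' = m)"
    and lt: "\<And>p. \<not> lt p p" "\<And>p q. lt p q \<Longrightarrow> \<not> lt q p"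
      "\<And>p q r. \<not> lt p q \<Longrightarrow> \<not> lt q r \<Longrightarrow> \<not> lt p r"
    and "xs \<noteq> []" and addr: "\<And>a x. (a, x) \<in> set xs \<Longrightarrow> x < length m"
  shows "runs V (2 * length xs) (optimize better xs) m
    (\<lambda>(z, D) m'. z \<in> snd ` set xs \<and> (\<forall>y\<in>snd ` set xs. \<not> lt (m ! y) (m ! z)) \<and>
       D = {a. \<exists>x. (a, x) \<in> set xs \<and> \<not> lt (m ! z) (m ! x)})"
proof -
  have snd_xs: "insert (snd (hd xs)) (set (map snd (tl xs))) = snd ` set xs"
    using \<open>xs \<noteq> []\<close> by (cases xs) auto
  have opt: "runs V (length xs * 1)
      (traverse (\<lambda>(a, x). do { u \<leftarrow> better z x; Return (if u then {} else {a}) }) xs) m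
      (\<lambda>Os m'. list_all2 (\<lambda>z' X. X = (if lt (m ! z) (m ! snd z') then {} else {fst z'})) xs Os)"
    if z: "z \<in> snd ` set xs" for z
  proof (rule runs_traverse)
    fix z' m' assume z': "z' \<in> set xs" "prefix m m'"
    obtain a x where ax: "z' = (a, x)" by (cases z')
    have "m' ! z = m ! z" "m' ! x = m ! x"
      using z z' ax addr by (auto intro!: prefix_nth)
    then show "runs V 1 (case z' of (a, x) \<Rightarrow> do { u \<leftarrow> better z x; Return (if u then {} else {a}) }) m'
        (\<lambda>X m'. X = (if lt (m ! z) (m ! snd z') then {} else {fst z'}))"
      unfolding ax prod.case fst_conv snd_conv
      by (intro runs_bind[OF better, where T' = 0]) (auto intro: runs_Return)
  qed
  have Union: "\<Union> (set Os) = {a. \<exists>x. (a, x) \<in> set xs \<and> \<not> lt (m ! z) (m ! x)}"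
    if "list_all2 (\<lambda>z' X. X = (if lt (m ! z) (m ! snd z') then {} else {fst z'})) xs Os" for Os z
    using that by (induction rule: list_all2_induct) (auto split: if_splits)
  show ?thesis
    unfolding optimize_def
  proof (rule runs_bind[OF runs_best[of better lt, OF better lt], where T' = "length xs * 1"],
      unfold snd_xs)
    fix z m' assume *: "z \<in> snd ` set xs \<and> (\<forall>y\<in>snd ` set xs. \<not> lt (m ! y) (m ! z)) \<and> m' = m"
    show "runs V (length xs * 1) (prog_bind
        (traverse (\<lambda>(a, x). do { u \<leftarrow> better z x; Return (if u then {} else {a}) }) xs)
        (\<lambda>opt. Return (z, \<Union> (set opt)))) m'
        (\<lambda>(z, D) m'. z \<in> snd ` set xs \<and> (\<forall>y\<in>snd ` set xs. \<not> lt (m ! y) (m ! z)) \<and>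
          D = {a. \<exists>x. (a, x) \<in> set xs \<and> \<not> lt (m ! z) (m ! x)})"
      unfolding conjunct2[OF conjunct2[OF *]]
      by (rule runs_bind[OF opt, where T' = 0]) (use * Union in \<open>auto intro!: runs_Return\<close>)
  qed (use \<open>xs \<noteq> []\<close> in auto)
qed

lemma runs_larger: "runs V 1 (larger x y) m (\<lambda>u m'. u = (m ! x > m ! y) \<and> m' = m)"
  unfolding larger_def by (rule runs_Less) simp

lemma runs_smaller: "runs V 1 (smaller x y) m (\<lambda>u m'. u = (m ! x < m ! y) \<and> m' = m)"
  unfolding smaller_def by (rule runs_Less) simp

section \<open>Linear systems and the size of their solutions\<close>

definition solver_within :: "linear_solver \<Rightarrow> nat poly \<Rightarrow> nat poly \<Rightarrow> bool" where
  "solver_within S p b \<longleftrightarrow>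
     (\<forall>N A r m x m' t.
        1 \<le> N \<and> (\<forall>i<N. r i < length m \<and> (\<forall>j<N. A i j < length m)) \<and>
        nonsingular N (\<lambda>i j. m ! A i j) \<and> exec (S N A r) m = (x, m', t) \<longrightarrow>
          (\<forall>i<N. x i < length m') \<and>
          (\<forall>i<N. (\<Sum>j<N. m ! A i j * m' ! x j) = m ! r i) \<and>
          t \<le> poly p N \<and>
          ((\<forall>i<N. m ! r i \<in> \<rat> \<and> (\<forall>j<N. m ! A i j \<in> \<rat>)) \<longrightarrow>
             (\<forall>z\<in>set (drop (length m) m'). z \<in> \<rat> \<and>
                bit_size z \<le>
                  poly b (\<Sum>i<N. bit_size (m ! r i) + (\<Sum>j<N. bit_size (m ! A i j))))))"

lemma strongly_polynomial_solver_iff: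
  "strongly_polynomial_solver S \<longleftrightarrow> (\<exists>p b. solver_within S p b)"
  by (simp only: strongly_polynomial_solver_def solver_within_def)

lemma solver_withinD:
  assumes "solver_within S p b" "1 \<le> N" "\<forall>i<N. r i < length m \<and> (\<forall>j<N. A i j < length m)"
    "nonsingular N (\<lambda>i j. m ! A i j)" "exec (S N A r) m = (x, m', t)"
  shows "\<forall>i<N. x i < length m'" "\<forall>i<N. (\<Sum>j<N. m ! A i j * m' ! x j) = m ! r i" "t \<le> poly p N"
    "(\<forall>i<N. m ! r i \<in> \<rat> \<and> (\<forall>j<N. m ! A i j \<in> \<rat>)) \<Longrightarrow>
       (\<forall>z\<in>set (drop (length m) m'). z \<in> \<rat> \<and>
          bit_size z \<le> poly b (\<Sum>i<N. bit_size (m ! r i) + (\<Sum>j<N. bit_size (m ! A i j))))"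
proof -
  have *: "(\<forall>i<N. x i < length m') \<and> (\<forall>i<N. (\<Sum>j<N. m ! A i j * m' ! x j) = m ! r i) \<and>
      t \<le> poly p N \<and> ((\<forall>i<N. m ! r i \<in> \<rat> \<and> (\<forall>j<N. m ! A i j \<in> \<rat>)) \<longrightarrow>
        (\<forall>z\<in>set (drop (length m) m'). z \<in> \<rat> \<and>
          bit_size z \<le> poly b (\<Sum>i<N. bit_size (m ! r i) + (\<Sum>j<N. bit_size (m ! A i j)))))"
    using assms unfolding solver_within_def by blast
  show "\<forall>i<N. x i < length m'" using * by (rule conjunct1)
  show "\<forall>i<N. (\<Sum>j<N. m ! A i j * m' ! x j) = m ! r i"
    using *[THEN conjunct2] by (rule conjunct1)
  show "t \<le> poly p N" using *[THEN conjunct2, THEN conjunct2] by (rule conjunct1)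
  assume rat: "\<forall>i<N. m ! r i \<in> \<rat> \<and> (\<forall>j<N. m ! A i j \<in> \<rat>)"
  show "\<forall>z\<in>set (drop (length m) m'). z \<in> \<rat> \<and>
      bit_size z \<le> poly b (\<Sum>i<N. bit_size (m ! r i) + (\<Sum>j<N. bit_size (m ! A i j)))"
    by (rule *[THEN conjunct2, THEN conjunct2, THEN conjunct2, THEN mp, OF rat])
qed

lemma nonsingular_cong:
  assumes "\<And>i j. i < N \<Longrightarrow> j < N \<Longrightarrow> A i j = B i j"
  shows "nonsingular N A \<longleftrightarrow> nonsingular N B"
  using assms unfolding nonsingular_def by simp

lemma nonsingular_unique:
  assumes "nonsingular N A" "\<And>i. i < N \<Longrightarrow> (\<Sum>j<N. A i j * x j) = (\<Sum>j<N. A i j * y j)" "j < N"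
  shows "x j = y j"
  using assms(1)[unfolded nonsingular_def, rule_format, of "\<lambda>j. x j - y j" j] assms(2,3)
  by (simp add: right_diff_distrib sum_subtractf)

text \<open>
  A solver may return addresses of numbers that were in memory before, whose size is not controlled
  by its specification. The solution being unique, its size can be read off a run on a memory
  that contains only the system itself.
\<close>

lemma solution_size:
  assumes S: "solver_within S p b" and N: "1 \<le> N" and A: "nonsingular N A"
    and sol: "\<And>i. i < N \<Longrightarrow> (\<Sum>j<N. A i j * y j) = r i"
    and rat: "\<And>i. i < N \<Longrightarrow> r i \<in> \<rat>" "\<And>i j. i < N \<Longrightarrow> j < N \<Longrightarrow> A i j \<in> \<rat>"
    and s: "(\<Sum>i<N. bit_size (r i) + (\<Sum>j<N. bit_size (A i j))) \<le> s" and k: "k < N"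
  shows "y k \<in> \<rat>" "bit_size (y k) \<le> poly b s + s"
proof -
  \<comment> \<open>The system is laid out row by row with \<open>Suc N\<close> columns, the
    right-hand side being the last one.\<close>
  define f where "f k = (if k mod Suc N < N then A (k div Suc N) (k mod Suc N) else r (k div Suc N))" for k
  define m where "m = map f [0..<N * Suc N]"
  have lt: "Suc N * i + j < N * Suc N" if "i < N" "j < Suc N" for i j
  proof -
    have "Suc N * i + j < Suc N * i + Suc N" using that by simp
    also have "\<dots> = Suc N * Suc i" by simp
    also have "\<dots> \<le> Suc N * N" using that by (intro mult_le_mono2) simp
    finally show ?thesis by (simp add: mult.commute)
  qed
  define a where "a i j = Suc N * i + j" for i j
  have a_less: "a i j < length m" if "i < N" "j < Suc N" for i j
    using lt[OF that] by (simp add: m_def a_def)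
  have nth: "m ! a i j = (if j < N then A i j else r i)" if "i < N" "j < Suc N" for i j
  proof -
    have "m ! a i j = f (a i j)" using lt[OF that] by (simp add: m_def a_def)
    moreover have "a i j mod Suc N = j" "a i j div Suc N = i"
      unfolding a_def using that by (simp_all only: mod_mult_self4 mod_less div_mult_self4) auto
    ultimately show ?thesis by (simp add: f_def)
  qed
  obtain x m' t where ex: "exec (S N a (\<lambda>i. a i N)) m = (x, m', t)"
    by (metis prod_cases3)
  have mA: "m ! a i j = A i j" if "i < N" "j < N" for i j using nth[of i j] that by simp
  have mr: "m ! a i N = r i" if "i < N" for i using nth[of i N] that by simp
  have addr: "\<forall>i<N. a i N < length m \<and> (\<forall>j<N. a i j < length m)" using a_less by auto
  have ns: "nonsingular N (\<lambda>i j. m ! a i j)"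
    using A nonsingular_cong[of N "\<lambda>i j. m ! a i j" A] mA by simp
  note run = solver_withinD[where A = a and r = "\<lambda>i. a i N" and m = m, OF S N addr ns ex]
  have sum_eq: "(\<Sum>i<N. bit_size (m ! a i N) + (\<Sum>j<N. bit_size (m ! a i j))) =
      (\<Sum>i<N. bit_size (r i) + (\<Sum>j<N. bit_size (A i j)))"
    by (simp add: mA mr)
  have new: "z \<in> \<rat> \<and> bit_size z \<le> poly b s + s" if "z \<in> set (drop (length m) m')" for z
  proof -
    have "\<forall>i<N. m ! a i N \<in> \<rat> \<and> (\<forall>j<N. m ! a i j \<in> \<rat>)" using rat mA mr by simp
    then have "z \<in> \<rat> \<and> bit_size z \<le> poly b (\<Sum>i<N. bit_size (r i) + (\<Sum>j<N. bit_size (A i j)))"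
      using run(4) that unfolding sum_eq by blast
    then show ?thesis using poly_nat_mono[OF s, of b] by linarith
  qed
  have old: "z \<in> \<rat> \<and> bit_size z \<le> poly b s + s" if "z \<in> set m" for z
  proof -
    obtain k where k: "k < N * Suc N" "z = f k" using \<open>z \<in> set m\<close> by (auto simp: m_def)
    define i j where "i = k div Suc N" and "j = k mod Suc N"
    have ij: "i < N" "j < Suc N" using k(1) by (simp_all add: i_def j_def less_mult_imp_div_less)
    have "bit_size (r i) + (\<Sum>j<N. bit_size (A i j)) \<le> s"
      using member_le_sum[of i "{..<N}" "\<lambda>i. bit_size (r i) + (\<Sum>j<N. bit_size (A i j))"] ij s by simp
    moreover have "bit_size (A i j) \<le> (\<Sum>j<N. bit_size (A i j))" if "j < N"
      using that by (intro member_le_sum) auto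
    moreover have "z = (if j < N then A i j else r i)" using k by (simp add: f_def i_def j_def)
    ultimately show ?thesis using rat ij by (auto split: if_splits)
  qed
  have "set m' = set m \<union> set (drop (length m) m')"
    using exec_prefix[OF ex] by (auto simp: prefix_def)
  \<comment> \<open>A solution register is either new, hence bounded by the solver, or holds a
    coefficient of the system, hence bounded by \<open>s\<close>; the sum covers both cases.\<close>
  then have *: "m' ! x k \<in> \<rat> \<and> bit_size (m' ! x k) \<le> poly b s + s"
    using run(1) k new old by (metis Un_iff nth_mem)
  have "m' ! x k = y k"
    by (rule nonsingular_unique[OF A _ k]) (use run(2) mA mr sol in auto)
  then show "y k \<in> \<rat>" "bit_size (y k) \<le> poly b s + s" using * by auto
qed

section \<open>Size bounds and policy evaluation\<close>

locale hk_game = weighted_game +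
  fixes S :: linear_solver and ps bs :: "nat poly"
  assumes solver: "solver_within S ps bs"
begin

text \<open>The dimension \<open>Suc n\<close> is at most \<open>input_size\<close>, and the middle
  factor counts the columns together with the right-hand side. Entries have exponents
  \<open>Suc input_size\<close> and \<open>input_size\<close>, hence at most
  \<open>Suc input_size + 2 * input_size + 3\<close> bits.\<close>

definition system_size :: nat where
  "system_size = input_size * (input_size + 1) * (3 * input_size + 4)"

definition value_size :: nat where
  "value_size = poly bs system_size + system_size"

text \<open>Chosen above all exponents that occur: \<open>value_size\<close> for the solver,
  \<open>Suc input_size\<close> for the matrix, and
  \<open>(input_size + value_size) * input_size\<close> for the denominators of partial sums in a
  one-step value.\<close>

definition number_size :: nat where
  "number_size = 2 * input_size + value_size + (input_size + value_size) * input_size + 1"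

text \<open>Vacuous for irrational input, so that one specification serves correctness and time on
  real data as well as bit sizes on rational data.\<close>

definition small :: "real \<Rightarrow> bool" where
  "small x \<longleftrightarrow> (rational \<longrightarrow> rat_bounded number_size number_size x)"

lemma smallI:
  "(rational \<Longrightarrow> rat_bounded P Q x) \<Longrightarrow> P \<le> number_size \<Longrightarrow> Q \<le> number_size \<Longrightarrow> small x"
  unfolding small_def using rat_bounded_mono by blast

lemma system_bits:
  assumes N: "N \<le> input_size"
    and "\<And>i. i < N \<Longrightarrow> rat_bounded (Suc input_size) input_size (r i)"
    and "\<And>i j. i < N \<Longrightarrow> j < N \<Longrightarrow> rat_bounded (Suc input_size) input_size (A i j)"
  shows "(\<Sum>i<N. bit_size (r i) + (\<Sum>j<N. bit_size (A i j))) \<le> system_size"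
proof -
  let ?b = "3 * input_size + 4"
  have r: "bit_size (r i) \<le> ?b" if "i < N" for i
    using rat_bounded_imp_bit_size(2)[OF assms(2)[OF that]] by simp
  have A: "bit_size (A i j) \<le> ?b" if "i < N" "j < N" for i j
    using rat_bounded_imp_bit_size(2)[OF assms(3)[OF that]] by simp
  have "(\<Sum>i<N. bit_size (r i) + (\<Sum>j<N. bit_size (A i j))) \<le> (\<Sum>i<N. ?b + (\<Sum>j<N. ?b))"
    using r A by (intro sum_mono add_mono) auto
  also have "\<dots> = N * (N + 1) * ?b" by (simp add: algebra_simps)
  also have "\<dots> \<le> system_size"
    unfolding system_size_def using N by (intro mult_le_mono) auto
  finally show ?thesis .
qed

definition stores :: "(nat \<Rightarrow> nat) \<Rightarrow> (nat \<Rightarrow> real) \<Rightarrow> real list \<Rightarrow> bool" where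
  "stores v y m \<longleftrightarrow> (\<forall>j<n. v j < length m \<and> m ! v j = y j)"

lemma stores_prefix: "stores v y m \<Longrightarrow> prefix m m' \<Longrightarrow> stores v y m'"
  by (auto simp: stores_def prefix_nth prefix_less)

text \<open>Sharper than \<open>small\<close>: a bias is multiplied by transition probabilities and
  summed up once more, and the outcome must still be \<open>small\<close>.\<close>

definition moderate :: "(nat \<Rightarrow> real) \<Rightarrow> bool" where
  "moderate y \<longleftrightarrow> (rational \<longrightarrow> (\<forall>j<n. rat_bounded value_size value_size (y j)))"

definition evaluates :: "(nat \<Rightarrow> nat) \<Rightarrow> (nat \<times> nat \<Rightarrow> nat) \<Rightarrow> real \<Rightarrow> (nat \<Rightarrow> real) \<Rightarrow> bool" where
  "evaluates \<sigma> \<delta> \<eta> y \<longleftrightarrow> (\<forall>i<n. \<eta> + y i = local_value G y i (\<sigma> i) (\<delta> (i, \<sigma> i))) \<and> y c = 0 \<and> moderate y"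

text \<open>The entries of the system come from the input, so the size bounds do not depend on the
  number of preceding iterations. The time consists of two constants, \<open>n * n\<close>
  subtractions and one call of the solver.\<close>

lemma runs_evaluate:
  assumes \<sigma>: "\<sigma> \<in> min_policies G" and \<delta>: "\<delta> \<in> max_policies G" and m: "loaded m"
  shows "runs small (2 + n * n + poly ps (Suc n)) (evaluate S G \<sigma> \<delta>) m
    (\<lambda>(e, v) m'. e < length m' \<and> (\<exists>y. stores v y m' \<and> evaluates \<sigma> \<delta> (m' ! e) y))"
proof -
  define M where "M i j = trans G i (\<sigma> i) (\<delta> (i, \<sigma> i)) j" for i j
  define r where "r i = payment G i (\<sigma> i) (\<delta> (i, \<sigma> i))" for i
  have act: "\<sigma> i \<in> min_actions G i" "\<delta> (i, \<sigma> i) \<in> max_actions G i" if "i < n" for i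
    using min_policiesD[OF \<sigma> that] max_policiesD[OF \<delta> that that] by auto
  \<comment> \<open>The system is first stated with real entries, which separates its algebra from
    the question which registers hold them.\<close>
  define sysA where "sysA i j = (if i < n then (if j < n then (if i = j then 1 else 0) - M i j else 1)
      else if j = c then 1 else 0)" for i j
  define sysr where "sysr i = (if i < n then r i else 0)" for i
  have row: "(\<Sum>j<Suc n. sysA i j * y j) =
      (if i < n then y i + y n - (\<Sum>j<n. M i j * y j) else y c)" if "i < Suc n" for i y
  proof (cases "i < n")
    case True
    have "(\<Sum>j<n. sysA i j * y j) = (\<Sum>j<n. (if i = j then y j else 0) - M i j * y j)"
      using True by (intro sum.cong) (auto simp: sysA_def left_diff_distrib)
    also have "\<dots> = y i - (\<Sum>j<n. M i j * y j)"
      using True by (simp add: sum_subtractf)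
    finally show ?thesis using True by (simp add: sysA_def)
  next
    case False
    have "(\<Sum>j<n. sysA i j * y j) = (\<Sum>j<n. if j = c then y j else 0)"
      using False by (intro sum.cong) (auto simp: sysA_def)
    also have "\<dots> = y c" using c by simp
    finally show ?thesis using False c by (simp add: sysA_def)
  qed
  \<comment> \<open>A kernel vector solves the evaluation equation with zero payments, its component
    \<open>n\<close> playing the role of \<open>\<eta>\<close>.\<close>
  have ns: "nonsingular (Suc n) sysA"
    unfolding nonsingular_def
  proof (intro allI impI)
    fix y j assume *: "\<forall>i<Suc n. (\<Sum>j<Suc n. sysA i j * y j) = 0" and j: "j < Suc n"
    have 1: "y i + y n = (\<Sum>j<n. trans G i (\<sigma> i) (\<delta> (i, \<sigma> i)) j * y j)" if "i < n" for i
      using *[rule_format, of i] row[of i y] that by (simp add: M_def)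
    have 2: "y c = 0" using *[rule_format, of n] row[of n y] by simp
    note 3 = evaluation_unique[of \<sigma> "\<lambda>i. \<delta> (i, \<sigma> i)" y "y n", OF act 1 2]
    show "y j = 0" using 3(1) 3(2)[of j] j by (cases "j < n") (auto simp: less_Suc_eq)
  qed
  have rbA: "rat_bounded (Suc input_size) input_size (sysA i j)" if rational "i < Suc n" for i j
  proof -
    have "rat_bounded (Suc input_size) input_size ((if i = j then 1 else 0) - M i j)"
      if "i < n" "j < n"
      using rat_bounded_diff[OF _ rat_bounded_data(2)[OF \<open>rational\<close> that(1) act[OF that(1)] that(2)],
          of 0 0 "if i = j then 1 else 0"]
      by (auto simp: M_def rat_bounded_0 rat_bounded_1)
    moreover have "rat_bounded (Suc input_size) input_size (if j = c then 1 else 0)"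
      by (simp add: rat_bounded_0 rat_bounded_1)
    ultimately show ?thesis unfolding sysA_def using rat_bounded_1 by presburger
  qed
  have rbr: "rat_bounded (Suc input_size) input_size (sysr i)" if rational for i
    using rat_bounded_mono[OF rat_bounded_data(1)[OF that _ act], of i "Suc input_size" input_size]
    by (simp add: sysr_def r_def rat_bounded_0)
  have bits: "(\<Sum>i<Suc n. bit_size (sysr i) + (\<Sum>j<Suc n. bit_size (sysA i j))) \<le> system_size"
    if rational
    using input_size_ge rbA rbr that by (intro system_bits) auto
  have sys_rat: "sysr i \<in> \<rat>" "sysA i j \<in> \<rat>" if rational "i < Suc n" for i j
    using rbA[OF that] rbr[OF that(1)] rat_bounded_imp_bit_size(1) by blast+
  have small01: "small 0" "small 1"
    by (rule smallI[of 0 0], auto simp: rat_bounded_0 rat_bounded_1)+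
  let ?prop = "\<lambda>(e, v) m'. e < length m' \<and> (\<exists>y. stores v y m' \<and> evaluates \<sigma> \<delta> (m' ! e) y)"
  let ?L = "\<lambda>zero one. traverse (\<lambda>i. traverse (\<lambda>j.
               Arith Minus (if i = j then one else zero)
                 (trans_addr G i (\<sigma> i) (\<delta> (i, \<sigma> i)) j) Return) [0..<n]) [0..<n]"
  let ?S = "\<lambda>zero one L. S (Suc n)
               (\<lambda>i j. if i < n then (if j < n then L ! i ! j else one)
                      else (if j = c then one else zero))
               (\<lambda>i. if i < n then payment_addr G i (\<sigma> i) (\<delta> (i, \<sigma> i)) else zero)"
  have L: "runs small (length [0..<n] * (length [0..<n] * 1)) (?L zero one) m' (\<lambda>L m'.
      list_all2 (\<lambda>i. list_all2 (\<lambda>j x. x < length m' \<and> m' ! x = (if i = j then 1 else 0) - M i j) [0..<n])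
        [0..<n] L)"
    if m': "loaded m'" "zero < length m'" "m' ! zero = 0" "one < length m'" "m' ! one = 1"
    for m' zero one
  proof (intro runs_traverse)
    fix i j m1 m2
    assume i: "i \<in> set [0..<n]" and j: "j \<in> set [0..<n]" and p: "prefix m' m1" "prefix m1 m2"
    have p2: "prefix m' m2" using p by (rule prefix_order.trans)
    have ij: "i < n" "j < n" using i j by auto
    have "m2 ! trans_addr G i (\<sigma> i) (\<delta> (i, \<sigma> i)) j = M i j"
      using loaded_addr(4)[OF loaded_prefix[OF m'(1) p2] ij(1) act[OF ij(1)] ij(2)] by (simp add: M_def)
    then have eq: "arith_fun Minus (m2 ! (if i = j then one else zero))
        (m2 ! trans_addr G i (\<sigma> i) (\<delta> (i, \<sigma> i)) j) = (if i = j then 1 else 0) - M i j"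
      using m' prefix_nth[OF p2] by simp
    have "(if i = j then 1 else 0) - M i j = sysA i j" using ij by (simp add: sysA_def)
    then have "small ((if i = j then 1 else 0) - M i j)"
      using rbA ij by (auto intro!: smallI[of "Suc input_size" input_size] simp: number_size_def)
    then show "runs small 1 (Arith Minus (if i = j then one else zero)
        (trans_addr G i (\<sigma> i) (\<delta> (i, \<sigma> i)) j) Return) m2
        (\<lambda>x m'. x < length m' \<and> m' ! x = (if i = j then 1 else 0) - M i j)"
      by (intro runs_Arith; unfold eq) (auto simp: nth_append)
  next
    fix i xs m1 m2
    assume *: "list_all2 (\<lambda>j x. x < length m1 \<and> m1 ! x = (if i = j then 1 else 0) - M i j) [0..<n] xs"
      and p: "prefix m1 m2"
    show "list_all2 (\<lambda>j x. x < length m2 \<and> m2 ! x = (if i = j then 1 else 0) - M i j) [0..<n] xs"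
      by (rule list_all2_mono[OF *]) (use p in \<open>auto simp: prefix_nth prefix_less\<close>)
  qed (auto simp: prefix_nth prefix_less)
  have S: "runs small (poly ps (Suc n)) (?S zero one L) m' (\<lambda>x. ?prop (x n, x))"
    if m': "loaded m'" "zero < length m'" "m' ! zero = 0" "one < length m'" "m' ! one = 1"
    and L: "list_all2 (\<lambda>i. list_all2 (\<lambda>j x. x < length m' \<and> m' ! x = (if i = j then 1 else 0) - M i j)
        [0..<n]) [0..<n] L" for m' zero one L
    unfolding runs_def
  proof (intro allI impI)
    let ?A = "\<lambda>i j. if i < n then (if j < n then L ! i ! j else one) else (if j = c then one else zero)"
    let ?r = "\<lambda>i. if i < n then payment_addr G i (\<sigma> i) (\<delta> (i, \<sigma> i)) else zero"
    define A where "A = ?A"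
    define r' where "r' = ?r"
    fix x m'' t assume "exec (?S zero one L) m' = (x, m'', t)"
    then have ex: "exec (S (Suc n) A r') m' = (x, m'', t)" by (simp only: A_def r'_def)
    have Lij: "L ! i ! j < length m' \<and> m' ! (L ! i ! j) = (if i = j then 1 else 0) - M i j"
      if "i < n" "j < n" for i j
      using list_all2_nthD2[OF list_all2_nthD[OF L, of i, simplified], of j] that
        list_all2_lengthD[OF list_all2_nthD[OF L, of i, simplified]] by auto
    have A: "A i j < length m' \<and> m' ! A i j = sysA i j" if "i < Suc n" "j < Suc n" for i j
      using m' Lij that by (auto simp: A_def sysA_def)
    have r: "r' i < length m' \<and> m' ! r' i = sysr i" for i
      using m' loaded_addr(1,2)[OF m'(1) _ act] by (auto simp: r'_def sysr_def r_def)
    have addr: "\<forall>i<Suc n. r' i < length m' \<and> (\<forall>j<Suc n. A i j < length m')"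
      using A r by blast
    have ns': "nonsingular (Suc n) (\<lambda>i j. m' ! A i j)"
      using ns nonsingular_cong[of "Suc n" "\<lambda>i j. m' ! A i j" sysA] A by blast
    have "1 \<le> Suc n" by simp
    note run = solver_withinD[where A = A and r = r' and m = m', OF solver this addr ns' ex]
    have sum_eq: "(\<Sum>i<Suc n. bit_size (m' ! r' i) + (\<Sum>j<Suc n. bit_size (m' ! A i j))) =
        (\<Sum>i<Suc n. bit_size (sysr i) + (\<Sum>j<Suc n. bit_size (sysA i j)))"
      using A r by (simp del: sum.lessThan_Suc)
    have V: "small z" if z: "z \<in> set (drop (length m') m'')" for z
    proof (rule smallI[of value_size value_size])
      assume rational
      have "\<forall>i<Suc n. m' ! r' i \<in> \<rat> \<and> (\<forall>j<Suc n. m' ! A i j \<in> \<rat>)"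
        using A r sys_rat[OF \<open>rational\<close>] by metis
      then have "z \<in> \<rat> \<and> bit_size z \<le> poly bs system_size"
        using run(4) z poly_nat_mono[OF bits[OF \<open>rational\<close>], of bs] unfolding sum_eq by fastforce
      then show "rat_bounded value_size value_size z"
        by (intro bit_size_imp_rat_bounded) (auto simp: value_size_def)
    qed (auto simp: number_size_def)
    define y where "y j = m'' ! x j" for j
    have sol: "(\<Sum>j<Suc n. sysA i j * y j) = sysr i" if "i < Suc n" for i
    proof -
      have "(\<Sum>j<Suc n. sysA i j * y j) = (\<Sum>j<Suc n. m' ! A i j * m'' ! x j)"
        using A that unfolding y_def by (intro sum.cong refl arg_cong2[where f = "(*)"]) auto
      also have "\<dots> = sysr i" using run(2) that r by metis
      finally show ?thesis .
    qed
    \<comment> \<open>\<open>V\<close> controls new registers only, whereas the solver may return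
      older addresses. The size of \<open>y\<close> therefore comes from
      \<open>solution_size\<close>, that is, from the uniqueness of the solution.\<close>
    have "moderate y"
      unfolding moderate_def
    proof (intro impI allI)
      fix j assume rational "j < n"
      then have "y j \<in> \<rat> \<and> bit_size (y j) \<le> poly bs system_size + system_size"
        using solution_size[OF solver _ ns sol sys_rat bits, of j] by auto
      then show "rat_bounded value_size value_size (y j)"
        by (intro bit_size_imp_rat_bounded) (auto simp: value_size_def)
    qed
    moreover have "y n + y i = local_value G y i (\<sigma> i) (\<delta> (i, \<sigma> i))" if "i < n" for i
      using sol[of i] row[of i y] that by (simp add: local_value_def sysr_def r_def M_def)
    moreover have "y c = 0" using sol[of n] row[of n y] by (simp add: sysr_def)
    moreover have "stores x y m''" using run(1) by (simp add: stores_def y_def)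
    ultimately have "?prop (x n, x) m''" using run(1) by (auto simp: evaluates_def y_def)
    then show "t \<le> poly ps (Suc n) \<and> prefix m' m'' \<and> (\<forall>y\<in>set (drop (length m') m''). small y) \<and>
        ?prop (x n, x) m''"
      using run(3) V exec_prefix[OF ex] by blast
  qed
  show ?thesis
    unfolding evaluate_def Let_def
  proof (rule runs_bind[where R = "\<lambda>zero m'. zero < length m' \<and> m' ! zero = 0"])
    show "runs small 1 (Const 0 Return) m (\<lambda>zero m'. zero < length m' \<and> m' ! zero = 0)"
      by (rule runs_Const) (auto simp: small01 nth_append)
  next
    fix zero m1 assume zero: "zero < length m1 \<and> m1 ! zero = 0" and p1: "prefix m m1"
    show "runs small (1 + n * n + poly ps (Suc n)) (do {
        one \<leftarrow> Const 1 Return; L \<leftarrow> ?L zero one; x \<leftarrow> ?S zero one L; Return (x n, x) }) m1 ?prop"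
    proof (rule runs_bind[where R = "\<lambda>one m'. one < length m' \<and> m' ! one = 1"])
      show "runs small 1 (Const 1 Return) m1 (\<lambda>one m'. one < length m' \<and> m' ! one = 1)"
        by (rule runs_Const) (auto simp: small01 nth_append)
    next
      fix one m2 assume one: "one < length m2 \<and> m2 ! one = 1" and p2: "prefix m1 m2"
      have ld: "loaded m2" using loaded_prefix m p1 p2 by blast
      have zero2: "zero < length m2" "m2 ! zero = 0" using zero p2 by (auto simp: prefix_nth prefix_less)
      show "runs small (n * n + poly ps (Suc n)) (do {
          L \<leftarrow> ?L zero one; x \<leftarrow> ?S zero one L; Return (x n, x) }) m2 ?prop"
      proof (rule runs_bind[OF L[OF ld zero2 conjunct1[OF one] conjunct2[OF one]]])
        fix L m3
        assume p3: "prefix m2 m3" and LL: "list_all2 (\<lambda>i. list_all2 (\<lambda>j x. x < length m3 \<and>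
            m3 ! x = (if i = j then 1 else 0) - M i j) [0..<n]) [0..<n] L"
        have pp: "zero < length m3" "m3 ! zero = 0" "one < length m3" "m3 ! one = 1" "loaded m3"
          using zero2 one p3 ld by (auto simp: prefix_nth prefix_less intro: loaded_prefix)
        show "runs small (poly ps (Suc n)) (do { x \<leftarrow> ?S zero one L; Return (x n, x) }) m3 ?prop"
          by (rule runs_bind[OF S[OF pp(5,1-4) LL], where T' = 0]) (auto intro: runs_Return)
      qed simp
    qed simp
  qed simp
qed

end

lemma list_all2_mem:
  assumes "list_all2 P xs ys"
  shows "y \<in> set ys \<Longrightarrow> \<exists>x\<in>set xs. P x y" "x \<in> set xs \<Longrightarrow> \<exists>y\<in>set ys. P x y"
  using assms by (induction rule: list_all2_induct) auto

section \<open>One-step values and policy improvement\<close>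

context hk_game
begin

lemma local_value_cong:
  "(\<And>j. j < n \<Longrightarrow> x j = y j) \<Longrightarrow> local_value G x i a b = local_value G y i a b"
  by (simp add: local_value_def)

lemma runs_local_value:
  assumes m: "loaded m" and act: "i < n" "a \<in> min_actions G i" "b \<in> max_actions G i"
    and v: "stores v y m" and y: "moderate y"
  shows "runs small (n * 2) (local_value_prog G v i a b) m
    (\<lambda>x m'. x < length m' \<and> m' ! x = local_value G y i a b)"
proof -
  let ?B = "input_size" and ?C = "value_size"
  define s where "s k = payment G i a b + (\<Sum>j<k. trans G i a b j * y j)" for k
  have prod_bounded: "rat_bounded (?B + ?C) (?B + ?C) (trans G i a b j * y j)" if rational "j < n" for j
    using rat_bounded_mult[OF rat_bounded_data(2)[OF that(1) act that(2)]] y that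
    unfolding moderate_def by blast
  \<comment> \<open>With each summand the magnitude gains one bit, while the denominators multiply
    and gain \<open>?B + ?C\<close> bits. The payment already counts as a term, hence
    \<open>Suc k\<close>.\<close>
  have s_bounded: "rat_bounded (?B + ?C + k) ((?B + ?C) * Suc k) (s k)" if rational "k \<le> n" for k
    using that(2)
  proof (induction k)
    case 0
    then show ?case
      using rat_bounded_mono[OF rat_bounded_data(1)[OF that(1) act]] by (simp add: s_def)
  next
    case (Suc k)
    then have "rat_bounded (Suc (max (?B + ?C + k) (?B + ?C))) ((?B + ?C) * Suc k + (?B + ?C))
        (s k + trans G i a b k * y k)"
      using that(1) by (intro rat_bounded_add prod_bounded) auto
    moreover have "max (?B + ?C + k) (?B + ?C) = ?B + ?C + k" by simp
    moreover have "(?B + ?C) * Suc k + (?B + ?C) = (?B + ?C) * Suc (Suc k)" by simp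
    moreover have "s k + trans G i a b k * y k = s (Suc k)" by (simp add: s_def)
    ultimately show ?case by (simp only: add_Suc_right)
  qed
  have small_s: "small (s k)" if "k \<le> n" for k
  proof (rule smallI[OF s_bounded[OF _ that]])
    have k: "Suc k \<le> ?B" using that input_size_ge by simp
    then have "(?B + ?C) * Suc k \<le> (?B + ?C) * ?B" by (rule mult_le_mono2)
    then show "(?B + ?C) * Suc k \<le> number_size" by (simp add: number_size_def)
    show "?B + ?C + k \<le> number_size" using k by (simp add: number_size_def)
  qed simp_all
  have small_prod: "small (trans G i a b j * y j)" if "j < n" for j
    by (rule smallI[OF prod_bounded[OF _ that]]) (auto simp: number_size_def)
  have "runs small (length [0..<n] * 2) (local_value_prog G v i a b) m
    ((\<lambda>k x m'. x < length m' \<and> m' ! x = s k) (length [0..<n]))"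
    unfolding local_value_prog_def
  proof (rule runs_fold_prog)
    fix k x m' assume "k < length [0..<n]" and p: "prefix m m'" and x: "x < length m' \<and> m' ! x = s k"
    then have k: "k < n" by simp
    have vk: "v k < length m'" "m' ! v k = y k"
      using stores_prefix[OF v p] k by (auto simp: stores_def)
    have tr: "m' ! trans_addr G i a b k = trans G i a b k"
      using loaded_addr(4)[OF loaded_prefix[OF m p] act k] .
    have "runs small 2 (do { z \<leftarrow> Arith Times (trans_addr G i a b k) (v k) Return;
        Arith Plus x z Return }) m' (\<lambda>x m'. x < length m' \<and> m' ! x = s (Suc k))"
    proof (rule runs_bind[where T = 1 and T' = 1])
      show "runs small 1 (Arith Times (trans_addr G i a b k) (v k) Return) m'
          (\<lambda>z m'. z < length m' \<and> m' ! z = trans G i a b k * y k)"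
        using small_prod[OF k] by (intro runs_Arith) (auto simp: tr vk nth_append)
    next
      fix z m'' assume p': "prefix m' m''" and z: "z < length m'' \<and> m'' ! z = trans G i a b k * y k"
      have "m'' ! x = s k" using x p' by (simp add: prefix_nth)
      then have eq: "arith_fun Plus (m'' ! x) (m'' ! z) = s (Suc k)" using z by (simp add: s_def)
      show "runs small 1 (Arith Plus x z Return) m'' (\<lambda>x m'. x < length m' \<and> m' ! x = s (Suc k))"
        by (rule runs_Arith; unfold eq) (use small_s[of "Suc k"] k in \<open>auto simp: nth_append\<close>)
    qed simp
    then show "runs small 2 (do { z \<leftarrow> Arith Times (trans_addr G i a b ([0..<n] ! k)) (v ([0..<n] ! k)) Return;
        Arith Plus x z Return }) m' (\<lambda>x m'. x < length m' \<and> m' ! x = s (Suc k))"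
      using k by simp
  qed (use loaded_addr(1,2)[OF m act] in \<open>simp add: s_def\<close>)
  then show ?thesis by (simp add: s_def local_value_def add.commute)
qed

text \<open>For each answer of the maximizer: two operations per state, and at most one comparison
  in each of the two passes of \<open>optimize\<close>.\<close>

definition max_time :: nat where
  "max_time = num_triples * (n * 2 + 2)"

definition min_time :: nat where
  "min_time = num_triples * (max_time + 2)"

lemma runs_maximize:
  assumes m: "loaded m" and act: "i < n" "a \<in> min_actions G i"
    and v: "stores v y m" and y: "moderate y"
  shows "runs small max_time (maximize G v i a) m
    (\<lambda>(x, D) m'. x < length m' \<and> m' ! x = max_value G y i a \<and>
       D = {b\<in>max_actions G i. local_value G y i a b = max_value G y i a})"
proof -
  let ?bs = "sorted_list_of_set (max_actions G i)"
  let ?l = "local_value G y i a"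
  have bs: "set ?bs = max_actions G i" "length ?bs = card (max_actions G i)" "?bs \<noteq> []"
    using finite_actions(2)[OF act(1)] by auto
  have max: "?l b \<le> max_value G y i a" if "b \<in> max_actions G i" for b
    using finite_actions(2)[OF act(1)] that by (auto simp: max_value_def)
  let ?R = "\<lambda>b (b', x) m'. b' = b \<and> x < length m' \<and> m' ! x = ?l b"
  have "runs small (length ?bs * (n * 2))
      (traverse (\<lambda>b. do { x \<leftarrow> local_value_prog G v i a b; Return (b, x) }) ?bs) m
      (\<lambda>xs m'. list_all2 (\<lambda>b x. ?R b x m') ?bs xs)"
  proof (rule runs_traverse)
    fix b m' assume "b \<in> set ?bs" and p: "prefix m m'"
    then have b: "b \<in> max_actions G i" using bs by simp
    show "runs small (n * 2) (do { x \<leftarrow> local_value_prog G v i a b; Return (b, x) }) m' (?R b)"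
      by (rule runs_bind[OF runs_local_value[OF loaded_prefix[OF m p] act b stores_prefix[OF v p] y],
            where T' = 0]) (auto intro: runs_Return)
  qed (auto simp: prefix_nth prefix_less)
  then show ?thesis
    unfolding maximize_def
  proof (rule runs_bind[where T' = "length ?bs * 2"])
    fix xs m' assume R: "list_all2 (\<lambda>b x. ?R b x m') ?bs xs"
    have len: "length xs = length ?bs" using list_all2_lengthD[OF R] by simp
    then have ne: "xs \<noteq> []" using bs(3) by (metis length_0_conv)
    have xs: "(b, x) \<in> set xs \<Longrightarrow> b \<in> max_actions G i \<and> x < length m' \<and> m' ! x = ?l b" for b x
      using list_all2_mem(1)[OF R, of "(b, x)"] bs(1) by auto
    have xs': "\<exists>x. (b, x) \<in> set xs" if "b \<in> max_actions G i" for b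
      using list_all2_mem(2)[OF R, of b] that bs(1) by auto
    have "runs small (2 * length xs) (optimize larger xs) m'
      (\<lambda>(z, D) m''. z \<in> snd ` set xs \<and> (\<forall>y\<in>snd ` set xs. \<not> m' ! y > m' ! z) \<and>
         D = {b. \<exists>x. (b, x) \<in> set xs \<and> \<not> m' ! z > m' ! x})"
      by (rule runs_optimize[where lt = "\<lambda>x y. x > y", OF runs_larger]) (use ne xs in auto)
    then show "runs small (length ?bs * 2) (optimize larger xs) m'
      (\<lambda>(x, D) m'. x < length m' \<and> m' ! x = max_value G y i a \<and>
       D = {b\<in>max_actions G i. ?l b = max_value G y i a})"
    proof (rule runs_weaken)
      fix zD and m'' :: "real list"
      assume p: "prefix m' m''"
        and "(case zD of (z, D) \<Rightarrow> \<lambda>_. z \<in> snd ` set xs \<and> (\<forall>y\<in>snd ` set xs. \<not> m' ! y > m' ! z) \<and>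
         D = {b. \<exists>x. (b, x) \<in> set xs \<and> \<not> m' ! z > m' ! x}) m''"
      then obtain z D b where zD: "zD = (z, D)" and b: "(b, z) \<in> set xs"
        and best: "\<And>b' x. (b', x) \<in> set xs \<Longrightarrow> m' ! x \<le> m' ! z"
        and D: "D = {b. \<exists>x. (b, x) \<in> set xs \<and> \<not> m' ! z > m' ! x}"
        by (cases zD) force
      have "max_value G y i a \<le> m' ! z"
      proof -
        have "?l b' \<le> m' ! z" if "b' \<in> max_actions G i" for b'
          using xs'[OF that] xs best by metis
        then show ?thesis
          using finite_actions(2)[OF act(1)] by (simp add: max_value_def)
      qed
      then have z: "m' ! z = max_value G y i a" using max xs[OF b] by (intro antisym) auto
      have "D = {b\<in>max_actions G i. ?l b = max_value G y i a}"
        unfolding D z using xs xs' max by (fastforce intro: antisym)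
      then show "(case zD of (x, D) \<Rightarrow> \<lambda>m'. x < length m' \<and> m' ! x = max_value G y i a \<and>
         D = {b\<in>max_actions G i. ?l b = max_value G y i a}) m''"
        using p z xs[OF b] by (simp add: zD prefix_nth prefix_less)
    qed (use len in simp)
  next
    have "length ?bs * (n * 2) + length ?bs * 2 = card (max_actions G i) * (n * 2 + 2)"
      using bs(2) by (simp add: algebra_simps)
    also have "\<dots> \<le> max_time"
      unfolding max_time_def using num_triples_ge(5)[OF act(1)] by (rule mult_le_mono1)
    finally show "length ?bs * (n * 2) + length ?bs * 2 \<le> max_time" .
  qed
qed

lemma runs_minimize:
  assumes m: "loaded m" and i: "i < n"
    and v: "stores v y m" and y: "moderate y"
  shows "runs small min_time (minimize G v i) m
    (\<lambda>(C, E) m'. C = {a\<in>min_actions G i. max_value G y i a = shapley G y i} \<and>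
       (\<forall>a\<in>min_actions G i. E a = {b\<in>max_actions G i. local_value G y i a b = max_value G y i a}))"
proof -
  let ?as = "sorted_list_of_set (min_actions G i)"
  let ?M = "max_value G y i"
  let ?D = "\<lambda>a. {b\<in>max_actions G i. local_value G y i a b = ?M a}"
  have as: "set ?as = min_actions G i" "length ?as = card (min_actions G i)" "?as \<noteq> []"
    using finite_actions(1)[OF i] by auto
  have min: "shapley G y i \<le> ?M a" if "a \<in> min_actions G i" for a
    using finite_actions(1)[OF i] that by (auto simp: shapley_def)
  let ?R = "\<lambda>a (a', x, D) m'. a' = a \<and> x < length m' \<and> m' ! x = ?M a \<and> D = ?D a"
  have "runs small (length ?as * max_time)
      (traverse (\<lambda>a. do { (x, D) \<leftarrow> maximize G v i a; Return (a, x, D) }) ?as) m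
      (\<lambda>ys m'. list_all2 (\<lambda>a x. ?R a x m') ?as ys)"
  proof (rule runs_traverse)
    fix a m' assume "a \<in> set ?as" and p: "prefix m m'"
    then have a: "a \<in> min_actions G i" using as by simp
    show "runs small max_time (do { (x, D) \<leftarrow> maximize G v i a; Return (a, x, D) }) m' (?R a)"
      by (rule runs_bind[OF runs_maximize[OF loaded_prefix[OF m p] i a stores_prefix[OF v p] y],
            where T' = 0]) (auto intro: runs_Return)
  qed (auto simp: prefix_nth prefix_less)
  then show ?thesis
    unfolding minimize_def
  proof (rule runs_bind[where T' = "length ?as * 2"])
    fix ys m' assume R: "list_all2 (\<lambda>a x. ?R a x m') ?as ys"
    let ?xs = "map (\<lambda>(a, y, D). (a, y)) ys"
    have len: "length ?xs = length ?as" using list_all2_lengthD[OF R] by simp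
    have ys: "(a, x, D) \<in> set ys \<Longrightarrow> a \<in> min_actions G i \<and> x < length m' \<and> m' ! x = ?M a \<and> D = ?D a"
      for a x D
      using list_all2_mem(1)[OF R, of "(a, x, D)"] as(1) by auto
    have ys': "\<exists>x. (a, x, ?D a) \<in> set ys" if "a \<in> min_actions G i" for a
      using list_all2_mem(2)[OF R, of a] that as(1) by auto
    have xs: "(a, x) \<in> set ?xs \<Longrightarrow> a \<in> min_actions G i \<and> x < length m' \<and> m' ! x = ?M a" for a x
      using ys by auto
    have xs': "\<exists>x. (a, x) \<in> set ?xs" if "a \<in> min_actions G i" for a
      using ys'[OF that] by force
    \<comment> \<open>All entries of \<open>ys\<close> for \<open>a\<close> carry the same answer
      set, so the union ranges over a single set.\<close>
    have E: "\<Union> {D. \<exists>x. (a, x, D) \<in> set ys} = ?D a" if "a \<in> min_actions G i" for a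
    proof -
      have "{D. \<exists>x. (a, x, D) \<in> set ys} = {?D a}" using ys ys'[OF that] by blast
      then show ?thesis by simp
    qed
    have "runs small (2 * length ?xs) (optimize smaller ?xs) m'
      (\<lambda>(z, C) m''. z \<in> snd ` set ?xs \<and> (\<forall>y\<in>snd ` set ?xs. \<not> m' ! y < m' ! z) \<and>
         C = {a. \<exists>x. (a, x) \<in> set ?xs \<and> \<not> m' ! z < m' ! x})"
    proof (rule runs_optimize[where lt = "\<lambda>x y. x < y", OF runs_smaller])
      show "?xs \<noteq> []" using len as(3) by (metis length_0_conv)
    qed (use xs in auto)
    then show "runs small (length ?as * 2) (do { (y, C) \<leftarrow> optimize smaller ?xs;
        Return (C, \<lambda>a. \<Union> {D. \<exists>y. (a, y, D) \<in> set ys}) }) m'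
      (\<lambda>(C, E) m'. C = {a\<in>min_actions G i. ?M a = shapley G y i} \<and> (\<forall>a\<in>min_actions G i. E a = ?D a))"
    proof (rule runs_bind[where T' = 0])
      fix zC and m'' :: "real list"
      assume "(case zC of (z, C) \<Rightarrow> \<lambda>_. z \<in> snd ` set ?xs \<and> (\<forall>y\<in>snd ` set ?xs. \<not> m' ! y < m' ! z) \<and>
         C = {a. \<exists>x. (a, x) \<in> set ?xs \<and> \<not> m' ! z < m' ! x}) m''"
      then obtain z C a where zC: "zC = (z, C)" and a: "(a, z) \<in> set ?xs"
        and best: "\<And>a' x. (a', x) \<in> set ?xs \<Longrightarrow> m' ! z \<le> m' ! x"
        and C: "C = {a. \<exists>x. (a, x) \<in> set ?xs \<and> \<not> m' ! z < m' ! x}"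
        by (cases zC) (fastforce simp del: set_map)
      have "m' ! z \<le> shapley G y i"
      proof -
        have "m' ! z \<le> ?M a'" if "a' \<in> min_actions G i" for a'
          using xs'[OF that] xs best by metis
        then show ?thesis
          using finite_actions(1)[OF i] by (simp add: shapley_def)
      qed
      then have z: "m' ! z = shapley G y i" using min xs[OF a] by (intro antisym) auto
      have "C = {a\<in>min_actions G i. ?M a = shapley G y i}"
        unfolding C z using xs xs' min by (fastforce intro: antisym simp del: set_map)
      then show "runs small 0 (case zC of (y, C) \<Rightarrow> Return (C, \<lambda>a. \<Union> {D. \<exists>y. (a, y, D) \<in> set ys})) m''
          (\<lambda>(C, E) m'. C = {a\<in>min_actions G i. ?M a = shapley G y i} \<and> (\<forall>a\<in>min_actions G i. E a = ?D a))"
        using E unfolding zC prod.case by (intro runs_Return) auto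
    qed (use len in simp)
  next
    have "length ?as * max_time + length ?as * 2 = card (min_actions G i) * (max_time + 2)"
      using as(2) by (simp add: algebra_simps)
    also have "\<dots> \<le> min_time"
      unfolding min_time_def using num_triples_ge(4)[OF i] by (rule mult_le_mono1)
    finally show "length ?as * max_time + length ?as * 2 \<le> min_time" .
  qed
qed

lemma list_all2_upt_nth: "list_all2 R [0..<k] xs \<Longrightarrow> i < k \<Longrightarrow> R i (xs ! i)"
  by (auto simp: list_all2_conv_all_nth)

definition step_time :: nat where
  "step_time = 2 + n * n + poly ps (Suc n) + n * max_time + n * min_time"

text \<open>The set of successors is determined exactly, not merely from above: the same description
  has to show later that this set is nonempty, so that no run stops early.\<close>

lemma runs_Evaluate:
  assumes \<sigma>: "\<sigma> \<in> min_policies G" and \<delta>: "\<delta> \<in> max_policies G" and m: "loaded m"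
  shows "runs small step_time (hk_control S G (Evaluate \<sigma> \<delta>)) m
    (\<lambda>Q m'. \<exists>e v y. e < length m' \<and> stores v y m' \<and> evaluates \<sigma> \<delta> (m' ! e) y \<and>
       Q = (if \<forall>i<n. local_value G y i (\<sigma> i) (\<delta> (i, \<sigma> i)) = max_value G y i (\<sigma> i) then {Improve \<sigma> e v}
         else {Evaluate \<sigma> \<delta>' | \<delta>'. \<delta>' \<in> max_policies G \<and>
           (\<forall>i<n. local_value G y i (\<sigma> i) (\<delta>' (i, \<sigma> i)) = max_value G y i (\<sigma> i))}))"
    (is "runs _ _ _ _ ?post")
proof -
  have act: "\<delta>' (i, \<sigma> i) \<in> max_actions G i" if "i < n" "\<delta>' \<in> max_policies G" for i \<delta>'
    using max_policiesD[OF that(2,1,1)] min_policiesD[OF \<sigma> that(1)] .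
  show ?thesis
    unfolding hk_control.simps
  proof (rule runs_bind[OF runs_evaluate[OF \<sigma> \<delta> m], where T' = "length [0..<n] * max_time"])
    fix ev m1
    assume p1: "prefix m m1" and "(case ev of (e, v) \<Rightarrow> \<lambda>m1. e < length m1 \<and>
      (\<exists>y. stores v y m1 \<and> evaluates \<sigma> \<delta> (m1 ! e) y)) m1"
    then obtain e v y where ev: "ev = (e, v)" and e: "e < length m1" and v: "stores v y m1"
      and y: "evaluates \<sigma> \<delta> (m1 ! e) y" by auto
    then have mod: "moderate y" by (simp add: evaluates_def)
    let ?D = "\<lambda>i. {b\<in>max_actions G i. local_value G y i (\<sigma> i) b = max_value G y i (\<sigma> i)}"
    have "runs small (length [0..<n] * max_time) (traverse (\<lambda>i. maximize G v i (\<sigma> i)) [0..<n]) m1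
      (\<lambda>R m'. list_all2 (\<lambda>i xD. snd xD = ?D i) [0..<n] R)"
    proof (rule runs_traverse[where R = "\<lambda>i xD m'. snd xD = ?D i"])
      fix i m2 assume "i \<in> set [0..<n]" and p2: "prefix m1 m2"
      then have i: "i < n" by simp
      show "runs small max_time (maximize G v i (\<sigma> i)) m2 (\<lambda>xD m'. snd xD = ?D i)"
        by (rule runs_weaken[OF runs_maximize[OF loaded_prefix[OF loaded_prefix[OF m p1] p2] i
              min_policiesD[OF \<sigma> i] stores_prefix[OF v p2] mod]]) auto
    qed simp
    then show "runs small (length [0..<n] * max_time) (case ev of (e, v) \<Rightarrow> do {
        R \<leftarrow> traverse (\<lambda>i. maximize G v i (\<sigma> i)) [0..<n];
        Return (if \<forall>i<n. \<delta> (i, \<sigma> i) \<in> snd (R ! i) then {Improve \<sigma> e v}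
         else {Evaluate \<sigma> \<delta>' | \<delta>'. \<delta>' \<in> max_policies G \<and> (\<forall>i<n. \<delta>' (i, \<sigma> i) \<in> snd (R ! i))}) }) m1 ?post"
      unfolding ev prod.case
    proof (rule runs_bind[where T' = 0])
      fix R m2
      assume p2: "prefix m1 m2" and "list_all2 (\<lambda>i xD. snd xD = ?D i) [0..<n] R"
      then have R: "\<delta>' (i, \<sigma> i) \<in> snd (R ! i) \<longleftrightarrow>
          local_value G y i (\<sigma> i) (\<delta>' (i, \<sigma> i)) = max_value G y i (\<sigma> i)"
        if "i < n" "\<delta>' \<in> max_policies G" for i \<delta>'
        using list_all2_upt_nth[of "\<lambda>i xD. snd xD = ?D i" n R i] act[OF that] that by auto
      have "e < length m2" "stores v y m2" "evaluates \<sigma> \<delta> (m2 ! e) y"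
        using e y p2 stores_prefix[OF v p2] by (auto simp: prefix_nth prefix_less)
      moreover have "(\<forall>i<n. \<delta> (i, \<sigma> i) \<in> snd (R ! i)) \<longleftrightarrow>
          (\<forall>i<n. local_value G y i (\<sigma> i) (\<delta> (i, \<sigma> i)) = max_value G y i (\<sigma> i))"
        using R[OF _ \<delta>] by blast
      moreover have "{Evaluate \<sigma> \<delta>' | \<delta>'. \<delta>' \<in> max_policies G \<and> (\<forall>i<n. \<delta>' (i, \<sigma> i) \<in> snd (R ! i))} =
          {Evaluate \<sigma> \<delta>' | \<delta>'. \<delta>' \<in> max_policies G \<and>
           (\<forall>i<n. local_value G y i (\<sigma> i) (\<delta>' (i, \<sigma> i)) = max_value G y i (\<sigma> i))}"
        using R by blast
      ultimately show "runs small 0 (Return (if \<forall>i<n. \<delta> (i, \<sigma> i) \<in> snd (R ! i) then {Improve \<sigma> e v}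
         else {Evaluate \<sigma> \<delta>' | \<delta>'. \<delta>' \<in> max_policies G \<and> (\<forall>i<n. \<delta>' (i, \<sigma> i) \<in> snd (R ! i))})) m2 ?post"
        by (intro runs_Return) (simp only:, blast)
    qed simp
  qed (simp add: step_time_def)
qed

lemma runs_Improve:
  assumes m: "loaded m" and v: "stores v y m" and y: "moderate y" and \<sigma>: "\<sigma> \<in> min_policies G"
  shows "runs small step_time (hk_control S G (Improve \<sigma> e v)) m
    (\<lambda>Q m'.
       Q = (if \<forall>i<n. max_value G y i (\<sigma> i) = shapley G y i
         then {Done \<sigma> \<delta> e v | \<delta>. \<delta> \<in> max_policies G \<and>
           (\<forall>i<n. \<forall>a\<in>min_actions G i. local_value G y i a (\<delta> (i, a)) = max_value G y i a)}
         else {Evaluate \<sigma>' \<delta> | \<sigma>' \<delta>. \<sigma>' \<in> min_policies G \<and>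
           (\<forall>i<n. max_value G y i (\<sigma>' i) = shapley G y i) \<and> \<delta> \<in> max_policies G}))"
    (is "runs _ _ _ _ ?post")
proof -
  let ?C = "\<lambda>i. {a\<in>min_actions G i. max_value G y i a = shapley G y i}"
  let ?D = "\<lambda>i a. {b\<in>max_actions G i. local_value G y i a b = max_value G y i a}"
  let ?P = "\<lambda>i CE. fst CE = ?C i \<and> (\<forall>a\<in>min_actions G i. snd CE a = ?D i a)"
  have "runs small (length [0..<n] * min_time) (traverse (minimize G v) [0..<n]) m
    (\<lambda>R m'. list_all2 ?P [0..<n] R)"
  proof (rule runs_traverse[where R = "\<lambda>i CE m'. ?P i CE"])
    fix i m2 assume "i \<in> set [0..<n]" and p2: "prefix m m2"
    then have i: "i < n" by simp
    show "runs small min_time (minimize G v i) m2 (\<lambda>CE m'. ?P i CE)"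
      by (rule runs_weaken[OF runs_minimize[OF loaded_prefix[OF m p2] i stores_prefix[OF v p2] y]]) auto
  qed simp
  then show ?thesis
    unfolding hk_control.simps
  proof (rule runs_bind[where T' = 0])
    fix R m2
    assume R: "list_all2 ?P [0..<n] R"
    have C: "\<sigma>' i \<in> fst (R ! i) \<longleftrightarrow> max_value G y i (\<sigma>' i) = shapley G y i"
      if "i < n" "\<sigma>' \<in> min_policies G" for i \<sigma>'
      using list_all2_upt_nth[OF R that(1)] min_policiesD[OF that(2,1)] by simp
    have D: "\<delta> (i, a) \<in> snd (R ! i) a \<longleftrightarrow> local_value G y i a (\<delta> (i, a)) = max_value G y i a"
      if "i < n" "\<delta> \<in> max_policies G" "a \<in> min_actions G i" for i \<delta> a
      using list_all2_upt_nth[OF R that(1)] max_policiesD[OF that(2,1,1,3)] that(3) by simp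
    have "(\<forall>i<n. \<sigma> i \<in> fst (R ! i)) \<longleftrightarrow> (\<forall>i<n. max_value G y i (\<sigma> i) = shapley G y i)"
      using C[OF _ \<sigma>] by blast
    moreover have "{Done \<sigma> \<delta> e v | \<delta>. \<delta> \<in> max_policies G \<and>
          (\<forall>i<n. \<forall>a\<in>min_actions G i. \<delta> (i, a) \<in> snd (R ! i) a)} =
        {Done \<sigma> \<delta> e v | \<delta>. \<delta> \<in> max_policies G \<and>
          (\<forall>i<n. \<forall>a\<in>min_actions G i. local_value G y i a (\<delta> (i, a)) = max_value G y i a)}"
      using D by blast
    moreover have "{Evaluate \<sigma>' \<delta> | \<sigma>' \<delta>. \<sigma>' \<in> min_policies G \<and> (\<forall>i<n. \<sigma>' i \<in> fst (R ! i)) \<and>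
          \<delta> \<in> max_policies G} =
        {Evaluate \<sigma>' \<delta> | \<sigma>' \<delta>. \<sigma>' \<in> min_policies G \<and>
          (\<forall>i<n. max_value G y i (\<sigma>' i) = shapley G y i) \<and> \<delta> \<in> max_policies G}"
      using C by blast
    ultimately show "runs small 0 (Return (if \<forall>i<n. \<sigma> i \<in> fst (R ! i)
        then {Done \<sigma> \<delta> e v | \<delta>. \<delta> \<in> max_policies G \<and>
                (\<forall>i<n. \<forall>a\<in>min_actions G i. \<delta> (i, a) \<in> snd (R ! i) a)}
        else {Evaluate \<sigma>' \<delta> | \<sigma>' \<delta>. \<sigma>' \<in> min_policies G \<and> (\<forall>i<n. \<sigma>' i \<in> fst (R ! i)) \<and>
                \<delta> \<in> max_policies G})) m2 ?post"
      by (intro runs_Return) (simp only:)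
  qed (simp add: step_time_def)
qed

end

section \<open>Runs of the algorithm\<close>

context hk_game
begin

text \<open>Registers represent a vector only below \<open>n\<close>, so the bias in memory and the
  one in the proof may differ elsewhere. These equalities transfer \<open>solution\<close> from one
  to the other.\<close>

lemma value_cong:
  assumes "\<And>j. j < n \<Longrightarrow> x j = y j"
  shows "max_value G x = max_value G y" "shapley G x = shapley G y" "local_value G x = local_value G y"
proof -
  show 1: "local_value G x = local_value G y"
    using local_value_cong[OF assms] by (intro ext) auto
  show 2: "max_value G x = max_value G y" by (intro ext) (simp add: max_value_def 1)
  show "shapley G x = shapley G y" by (intro ext) (simp add: shapley_def 2)
qed

text \<open>\<open>Evaluate\<close> carries no numbers, since evaluation starts from the input.
  \<open>Improve\<close> records an exact solution of the inner problem, which the outer rank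
  presupposes.\<close>

fun state_invariant :: "hk_state \<Rightarrow> real list \<Rightarrow> bool" where
  "state_invariant (Evaluate \<sigma> \<delta>) m \<longleftrightarrow> \<sigma> \<in> min_policies G \<and> \<delta> \<in> max_policies G"
| "state_invariant (Improve \<sigma> e v) m \<longleftrightarrow> \<sigma> \<in> min_policies G \<and> e < length m \<and>
     (\<exists>y. stores v y m \<and> moderate y \<and> y c = 0 \<and> (\<forall>i<n. m ! e + y i = max_value G y i (\<sigma> i)))"
| "state_invariant (Done \<sigma> \<delta> e v) m \<longleftrightarrow> solution G (m ! e) (\<lambda>i. m ! v i) \<sigma> \<delta>"

definition invariant :: "hk_state \<Rightarrow> real list \<Rightarrow> bool" where
  "invariant q m \<longleftrightarrow> loaded m \<and> (\<forall>x\<in>set m. small x) \<and> state_invariant q m"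

lemma run_step_invariant:
  assumes "runs small step_time (hk_control S G q) m R" "step (hk_control S G) (q, m, t) (q', m', t')"
    and "loaded m" "\<forall>x\<in>set m. small x"
  obtains Q where "q' \<in> Q" "R Q m'" "loaded m'" "\<forall>x\<in>set m'. small x" "prefix m m'" "t' \<le> t + step_time"
proof -
  obtain Q d where "exec (hk_control S G q) m = (Q, m', d)" "q' \<in> Q" "t' = t + d"
    using assms(2) by auto
  with runsD[OF assms(1)] assms(3,4) that show thesis
    by (metis add_left_mono loaded_prefix)
qed

text \<open>Optimal actions always exist, so in every control state but \<open>Done\<close> there is
  a successor. A run that cannot continue is therefore in \<open>Done\<close>, where the invariant
  asserts the solution.\<close>

lemma not_stuck:
  assumes "invariant q m" "\<And>s. \<not> step (hk_control S G) (q, m, t) s"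
  shows "solved G q m"
proof -
  have m: "loaded m" and q: "state_invariant q m"
    using assms(1) by (auto simp: invariant_def)
  have empty: "Q = {}" if "exec (hk_control S G q) m = (Q, m', d)" for Q m' d
    using assms(2)[of "(_, m', t + d)"] that by auto
  obtain Q m' d where ex: "exec (hk_control S G q) m = (Q, m', d)" by (metis prod_cases3)
  note Q = empty[OF ex]
  have arg_max: "\<exists>b\<in>max_actions G i. local_value G y i a b = max_value G y i a" if "i < n" for y i a
    using Max_in[of "local_value G y i a ` max_actions G i"] finite_actions(2)[OF that]
    unfolding max_value_def by (metis finite_imageI image_is_empty imageE)
  have arg_min: "\<exists>a\<in>min_actions G i. max_value G y i a = shapley G y i" if "i < n" for y i
    using Min_in[of "max_value G y i ` min_actions G i"] finite_actions(1)[OF that]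
    unfolding shapley_def by (metis finite_imageI image_is_empty imageE)
  show ?thesis
  proof (cases q)
    case (Evaluate \<sigma> \<delta>)
    then have s: "\<sigma> \<in> min_policies G" "\<delta> \<in> max_policies G" using q by auto
    from runsD(4)[OF runs_Evaluate[OF s m] ex[unfolded Evaluate]] obtain e v y where
      Q': "Q = (if \<forall>i<n. local_value G y i (\<sigma> i) (\<delta> (i, \<sigma> i)) = max_value G y i (\<sigma> i) then {Improve \<sigma> e v}
         else {Evaluate \<sigma> \<delta>' | \<delta>'. \<delta>' \<in> max_policies G \<and>
           (\<forall>i<n. local_value G y i (\<sigma> i) (\<delta>' (i, \<sigma> i)) = max_value G y i (\<sigma> i))})"
      by blast
    \<comment> \<open>The new policy must also answer actions that are offered only in other states;
      \<open>arg_max\<close> holds for every \<open>a\<close> and covers them.\<close>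
    obtain \<delta>' where "\<delta>' \<in> max_policies G" and opt: "\<And>i k a. i < n \<Longrightarrow> k < n \<Longrightarrow> a \<in> min_actions G k \<Longrightarrow>
        local_value G y i a (\<delta>' (i, a)) = max_value G y i a"
      by (rule max_policies_ex[where G = G and
            P = "\<lambda>i a b. local_value G y i a b = max_value G y i a"]) (use arg_max in auto)
    moreover have "\<forall>i<n. local_value G y i (\<sigma> i) (\<delta>' (i, \<sigma> i)) = max_value G y i (\<sigma> i)"
      using opt min_policiesD[OF s(1)] by blast
    ultimately have "Q \<noteq> {}" unfolding Q' by auto
    with Q show ?thesis by blast
  next
    case (Improve \<sigma> e v)
    then obtain y where s: "\<sigma> \<in> min_policies G" and y: "stores v y m" "moderate y" using q by auto
    from runsD(4)[OF runs_Improve[OF m y s] ex[unfolded Improve]] have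
      Q': "Q = (if \<forall>i<n. max_value G y i (\<sigma> i) = shapley G y i
         then {Done \<sigma> \<delta> e v | \<delta>. \<delta> \<in> max_policies G \<and>
           (\<forall>i<n. \<forall>a\<in>min_actions G i. local_value G y i a (\<delta> (i, a)) = max_value G y i a)}
         else {Evaluate \<sigma>' \<delta> | \<sigma>' \<delta>. \<sigma>' \<in> min_policies G \<and>
           (\<forall>i<n. max_value G y i (\<sigma>' i) = shapley G y i) \<and> \<delta> \<in> max_policies G})" .
    obtain \<delta>' where \<delta>': "\<delta>' \<in> max_policies G" and opt: "\<And>i k a. i < n \<Longrightarrow> k < n \<Longrightarrow> a \<in> min_actions G k \<Longrightarrow>
        local_value G y i a (\<delta>' (i, a)) = max_value G y i a"
      by (rule max_policies_ex[where G = G and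
            P = "\<lambda>i a b. local_value G y i a b = max_value G y i a"]) (use arg_max in auto)
    obtain \<sigma>' where \<sigma>': "\<sigma>' \<in> min_policies G" "\<And>i. i < n \<Longrightarrow> max_value G y i (\<sigma>' i) = shapley G y i"
      by (rule min_policies_ex[where G = G and
            P = "\<lambda>i a. max_value G y i a = shapley G y i"]) (use arg_min in auto)
    have "\<forall>i<n. \<forall>a\<in>min_actions G i. local_value G y i a (\<delta>' (i, a)) = max_value G y i a"
      using opt by blast
    then have "Q \<noteq> {}" unfolding Q' using \<delta>' \<sigma>' by auto
    with Q show ?thesis by blast
  next
    case (Done \<sigma> \<delta> e v)
    then show ?thesis using q by (auto simp: solved_def)
  qed
qed

text \<open>A single potential for the whole run replaces nested counting: it falls with every step,
  so its initial value bounds the number of steps under all nondeterministic choices.\<close>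

lemma run_bounds:
  assumes L: "\<gamma> ^ L < 1 - \<gamma>" and q: "q \<in> start (hoffman_karp S) G"
    and run: "(step (hk_control S G) ^^ k) (q, game_data G, 0) (q', m, t)"
  shows "invariant q' m" "k \<le> L * num_triples * (L * num_triples + 2) + (L * num_triples + 2)"
    "t \<le> k * step_time"
proof -
  let ?B = "L * num_triples"
  define ranks where "ranks \<sigma> \<rho> \<longleftrightarrow> (\<forall>\<pi>. \<rho> \<pi> \<le> ?B) \<and>
    (\<forall>\<delta> \<delta>' \<eta> y. \<delta> \<in> max_policies G \<longrightarrow> \<delta>' \<in> max_policies G \<longrightarrow> evaluates \<sigma> \<delta> \<eta> y \<longrightarrow>
      (\<forall>i<n. local_value G y i (\<sigma> i) (\<delta>' (i, \<sigma> i)) = max_value G y i (\<sigma> i)) \<longrightarrow>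
      \<not> (\<forall>i<n. local_value G y i (\<sigma> i) (\<delta> (i, \<sigma> i)) = max_value G y i (\<sigma> i)) \<longrightarrow>
      \<rho> (\<lambda>i. \<delta>' (i, \<sigma> i)) < \<rho> (\<lambda>i. \<delta> (i, \<sigma> i)))" for \<sigma> and \<rho> :: "(nat \<Rightarrow> nat) \<Rightarrow> nat"
  \<comment> \<open>Every \<open>\<sigma>\<close> needs an inner rank of its own, as the inner
    problem and its optimum depend on \<open>\<sigma>\<close>; a choice function collects them
    afterwards.\<close>
  have "\<exists>\<rho>. ranks \<sigma> \<rho>"
    if \<sigma>: "\<sigma> \<in> min_policies G" for \<sigma>
  proof (rule inner_rank[OF \<sigma> L], goal_cases)
    case (1 \<rho>)
    have "\<rho> \<pi> \<le> ?B" for \<pi>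
      using 1(1)[of \<pi>] mult_le_mono2[OF num_triples_ge(3), of L] by linarith
    moreover have "\<rho> (\<lambda>i. \<delta>' (i, \<sigma> i)) < \<rho> (\<lambda>i. \<delta> (i, \<sigma> i))"
      if "\<delta> \<in> max_policies G" "\<delta>' \<in> max_policies G" "evaluates \<sigma> \<delta> \<eta> y"
        "\<forall>i<n. local_value G y i (\<sigma> i) (\<delta>' (i, \<sigma> i)) = max_value G y i (\<sigma> i)"
        "\<not> (\<forall>i<n. local_value G y i (\<sigma> i) (\<delta> (i, \<sigma> i)) = max_value G y i (\<sigma> i))" for \<delta> \<delta>' \<eta> y
      by (rule 1(2)[where \<eta> = \<eta> and v = y])
        (use that max_policiesD min_policiesD[OF \<sigma>] in \<open>auto simp: evaluates_def\<close>)
    ultimately show ?case unfolding ranks_def by blast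
  qed
  then have "\<forall>\<sigma>\<in>min_policies G. \<exists>\<rho>. ranks \<sigma> \<rho>" by blast
  from bchoice[OF this] obtain \<rho>i where \<rho>i_ranks: "\<And>\<sigma>. \<sigma> \<in> min_policies G \<Longrightarrow> ranks \<sigma> (\<rho>i \<sigma>)" by blast
  have \<rho>i_le: "\<And>\<sigma> \<pi>. \<sigma> \<in> min_policies G \<Longrightarrow> \<rho>i \<sigma> \<pi> \<le> ?B" and
    \<rho>i: "\<And>\<sigma> \<delta> \<delta>' \<eta> y. \<sigma> \<in> min_policies G \<Longrightarrow> \<delta> \<in> max_policies G \<Longrightarrow> \<delta>' \<in> max_policies G \<Longrightarrow>
      evaluates \<sigma> \<delta> \<eta> y \<Longrightarrow>
      \<forall>i<n. local_value G y i (\<sigma> i) (\<delta>' (i, \<sigma> i)) = max_value G y i (\<sigma> i) \<Longrightarrow>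
      \<not> (\<forall>i<n. local_value G y i (\<sigma> i) (\<delta> (i, \<sigma> i)) = max_value G y i (\<sigma> i)) \<Longrightarrow>
      \<rho>i \<sigma> (\<lambda>i. \<delta>' (i, \<sigma> i)) < \<rho>i \<sigma> (\<lambda>i. \<delta> (i, \<sigma> i))"
    using \<rho>i_ranks unfolding ranks_def by blast+
  have "\<exists>\<rho> :: (nat \<Rightarrow> nat) \<Rightarrow> nat. (\<forall>\<sigma>. \<rho> \<sigma> \<le> ?B) \<and>
    (\<forall>\<sigma> \<sigma>' \<eta> y. \<sigma> \<in> min_policies G \<longrightarrow> \<sigma>' \<in> min_policies G \<longrightarrow> y c = 0 \<longrightarrow>
      (\<forall>i<n. \<eta> + y i = max_value G y i (\<sigma> i)) \<longrightarrow> (\<forall>i<n. max_value G y i (\<sigma>' i) = shapley G y i) \<longrightarrow>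
      \<not> (\<forall>i<n. max_value G y i (\<sigma> i) = shapley G y i) \<longrightarrow> \<rho> \<sigma>' < \<rho> \<sigma>)"
  proof (rule outer_rank[OF L], goal_cases)
    case (1 \<rho>)
    have "\<rho> \<sigma> \<le> ?B" for \<sigma>
      using 1(1)[of \<sigma>] mult_le_mono2[OF num_triples_ge(2), of L] by linarith
    moreover have "\<rho> \<sigma>' < \<rho> \<sigma>"
      if "\<sigma> \<in> min_policies G" "\<sigma>' \<in> min_policies G" "y c = 0"
        "\<forall>i<n. \<eta> + y i = max_value G y i (\<sigma> i)" "\<forall>i<n. max_value G y i (\<sigma>' i) = shapley G y i"
        "\<not> (\<forall>i<n. max_value G y i (\<sigma> i) = shapley G y i)" for \<sigma> \<sigma>' \<eta> y
      by (rule 1(2)[where \<eta> = \<eta> and v = y]) (use that min_policiesD in auto)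
    ultimately show ?case by blast
  qed
  then obtain \<rho>o where \<rho>o_le: "\<And>\<sigma>. \<rho>o \<sigma> \<le> ?B" and
    \<rho>o: "\<And>\<sigma> \<sigma>' \<eta> y. \<sigma> \<in> min_policies G \<Longrightarrow> \<sigma>' \<in> min_policies G \<Longrightarrow> y c = 0 \<Longrightarrow>
      \<forall>i<n. \<eta> + y i = max_value G y i (\<sigma> i) \<Longrightarrow> \<forall>i<n. max_value G y i (\<sigma>' i) = shapley G y i \<Longrightarrow>
      \<not> (\<forall>i<n. max_value G y i (\<sigma> i) = shapley G y i) \<Longrightarrow> \<rho>o \<sigma>' < \<rho>o \<sigma>"
    by blast
  \<comment> \<open>The inner part ranges from 2 to \<open>?B + 2\<close>, which places
    \<open>Improve\<close> below every \<open>Evaluate\<close> with the same \<open>\<sigma>\<close>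
    and above \<open>Done\<close>. A drop of \<open>\<rho>o\<close> by one frees
    \<open>?B + 2\<close>, enough to pay for an arbitrary new inner policy.\<close>
  define rank where "rank q = (case q of
      Evaluate \<sigma> \<delta> \<Rightarrow> \<rho>o \<sigma> * (?B + 2) + \<rho>i \<sigma> (\<lambda>i. \<delta> (i, \<sigma> i)) + 2
    | Improve \<sigma> e v \<Rightarrow> \<rho>o \<sigma> * (?B + 2) + 1
    | Done \<sigma> \<delta> e v \<Rightarrow> 0)" for q
  have step: "invariant q' m' \<and> rank q' < rank q \<and> t' \<le> t + step_time"
    if inv: "invariant q m" and st: "step (hk_control S G) (q, m, t) (q', m', t')" for q m t q' m' t'
  proof (cases q)
    case (Evaluate \<sigma> \<delta>)
    have m: "loaded m" "\<forall>x\<in>set m. small x" and s: "\<sigma> \<in> min_policies G" "\<delta> \<in> max_policies G"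
      using inv by (auto simp: invariant_def Evaluate)
    obtain Q where Q: "q' \<in> Q" and m': "loaded m'" "\<forall>x\<in>set m'. small x" and t: "t' \<le> t + step_time"
      and ex: "\<exists>e v y. e < length m' \<and> stores v y m' \<and> evaluates \<sigma> \<delta> (m' ! e) y \<and>
       Q = (if \<forall>i<n. local_value G y i (\<sigma> i) (\<delta> (i, \<sigma> i)) = max_value G y i (\<sigma> i) then {Improve \<sigma> e v}
         else {Evaluate \<sigma> \<delta>' | \<delta>'. \<delta>' \<in> max_policies G \<and>
           (\<forall>i<n. local_value G y i (\<sigma> i) (\<delta>' (i, \<sigma> i)) = max_value G y i (\<sigma> i))})"
      by (rule run_step_invariant[OF runs_Evaluate[OF s m(1)] st[unfolded Evaluate] m])
    from ex obtain e v y where e: "e < length m'" and v: "stores v y m'" and y: "evaluates \<sigma> \<delta> (m' ! e) y"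
      and Q_eq: "Q = (if \<forall>i<n. local_value G y i (\<sigma> i) (\<delta> (i, \<sigma> i)) = max_value G y i (\<sigma> i) then {Improve \<sigma> e v}
         else {Evaluate \<sigma> \<delta>' | \<delta>'. \<delta>' \<in> max_policies G \<and>
           (\<forall>i<n. local_value G y i (\<sigma> i) (\<delta>' (i, \<sigma> i)) = max_value G y i (\<sigma> i))})"
      by (elim exE conjE) (rule that)
    note Q' = Q[unfolded Q_eq]
    show ?thesis
    proof (cases "\<forall>i<n. local_value G y i (\<sigma> i) (\<delta> (i, \<sigma> i)) = max_value G y i (\<sigma> i)")
      case True
      then have q': "q' = Improve \<sigma> e v" using Q' by simp
      have "state_invariant q' m'"
        using e v y s True by (auto simp: q' evaluates_def)
      moreover have "rank q' < rank q" by (simp add: rank_def q' Evaluate)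
      ultimately show ?thesis using m' t by (simp add: invariant_def)
    next
      case False
      obtain \<delta>' where q': "q' = Evaluate \<sigma> \<delta>'" and \<delta>': "\<delta>' \<in> max_policies G"
        "\<forall>i<n. local_value G y i (\<sigma> i) (\<delta>' (i, \<sigma> i)) = max_value G y i (\<sigma> i)"
        using Q'[unfolded if_not_P[OF False]] by blast
      have "rank q' < rank q"
        using \<rho>i[OF s(1,2) \<delta>'(1) y \<delta>'(2) False] by (simp add: rank_def q' Evaluate)
      then show ?thesis using m' t s \<delta>' by (simp add: invariant_def q')
    qed
  next
    case (Improve \<sigma> e v)
    then obtain y where m: "loaded m" "\<forall>x\<in>set m. small x" and s: "\<sigma> \<in> min_policies G"
      and e: "e < length m" and v: "stores v y m" "moderate y"
      and y: "y c = 0" "\<forall>i<n. m ! e + y i = max_value G y i (\<sigma> i)"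
      using inv by (auto simp: invariant_def)
    obtain Q where Q: "q' \<in> Q" and m': "loaded m'" "\<forall>x\<in>set m'. small x" "prefix m m'"
      and t: "t' \<le> t + step_time"
      and Q_eq: "Q = (if \<forall>i<n. max_value G y i (\<sigma> i) = shapley G y i
         then {Done \<sigma> \<delta> e v | \<delta>. \<delta> \<in> max_policies G \<and>
           (\<forall>i<n. \<forall>a\<in>min_actions G i. local_value G y i a (\<delta> (i, a)) = max_value G y i a)}
         else {Evaluate \<sigma>' \<delta> | \<sigma>' \<delta>. \<sigma>' \<in> min_policies G \<and>
           (\<forall>i<n. max_value G y i (\<sigma>' i) = shapley G y i) \<and> \<delta> \<in> max_policies G})"
      by (rule run_step_invariant[OF runs_Improve[OF m(1) v s] st[unfolded Improve] m])
    note Q' = Q[unfolded Q_eq]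
    show ?thesis
    proof (cases "\<forall>i<n. max_value G y i (\<sigma> i) = shapley G y i")
      case True
      obtain \<delta> where q': "q' = Done \<sigma> \<delta> e v" and \<delta>: "\<delta> \<in> max_policies G"
        "\<forall>i<n. \<forall>a\<in>min_actions G i. local_value G y i a (\<delta> (i, a)) = max_value G y i a"
        using Q'[unfolded if_P[OF True]] by blast
      have eq: "m ! e + y i = shapley G y i" if "i < n" for i using y(2) True that by simp
      have "solution G (m ! e) y \<sigma> \<delta>"
        unfolding solution_def using eq ergodic_equation_value[OF valid eq] True s y \<delta> by simp
      moreover have m'v: "y i = m' ! v i" if "i < n" for i
        using stores_prefix[OF v(1) m'(3)] that by (simp add: stores_def)
      ultimately have "solution G (m' ! e) (\<lambda>i. m' ! v i) \<sigma> \<delta>"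
        using prefix_nth[OF m'(3) e] value_cong[of y "\<lambda>i. m' ! v i", OF m'v] c
        unfolding solution_def by simp
      then show ?thesis using m' t by (simp add: invariant_def rank_def q' Improve)
    next
      case False
      obtain \<sigma>' \<delta> where q': "q' = Evaluate \<sigma>' \<delta>" and \<sigma>': "\<sigma>' \<in> min_policies G"
        "\<forall>i<n. max_value G y i (\<sigma>' i) = shapley G y i" and \<delta>: "\<delta> \<in> max_policies G"
        using Q'[unfolded if_not_P[OF False]] by blast
      have "Suc (\<rho>o \<sigma>') \<le> \<rho>o \<sigma>" using \<rho>o[OF s \<sigma>'(1) y \<sigma>'(2) False] by simp
      then have "Suc (\<rho>o \<sigma>') * (?B + 2) \<le> \<rho>o \<sigma> * (?B + 2)" by (rule mult_le_mono1)
      then have "rank q' < rank q"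
        using \<rho>i_le[OF \<sigma>'(1), of "\<lambda>i. \<delta> (i, \<sigma>' i)"] by (simp add: rank_def q' Improve)
      then show ?thesis using m' t \<sigma>' \<delta> by (simp add: invariant_def q')
    qed
  next
    case (Done \<sigma> \<delta> e v)
    then show ?thesis using st by simp
  qed
  have init: "invariant q (game_data G)"
  proof -
    have "small x" if "x \<in> set (game_data G)" for x
      using that bit_size_game_data[OF that]
      by (intro smallI[of input_size input_size] bit_size_imp_rat_bounded)
        (auto simp: number_size_def)
    then show ?thesis using q by (auto simp: invariant_def loaded_def hoffman_karp_def)
  qed
  have *: "invariant q' m \<and> rank q' + k \<le> rank q \<and> t \<le> k * step_time"
    using run
  proof (induction k arbitrary: q' m t)
    case 0
    then show ?case using init by simp
  next
    case (Suc k)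
    then obtain q1 m1 t1 where 1: "(step (hk_control S G) ^^ k) (q, game_data G, 0) (q1, m1, t1)"
      and 2: "step (hk_control S G) (q1, m1, t1) (q', m, t)"
      by (metis relpowp_Suc_E prod_cases3)
    show ?case using Suc.IH[OF 1] step[OF _ 2] by force
  qed
  then show "invariant q' m" "t \<le> k * step_time" by auto
  obtain \<sigma> \<delta> where "q = Evaluate \<sigma> \<delta>" "\<sigma> \<in> min_policies G" using q by (auto simp: hoffman_karp_def)
  then have "rank q \<le> ?B * (?B + 2) + (?B + 2)"
    using \<rho>i_le[of \<sigma> "\<lambda>i. \<delta> (i, \<sigma> i)"] mult_le_mono1[OF \<rho>o_le[of \<sigma>], of "?B + 2"]
    by (simp add: rank_def)
  then show "k \<le> ?B * (?B + 2) + (?B + 2)" using * by linarith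
qed

end

theorem corollary17:
  fixes K :: real and S :: linear_solver
  assumes "1 \<le> K"
    and "strongly_polynomial_solver S"
  shows "solves_in_strongly_polynomial_time (hoffman_karp S) game_data_count solved
           (bounded_return_games K)"
proof -
  obtain ps bs where S: "solver_within S ps bs"
    using assms(2) by (auto simp: strongly_polynomial_solver_iff)
  \<comment> \<open>\<open>L\<close> is chosen from \<open>K\<close> alone, before any game is
    given, and so may enter the polynomials as a constant.\<close>
  obtain L where L: "(1 - 1 / K) ^ L < 1 - (1 - 1 / K)"
    using real_arch_pow_inv[of "1 - (1 - 1 / K)" "1 - 1 / K"] assms(1) by auto
  define X where "X = ([:0, 1:] :: nat poly)"
  \<comment> \<open>\<open>[:2, L:]\<close> is the polynomial \<open>L * X + 2\<close>; the two
    summands bound the outer and the inner part of the initial rank.\<close>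
  define steps where "steps = [:0, L:] * [:2, L:] + [:2, L:]"
  define max_p where "max_p = X * (X * 2 + 2)"
  define min_p where "min_p = X * (max_p + 2)"
  \<comment> \<open>Composition with \<open>[:1, 1:]\<close> shifts the argument by one, since
    \<open>n\<close> states lead to a system of dimension \<open>Suc n\<close>.\<close>
  define step_p where "step_p = 2 + X * X + pcompose ps [:1, 1:] + X * max_p + X * min_p"
  define sys_p where "sys_p = X * (X + 1) * (3 * X + 4)"
  define val_p where "val_p = pcompose bs sys_p + sys_p"
  define num_p where "num_p = 2 * X + val_p + (X + val_p) * X + 1"
  show ?thesis
    unfolding solves_in_strongly_polynomial_time_def
  \<comment> \<open>The bit polynomial is \<open>P + 2 * Q + 3\<close> from
    \<open>rat_bounded_imp_bit_size\<close> with both exponents equal to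
    \<open>number_size\<close>.\<close>
  proof (rule exI[of _ "steps + steps * step_p"], rule exI[of _ "3 * num_p + 3"], intro ballI allI impI)
    fix G q k q' m t
    assume "G \<in> bounded_return_games K" and q: "q \<in> start (hoffman_karp S) G"
      and run: "(step (control (hoffman_karp S) G) ^^ k) (q, input (hoffman_karp S) G, 0) (q', m, t)"
    then obtain u where "\<And>i. i < states G \<Longrightarrow> 1 \<le> u i \<and> u i \<le> K"
      "\<And>i a b. i < states G \<Longrightarrow> a \<in> min_actions G i \<Longrightarrow> b \<in> max_actions G i \<Longrightarrow>
      1 + (\<Sum>j\<in>{..<states G} - {centre G}. trans G i a b j * u j) \<le> u i"
      using bounded_return_weight by blast
    then interpret hk_game G K u S ps bs
      using S \<open>G \<in> bounded_return_games K\<close>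
      by unfold_locales (auto simp: bounded_return_games_def)
    let ?N = "game_data_count G"
    have run': "(step (hk_control S G) ^^ k) (q, game_data G, 0) (q', m, t)"
      using run by (simp add: hoffman_karp_def)
    note bounds = run_bounds[OF L q run']
    have le: "n \<le> ?N" "num_triples \<le> ?N" by (auto simp: game_data_count_def)
    have X: "poly X x = x" for x by (simp add: X_def)
    have max_le: "max_time \<le> poly max_p ?N"
      unfolding max_time_def max_p_def poly_add poly_mult poly_numeral X using le
      by (intro mult_le_mono add_mono) auto
    have min_le: "min_time \<le> poly min_p ?N"
      unfolding min_time_def min_p_def poly_add poly_mult poly_numeral X using le max_le
      by (intro mult_le_mono add_mono) auto
    have step_le: "step_time \<le> poly step_p ?N"
      unfolding step_time_def step_p_def poly_add poly_mult poly_pcompose X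
      using le max_le min_le poly_nat_mono[of "Suc n" "Suc ?N" ps]
      by (intro add_mono mult_le_mono) auto
    have "L * num_triples * (L * num_triples + 2) + (L * num_triples + 2) \<le>
        L * ?N * (L * ?N + 2) + (L * ?N + 2)"
      using le by (intro add_mono mult_le_mono) auto
    also have "\<dots> = poly steps ?N" by (simp add: steps_def algebra_simps)
    finally have k: "k \<le> poly steps ?N" using bounds(2) by simp
    have t: "t \<le> poly steps ?N * poly step_p ?N"
      using bounds(3) mult_le_mono[OF k step_le] by simp
    have bits: "x \<in> \<rat> \<and> bit_size x \<le> poly (3 * num_p + 3) input_size" if "x \<in> set m" rational for x
    proof -
      have "poly num_p input_size = number_size"
        by (simp add: num_p_def val_p_def sys_p_def number_size_def value_size_def system_size_def
            poly_pcompose X)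
      then have num: "poly (3 * num_p + 3) input_size = 3 * number_size + 3" by simp
      have "rat_bounded number_size number_size x"
        using bounds(1) that by (auto simp: invariant_def small_def)
      from rat_bounded_imp_bit_size[OF this] show ?thesis unfolding num by simp
    qed
    show "k \<le> poly (steps + steps * step_p) ?N \<and> t \<le> poly (steps + steps * step_p) ?N \<and>
        (set (input (hoffman_karp S) G) \<subseteq> \<rat> \<longrightarrow> (\<forall>x\<in>set m. x \<in> \<rat> \<and>
          bit_size x \<le> poly (3 * num_p + 3) (sum_list (map bit_size (input (hoffman_karp S) G))))) \<and>
        ((\<nexists>s. step (control (hoffman_karp S) G) (q', m, t) s) \<longrightarrow> solved G q' m)"
    proof (intro conjI impI ballI)
      show "k \<le> poly (steps + steps * step_p) ?N" "t \<le> poly (steps + steps * step_p) ?N"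
        using k t by (simp_all add: trans_le_add1 trans_le_add2)
      show "x \<in> \<rat>" "bit_size x \<le> poly (3 * num_p + 3) (sum_list (map bit_size (input (hoffman_karp S) G)))"
        if "set (input (hoffman_karp S) G) \<subseteq> \<rat>" "x \<in> set m" for x
        using bits[OF that(2)] that(1) by (auto simp: hoffman_karp_def)
      show "solved G q' m" if "\<nexists>s. step (control (hoffman_karp S) G) (q', m, t) s"
      proof (rule not_stuck[OF bounds(1)])
        have "control (hoffman_karp S) G = hk_control S G" by (simp add: hoffman_karp_def)
        then show "\<not> step (hk_control S G) (q', m, t) s" for s using that by metis
      qed
    qed
  qed
qed

end
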